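(* Let $G$ be a semisimple, simply connected linear algebraic group over an algebraically closed field $K$ of characteristic $p>0$, with Coxeter number $h$. Assume that $p\ge 2h-2$, or that if $p<2h-2$ then $\widehat{\mathrm Q}_1(\mu)$ has a unique $G$-module structure for all $\mu\in X_1$. Let $(I_j)_{j\ge 0}=(I_0,I_1,\dots,I_m)$ be a finite sequence of members of $\mathfrak F$. If each $I_j$ has simple $G_1T$-socle with restricted highest weight, then the twisted tensor product $\bigotimes_{j\ge 0} I_j^{[j]}$ is indecomposable as a $G$-module.
   Context: Fix a Borel subgroup $B$ and a maximal torus $T\subset B\subset G$, with $B$ determining the negative roots. $X=X(T)$ is the character group, $X^+$ the set of dominant weights, and $X_1=\{\nu\in X^+\mid \langle\alpha^\vee,\nu\rangle\le p-1 \text{ for all simple roots }\alpha\}$ is the set of restricted weights. $G$-modules are rational modules. $L(\lambda)$ is the simple $G$-module of highest weight $\lambda\in X^+$. $M^{[j]}$ denotes the twist of a $G$-module $M$ by the $j$th power of the Frobenius endomorphism of $G$. $\mathfrak F=\mathfrak F(G)$ is the set of isomorphism classes of indecomposable $G$-module direct summands of tensor products $L(\lambda)\otimes L(\mu)$ with $\lambda,\mu\in X_1$. $G_1$ is the kernel of the Frobenius endomorphism and $G_1T$ is the inverse image of $T$ under Frobenius. $\widehat{\mathrm Q}_1(\mu)$ is the $G_1T$-injective hull of $L(\mu)$ for $\mu\in X_1$. "$\widehat{\mathrm Q}_1(\mu)$ has a unique $G$-module structure" means that its $G_1T$-structure extends to a $G$-module structure, and any two such $G$-module structures are equivalent. "$I_j$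 has simple $G_1T$-socle with restricted highest weight" means that the socle of $I_j$ restricted to $G_1T$ is isomorphic to $L(\mu)|_{G_1T}$ for some $\mu\in X_1$. *)

theory Defs
  imports
    "HOL-Algebra.Solvable_Groups"
    "HOL-Computational_Algebra.Polynomial"
    "Jordan_Normal_Form.Determinant"
    "Jordan_Normal_Form.VS_Connect"
begin

section \<open>Linear algebraic groups\<close>

text \<open>
  A linear algebraic group is a Zariski closed subgroup of \<open>GL\<^sub>n(K)\<close>; the dimension \<open>n\<close> of the
  ambient matrix group is passed along explicitly.
\<close>

definition GL :: "nat \<Rightarrow> 'k::field mat monoid" where
  "GL n = units_of (ring_mat TYPE('k) n ())"

text \<open>The functions in \<open>K[GL\<^sub>n] = K[x\<^sub>i\<^sub>j, 1/det]\<close>.\<close>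

inductive_set GL_functions :: "nat \<Rightarrow> ('k::field mat \<Rightarrow> 'k) set" for n where
  const: "(\<lambda>g. c) \<in> GL_functions n"
| entry: "i < n \<Longrightarrow> j < n \<Longrightarrow> (\<lambda>g. g $$ (i, j)) \<in> GL_functions n"
| inv_det: "(\<lambda>g. inverse (det g)) \<in> GL_functions n"
| add: "a \<in> GL_functions n \<Longrightarrow> b \<in> GL_functions n \<Longrightarrow> (\<lambda>g. a g + b g) \<in> GL_functions n"
| mult: "a \<in> GL_functions n \<Longrightarrow> b \<in> GL_functions n \<Longrightarrow> (\<lambda>g. a g * b g) \<in> GL_functions n"

definition zariski_closed :: "nat \<Rightarrow> 'k::field mat set \<Rightarrow> bool" where
  "zariski_closed n S \<longleftrightarrow>
    (\<exists>P \<subseteq> GL_functions n. S = {g \<in> carrier (GL n). \<forall>f\<in>P. f g = 0})"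

text \<open>
  The coordinate ring \<open>K[G]\<close>. Its elements are represented by functions on all matrices, two of
  which represent the same element iff they agree on \<open>G\<close>.
\<close>

definition regular :: "nat \<Rightarrow> 'k::field mat set \<Rightarrow> ('k mat \<Rightarrow> 'k) \<Rightarrow> bool" where
  "regular n G f \<longleftrightarrow> (\<exists>r \<in> GL_functions n. \<forall>g\<in>G. f g = r g)"

definition closed_subgroup :: "nat \<Rightarrow> 'k::field mat set \<Rightarrow> bool" where
  "closed_subgroup n G \<longleftrightarrow> subgroup G (GL n) \<and> zariski_closed n G"

definition zariski_connected :: "nat \<Rightarrow> 'k::field mat set \<Rightarrow> bool" where
  "zariski_connected n G \<longleftrightarrow>
    \<not> (\<exists>A B. zariski_closed n A \<and> zariski_closed n B \<and> A \<noteq> {} \<and> B \<noteq> {} \<and>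
          A \<inter> B = {} \<and> A \<union> B = G)"

text \<open>Homomorphisms and isomorphisms of algebraic groups, from \<open>G \<le> GL\<^sub>n\<close> to \<open>H \<le> GL\<^sub>m\<close>.\<close>

definition alg_hom ::
  "nat \<Rightarrow> 'k::field mat set \<Rightarrow> nat \<Rightarrow> 'k mat set \<Rightarrow> ('k mat \<Rightarrow> 'k mat) \<Rightarrow> bool" where
  "alg_hom n G m H \<phi> \<longleftrightarrow>
    \<phi> \<in> hom (GL n\<lparr>carrier := G\<rparr>) (GL m\<lparr>carrier := H\<rparr>) \<and>
    (\<forall>i<m. \<forall>j<m. regular n G (\<lambda>g. \<phi> g $$ (i, j)))"

definition alg_iso ::
  "nat \<Rightarrow> 'k::field mat set \<Rightarrow> nat \<Rightarrow> 'k mat set \<Rightarrow> ('k mat \<Rightarrow> 'k mat) \<Rightarrow> bool" where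
  "alg_iso n G m H \<phi> \<longleftrightarrow> alg_hom n G m H \<phi> \<and>
    (\<exists>\<psi>. alg_hom m H n G \<psi> \<and> (\<forall>g\<in>G. \<psi> (\<phi> g) = g) \<and> (\<forall>h\<in>H. \<phi> (\<psi> h) = h))"

definition semisimple :: "nat \<Rightarrow> 'k::field mat set \<Rightarrow> bool" where
  "semisimple n G \<longleftrightarrow> closed_subgroup n G \<and> zariski_connected n G \<and>
    (\<forall>N. N \<lhd> (GL n\<lparr>carrier := G\<rparr>) \<and> closed_subgroup n N \<and> zariski_connected n N \<and>
         solvable (GL n\<lparr>carrier := N\<rparr>) \<longrightarrow> N = {1\<^sub>m n})"

definition torus :: "nat \<Rightarrow> 'k::field mat set \<Rightarrow> bool" where
  "torus n T \<longleftrightarrow> closed_subgroup n T \<and>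
    (\<exists>r \<phi>. alg_iso n T r {A \<in> carrier (GL r). diagonal_mat A} \<phi>)"

definition maximal_torus :: "nat \<Rightarrow> 'k::field mat set \<Rightarrow> 'k mat set \<Rightarrow> bool" where
  "maximal_torus n G T \<longleftrightarrow> torus n T \<and> T \<subseteq> G \<and>
    (\<forall>S. torus n S \<and> S \<subseteq> G \<and> T \<subseteq> S \<longrightarrow> S = T)"

definition connected_solvable :: "nat \<Rightarrow> 'k::field mat set \<Rightarrow> bool" where
  "connected_solvable n B \<longleftrightarrow> closed_subgroup n B \<and> zariski_connected n B \<and>
    solvable (GL n\<lparr>carrier := B\<rparr>)"

definition borel_subgroup :: "nat \<Rightarrow> 'k::field mat set \<Rightarrow> 'k mat set \<Rightarrow> bool" where
  "borel_subgroup n G B \<longleftrightarrow> connected_solvable n B \<and> B \<subseteq> G \<and>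
    (\<forall>S. connected_solvable n S \<and> S \<subseteq> G \<and> B \<subseteq> S \<longrightarrow> S = B)"


section \<open>Roots and weights\<close>

text \<open>
  The character group \<open>X(T)\<close> is written multiplicatively, with pointwise operations. Characters are
  given the value \<open>1\<close> outside \<open>T\<close>, so that equality of characters is equality of functions.
\<close>

definition characters :: "nat \<Rightarrow> 'k::field mat set \<Rightarrow> ('k mat \<Rightarrow> 'k) set" where
  "characters n T = {\<chi>. regular n T \<chi> \<and> (\<forall>t\<in>T. \<chi> t \<noteq> 0) \<and>
     (\<forall>s\<in>T. \<forall>t\<in>T. \<chi> (s * t) = \<chi> s * \<chi> t) \<and> (\<forall>g. g \<notin> T \<longrightarrow> \<chi> g = 1)}"

text \<open>The Lie algebra of \<open>G\<close>, as the space of point derivations of \<open>K[G]\<close> at the identity.\<close>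

definition point_derivation ::
  "nat \<Rightarrow> 'k::field mat set \<Rightarrow> (('k mat \<Rightarrow> 'k) \<Rightarrow> 'k) \<Rightarrow> bool" where
  "point_derivation n G \<delta> \<longleftrightarrow>
    (\<forall>f f'. regular n G f \<and> regular n G f' \<longrightarrow>
       ((\<forall>g\<in>G. f g = f' g) \<longrightarrow> \<delta> f = \<delta> f') \<and>
       \<delta> (\<lambda>g. f g + f' g) = \<delta> f + \<delta> f' \<and>
       \<delta> (\<lambda>g. f g * f' g) = f (1\<^sub>m n) * \<delta> f' + \<delta> f * f' (1\<^sub>m n)) \<and>
    (\<forall>c f. regular n G f \<longrightarrow> \<delta> (\<lambda>g. c * f g) = c * \<delta> f)"

text \<open>
  The nonzero weights of \<open>T\<close> on \<open>Lie(G)\<close>. The adjoint action sends \<open>\<delta>\<close> to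
  \<open>f \<mapsto> \<delta> (g \<mapsto> f (t g t\<^sup>-\<^sup>1))\<close>.
\<close>

definition roots :: "nat \<Rightarrow> 'k::field mat set \<Rightarrow> 'k mat set \<Rightarrow> ('k mat \<Rightarrow> 'k) set" where
  "roots n G T = {\<alpha> \<in> characters n T. \<alpha> \<noteq> (\<lambda>g. 1) \<and>
     (\<exists>\<delta>. point_derivation n G \<delta> \<and> (\<exists>f. regular n G f \<and> \<delta> f \<noteq> 0) \<and>
        (\<forall>t\<in>T. \<forall>f. regular n G f \<longrightarrow>
           \<delta> (\<lambda>g. f (t * g * inv\<^bsub>GL n\<^esub> t)) = \<alpha> t * \<delta> f))}"

text \<open>\<open>B\<close> determines the negative roots, so the positive ones are the inverses of those of \<open>B\<close>.\<close>

definition positive_roots ::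
  "nat \<Rightarrow> 'k::field mat set \<Rightarrow> 'k mat set \<Rightarrow> ('k mat \<Rightarrow> 'k) set" where
  "positive_roots n B T = (\<lambda>\<alpha> g. inverse (\<alpha> g)) ` roots n B T"

definition simple_roots ::
  "nat \<Rightarrow> 'k::field mat set \<Rightarrow> 'k mat set \<Rightarrow> ('k mat \<Rightarrow> 'k) set" where
  "simple_roots n B T = {\<alpha> \<in> positive_roots n B T.
     \<not> (\<exists>\<beta> \<in> positive_roots n B T. \<exists>\<gamma> \<in> positive_roots n B T. \<alpha> = (\<lambda>g. \<beta> g * \<gamma> g))}"

text \<open>
  The coroot \<open>\<alpha>\<^sup>\<or>\<close>, as an element \<open>\<lambda> \<mapsto> \<langle>\<lambda>, \<alpha>\<^sup>\<or>\<rangle>\<close> of \<open>Hom(X(T), \<int>) = Y(T)\<close>: the additive function with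
  \<open>\<langle>\<alpha>, \<alpha>\<^sup>\<or>\<rangle> = 2\<close> whose reflection \<open>\<beta> \<mapsto> \<beta> - \<langle>\<beta>, \<alpha>\<^sup>\<or>\<rangle> \<alpha>\<close> preserves the set of roots. It is unique
  because the roots of a semisimple group form a finite set spanning \<open>X(T) \<otimes> \<rat>\<close>. The last clause
  only fixes the value of the HOL function outside \<open>X(T)\<close>.
\<close>

definition coroot ::
  "nat \<Rightarrow> 'k::field mat set \<Rightarrow> 'k mat set \<Rightarrow> ('k mat \<Rightarrow> 'k) \<Rightarrow> ('k mat \<Rightarrow> 'k) \<Rightarrow> int" where
  "coroot n G T \<alpha> = (THE c.
     (\<forall>\<chi> \<in> characters n T. \<forall>\<psi> \<in> characters n T. c (\<lambda>g. \<chi> g * \<psi> g) = c \<chi> + c \<psi>) \<and>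
     c \<alpha> = 2 \<and>
     (\<forall>\<beta> \<in> roots n G T. (\<lambda>g. \<beta> g * \<alpha> g powi (- c \<beta>)) \<in> roots n G T) \<and>
     (\<forall>\<chi>. \<chi> \<notin> characters n T \<longrightarrow> c \<chi> = 0))"

text \<open>A semisimple group is simply connected if \<open>X(T)\<close> is the full weight lattice.\<close>

definition simply_connected ::
  "nat \<Rightarrow> 'k::field mat set \<Rightarrow> 'k mat set \<Rightarrow> 'k mat set \<Rightarrow> bool" where
  "simply_connected n G B T \<longleftrightarrow>
    (\<forall>d :: ('k mat \<Rightarrow> 'k) \<Rightarrow> int. \<exists>\<omega> \<in> characters n T.
       \<forall>\<alpha> \<in> simple_roots n B T. coroot n G T \<alpha> \<omega> = d \<alpha>)"

definition dominant_weights ::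
  "nat \<Rightarrow> 'k::field mat set \<Rightarrow> 'k mat set \<Rightarrow> 'k mat set \<Rightarrow> ('k mat \<Rightarrow> 'k) set" where
  "dominant_weights n G B T =
     {\<nu> \<in> characters n T. \<forall>\<alpha> \<in> simple_roots n B T. 0 \<le> coroot n G T \<alpha> \<nu>}"

definition restricted_weights ::
  "nat \<Rightarrow> 'k::field mat set \<Rightarrow> 'k mat set \<Rightarrow> 'k mat set \<Rightarrow> ('k mat \<Rightarrow> 'k) set" where
  "restricted_weights n G B T = {\<nu> \<in> dominant_weights n G B T.
     \<forall>\<alpha> \<in> simple_roots n B T. coroot n G T \<alpha> \<nu> \<le> int CHAR('k) - 1}"

text \<open>
  The Coxeter number \<open>h = max {\<langle>\<rho>, \<beta>\<^sup>\<or>\<rangle> + 1 | \<beta> > 0}\<close>, where \<open>\<rho>\<close> is half the sum of the positive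
  roots (the convention of Jantzen, Representations of Algebraic Groups, II.6.2). For \<open>G\<close> almost
  simple it is the order of a Coxeter element, in general it is the maximum over the simple factors.
  The inserted \<open>0\<close> matters only if there are no roots.
\<close>

definition coxeter_number ::
  "nat \<Rightarrow> 'k::field mat set \<Rightarrow> 'k mat set \<Rightarrow> 'k mat set \<Rightarrow> int" where
  "coxeter_number n G B T = Max (insert 0
     ((\<lambda>\<beta>. (\<Sum>\<alpha> \<in> positive_roots n B T. coroot n G T \<beta> \<alpha>) div 2) ` positive_roots n B T)) + 1"


section \<open>Rational modules\<close>

text \<open>
  Modules are finite-dimensional and given in coordinates, by matrices acting on \<open>K\<^sup>m\<close> where \<open>m\<close> is
  the degree.
\<close>

datatype 'k rep = Rep (deg: nat) (act: "'k mat \<Rightarrow> 'k mat")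

definition rational_module :: "nat \<Rightarrow> 'k::field mat set \<Rightarrow> 'k rep \<Rightarrow> bool" where
  "rational_module n G M \<longleftrightarrow> alg_hom n G (deg M) (carrier (GL (deg M))) (act M)"

definition rep_iso :: "'k::field mat set \<Rightarrow> 'k rep \<Rightarrow> 'k rep \<Rightarrow> bool" where
  "rep_iso G M N \<longleftrightarrow> deg M = deg N \<and>
    (\<exists>P \<in> carrier (GL (deg M)). \<forall>g\<in>G. P * act M g = act N g * P)"

definition rep_sum :: "'k::field rep \<Rightarrow> 'k rep \<Rightarrow> 'k rep" where
  "rep_sum M N = Rep (deg M + deg N)
     (\<lambda>g. four_block_mat (act M g) (0\<^sub>m (deg M) (deg N)) (0\<^sub>m (deg N) (deg M)) (act N g))"

text \<open>The Kronecker product of matrices, where \<open>e\<^sub>i \<otimes> e\<^sub>j\<close> has index \<open>i * deg N + j\<close>.\<close>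

definition rep_tensor :: "'k::field rep \<Rightarrow> 'k rep \<Rightarrow> 'k rep" where
  "rep_tensor M N = Rep (deg M * deg N)
     (\<lambda>g. mat (deg M * deg N) (deg M * deg N)
        (\<lambda>(i, j). act M g $$ (i div deg N, j div deg N) * act N g $$ (i mod deg N, j mod deg N)))"

definition rep_trivial :: "'k::field rep" where
  "rep_trivial = Rep 1 (\<lambda>g. 1\<^sub>m 1)"

definition rep_tensor_list :: "'k::field rep list \<Rightarrow> 'k rep" where
  "rep_tensor_list Ms = foldr rep_tensor Ms rep_trivial"

definition indecomposable :: "nat \<Rightarrow> 'k::field mat set \<Rightarrow> 'k rep \<Rightarrow> bool" where
  "indecomposable n G M \<longleftrightarrow> rational_module n G M \<and> deg M \<noteq> 0 \<and>
    (\<forall>M1 M2. rational_module n G M1 \<and> rational_module n G M2 \<and> rep_iso G M (rep_sum M1 M2) \<longrightarrow>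
       deg M1 = 0 \<or> deg M2 = 0)"

definition direct_summand :: "nat \<Rightarrow> 'k::field mat set \<Rightarrow> 'k rep \<Rightarrow> 'k rep \<Rightarrow> bool" where
  "direct_summand n G M N \<longleftrightarrow> rational_module n G M \<and>
    (\<exists>M'. rational_module n G M' \<and> rep_iso G N (rep_sum M M'))"

definition simple_module :: "nat \<Rightarrow> 'k::field mat set \<Rightarrow> 'k rep \<Rightarrow> bool" where
  "simple_module n G M \<longleftrightarrow> rational_module n G M \<and> deg M \<noteq> 0 \<and>
    (\<forall>W. subspace class_ring W (module_vec TYPE('k) (deg M)) \<and>
         (\<forall>g\<in>G. \<forall>w\<in>W. act M g *\<^sub>v w \<in> W) \<longrightarrow>
       W = {0\<^sub>v (deg M)} \<or> W = carrier_vec (deg M))"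

definition weights :: "nat \<Rightarrow> 'k::field mat set \<Rightarrow> 'k rep \<Rightarrow> ('k mat \<Rightarrow> 'k) set" where
  "weights n T M = {\<chi> \<in> characters n T.
     \<exists>v \<in> carrier_vec (deg M). v \<noteq> 0\<^sub>v (deg M) \<and> (\<forall>t\<in>T. act M t *\<^sub>v v = \<chi> t \<cdot>\<^sub>v v)}"

text \<open>
  \<open>M\<close> is the simple module \<open>L(\<nu>)\<close>: every weight \<open>\<mu>\<close> satisfies \<open>\<mu> \<le> \<nu>\<close>, i.e. \<open>\<nu> - \<mu>\<close> is a sum of
  positive roots.
\<close>

definition is_L ::
  "nat \<Rightarrow> 'k::field mat set \<Rightarrow> 'k mat set \<Rightarrow> 'k mat set \<Rightarrow> ('k mat \<Rightarrow> 'k) \<Rightarrow> 'k rep \<Rightarrow> bool" where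
  "is_L n G B T \<nu> M \<longleftrightarrow> simple_module n G M \<and> \<nu> \<in> weights n T M \<and>
    (\<forall>\<mu> \<in> weights n T M. \<exists>\<alpha>s. set \<alpha>s \<subseteq> positive_roots n B T \<and>
       \<nu> = (\<lambda>g. \<mu> g * (\<Prod>\<alpha>\<leftarrow>\<alpha>s. \<alpha> g)))"

text \<open>Modules whose isomorphism class belongs to \<open>\<FF>(G)\<close>.\<close>

definition in_F ::
  "nat \<Rightarrow> 'k::field mat set \<Rightarrow> 'k mat set \<Rightarrow> 'k mat set \<Rightarrow> 'k rep \<Rightarrow> bool" where
  "in_F n G B T M \<longleftrightarrow> indecomposable n G M \<and>
    (\<exists>\<nu> \<in> restricted_weights n G B T. \<exists>\<mu> \<in> restricted_weights n G B T. \<exists>L L'.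
       is_L n G B T \<nu> L \<and> is_L n G B T \<mu> L' \<and> direct_summand n G M (rep_tensor L L'))"


section \<open>Frobenius\<close>

text \<open>
  \<open>F\<close> is a standard Frobenius endomorphism: under a suitable closed embedding \<open>G \<rightarrow> GL\<^sub>N\<close> it raises
  matrix entries to the \<open>p\<close>-th power.  It is the Frobenius of the split \<open>\<FF>\<^sub>p\<close>-form with split maximal
  torus \<open>T\<close> iff moreover \<open>F t = t\<^sup>p\<close> on \<open>T\<close>; this excludes, e.g., composites with graph automorphisms.
\<close>

definition frobenius ::
  "nat \<Rightarrow> 'k::field mat set \<Rightarrow> 'k mat set \<Rightarrow> ('k mat \<Rightarrow> 'k mat) \<Rightarrow> bool" where
  "frobenius n G T F \<longleftrightarrow> alg_hom n G n G F \<and>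
    (\<exists>N \<iota>. closed_subgroup N (\<iota> ` G) \<and> alg_iso n G N (\<iota> ` G) \<iota> \<and>
       (\<forall>g\<in>G. \<iota> (F g) = map_mat (\<lambda>x. x ^ CHAR('k)) (\<iota> g))) \<and>
    (\<forall>t\<in>T. F t = t [^]\<^bsub>GL n\<^esub> CHAR('k))"

definition twist :: "('k mat \<Rightarrow> 'k mat) \<Rightarrow> nat \<Rightarrow> 'k::field rep \<Rightarrow> 'k rep" where
  "twist F j M = Rep (deg M) (\<lambda>g. act M ((F ^^ j) g))"

text \<open>
  The ideal of \<open>K[G]\<close> defining the closed subgroup scheme \<open>G\<^sub>1T\<close>, the scheme-theoretic inverse image
  of \<open>T\<close> under \<open>F\<close>: it is generated by the functions \<open>f \<circ> F\<close> with \<open>f\<close> vanishing on \<open>T\<close>.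
\<close>

inductive_set G1T_ideal ::
  "nat \<Rightarrow> 'k::field mat set \<Rightarrow> 'k mat set \<Rightarrow> ('k mat \<Rightarrow> 'k mat) \<Rightarrow> ('k mat \<Rightarrow> 'k) set"
  for n G T F where
  pullback: "regular n G f \<Longrightarrow> (\<And>t. t \<in> T \<Longrightarrow> f t = 0) \<Longrightarrow> (\<lambda>g. f (F g)) \<in> G1T_ideal n G T F"
| add: "a \<in> G1T_ideal n G T F \<Longrightarrow> b \<in> G1T_ideal n G T F \<Longrightarrow> (\<lambda>g. a g + b g) \<in> G1T_ideal n G T F"
| mult: "regular n G a \<Longrightarrow> b \<in> G1T_ideal n G T F \<Longrightarrow> (\<lambda>g. a g * b g) \<in> G1T_ideal n G T F"
| cong: "a \<in> G1T_ideal n G T F \<Longrightarrow> (\<And>g. g \<in> G \<Longrightarrow> b g = a g) \<Longrightarrow> b \<in> G1T_ideal n G T F"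


section \<open>Modules for a closed subgroup scheme\<close>

text \<open>
  Let \<open>H\<close> be the closed subgroup scheme of \<open>G\<close> with ideal \<open>I \<subseteq> K[G]\<close>. A function on \<open>G\<close> is zero on
  \<open>H\<close> iff it belongs to \<open>I\<close>, and a function on \<open>G \<times> G\<close> is zero on \<open>H \<times> H\<close> iff it belongs to
  \<open>I \<otimes> K[G] + K[G] \<otimes> I\<close>, which is the following set.
\<close>

inductive_set square_ideal ::
  "nat \<Rightarrow> 'k::field mat set \<Rightarrow> ('k mat \<Rightarrow> 'k) set \<Rightarrow> ('k mat \<times> 'k mat \<Rightarrow> 'k) set"
  for n G I where
  left: "a \<in> I \<Longrightarrow> regular n G b \<Longrightarrow> (\<lambda>(g, h). a g * b h) \<in> square_ideal n G I"
| right: "regular n G a \<Longrightarrow> b \<in> I \<Longrightarrow> (\<lambda>(g, h). a g * b h) \<in> square_ideal n G I"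
| add: "a \<in> square_ideal n G I \<Longrightarrow> b \<in> square_ideal n G I \<Longrightarrow> (\<lambda>x. a x + b x) \<in> square_ideal n G I"
| cong: "a \<in> square_ideal n G I \<Longrightarrow> (\<And>x. x \<in> G \<times> G \<Longrightarrow> b x = a x) \<Longrightarrow> b \<in> square_ideal n G I"

text \<open>
  An \<open>H\<close>-module of degree \<open>m\<close> is a comodule \<open>K\<^sup>m\<close> for \<open>K[H] = K[G]/I\<close>, given by the matrix of its
  coefficient functions (represented by functions in \<open>K[G]\<close>). Every rational \<open>G\<close>-module is an
  \<open>H\<close>-module by restriction, with the same \<open>act\<close>.
\<close>

definition scheme_module ::
  "nat \<Rightarrow> 'k::field mat set \<Rightarrow> ('k mat \<Rightarrow> 'k) set \<Rightarrow> 'k rep \<Rightarrow> bool" where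
  "scheme_module n G I M \<longleftrightarrow>
    (\<forall>g\<in>G. act M g \<in> carrier_mat (deg M) (deg M)) \<and>
    (\<forall>i<deg M. \<forall>j<deg M. regular n G (\<lambda>g. act M g $$ (i, j))) \<and>
    act M (1\<^sub>m n) = 1\<^sub>m (deg M) \<and>
    (\<forall>i<deg M. \<forall>j<deg M.
       (\<lambda>(g, h). act M (g * h) $$ (i, j) - (act M g * act M h) $$ (i, j)) \<in> square_ideal n G I)"

definition scheme_hom ::
  "('k::field mat \<Rightarrow> 'k) set \<Rightarrow> 'k rep \<Rightarrow> 'k rep \<Rightarrow> 'k mat \<Rightarrow> bool" where
  "scheme_hom I M N P \<longleftrightarrow> P \<in> carrier_mat (deg N) (deg M) \<and>
    (\<forall>i<deg N. \<forall>j<deg M. (\<lambda>g. (P * act M g) $$ (i, j) - (act N g * P) $$ (i, j)) \<in> I)"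

definition scheme_mono ::
  "('k::field mat \<Rightarrow> 'k) set \<Rightarrow> 'k rep \<Rightarrow> 'k rep \<Rightarrow> 'k mat \<Rightarrow> bool" where
  "scheme_mono I M N P \<longleftrightarrow> scheme_hom I M N P \<and> inj_on (\<lambda>v. P *\<^sub>v v) (carrier_vec (deg M))"

text \<open>
  \<open>W\<close> is a subcomodule, i.e. the coaction maps \<open>W\<close> into \<open>W \<otimes> K[H]\<close>. As subspaces of \<open>K\<^sup>m\<close> are cut
  out by linear forms, this says that \<open>g \<mapsto> c \<bullet> (g w)\<close> is zero on \<open>H\<close> for all \<open>w \<in> W\<close> and all linear
  forms \<open>c\<close> vanishing on \<open>W\<close>.
\<close>

definition scheme_submodule ::
  "('k::field mat \<Rightarrow> 'k) set \<Rightarrow> 'k rep \<Rightarrow> 'k vec set \<Rightarrow> bool" where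
  "scheme_submodule I M W \<longleftrightarrow>
    subspace class_ring W (module_vec TYPE('k) (deg M)) \<and>
    (\<forall>w\<in>W. \<forall>c \<in> carrier_vec (deg M). (\<forall>u\<in>W. c \<bullet> u = 0) \<longrightarrow> (\<lambda>g. c \<bullet> (act M g *\<^sub>v w)) \<in> I)"

definition scheme_simple_submodule ::
  "('k::field mat \<Rightarrow> 'k) set \<Rightarrow> 'k rep \<Rightarrow> 'k vec set \<Rightarrow> bool" where
  "scheme_simple_submodule I M W \<longleftrightarrow> scheme_submodule I M W \<and> W \<noteq> {0\<^sub>v (deg M)} \<and>
    (\<forall>U. scheme_submodule I M U \<and> U \<subseteq> W \<longrightarrow> U = {0\<^sub>v (deg M)} \<or> U = W)"

text \<open>The sum of all simple submodules.\<close>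

definition scheme_socle :: "('k::field mat \<Rightarrow> 'k) set \<Rightarrow> 'k rep \<Rightarrow> 'k vec set" where
  "scheme_socle I M = \<Inter> {U. subspace class_ring U (module_vec TYPE('k) (deg M)) \<and>
     (\<forall>W. scheme_simple_submodule I M W \<longrightarrow> W \<subseteq> U)}"

text \<open>The submodule \<open>W\<close> of \<open>M\<close> is isomorphic to \<open>L\<close>.\<close>

definition scheme_submodule_iso ::
  "('k::field mat \<Rightarrow> 'k) set \<Rightarrow> 'k rep \<Rightarrow> 'k rep \<Rightarrow> 'k vec set \<Rightarrow> bool" where
  "scheme_submodule_iso I L M W \<longleftrightarrow>
    (\<exists>P. scheme_mono I L M P \<and> (\<lambda>v. P *\<^sub>v v) ` carrier_vec (deg L) = W)"

text \<open>
  Injectivity is tested on finite-dimensional modules; as comodules are locally finite, this is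
  the same as injectivity of \<open>Q\<close> among all modules.
\<close>

definition scheme_injective ::
  "nat \<Rightarrow> 'k::field mat set \<Rightarrow> ('k mat \<Rightarrow> 'k) set \<Rightarrow> 'k rep \<Rightarrow> bool" where
  "scheme_injective n G I Q \<longleftrightarrow> scheme_module n G I Q \<and>
    (\<forall>N M P f. scheme_module n G I N \<and> scheme_module n G I M \<and>
       scheme_mono I N M P \<and> scheme_hom I N Q f \<longrightarrow>
       (\<exists>f'. scheme_hom I M Q f' \<and> f' * P = f))"

definition scheme_injective_hull ::
  "nat \<Rightarrow> 'k::field mat set \<Rightarrow> ('k mat \<Rightarrow> 'k) set \<Rightarrow> 'k rep \<Rightarrow> 'k rep \<Rightarrow> bool" where
  "scheme_injective_hull n G I L Q \<longleftrightarrow> scheme_injective n G I Q \<and>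
    (\<exists>P. scheme_mono I L Q P \<and>
       (\<forall>W. scheme_submodule I Q W \<and> W \<noteq> {0\<^sub>v (deg Q)} \<longrightarrow>
          W \<inter> (\<lambda>v. P *\<^sub>v v) ` carrier_vec (deg L) \<noteq> {0\<^sub>v (deg Q)}))"

text \<open>The \<open>G\<close>-module \<open>M\<close> extends the \<open>H\<close>-module \<open>Q\<close>: its restriction to \<open>H\<close> is \<open>Q\<close>.\<close>

definition extends_structure ::
  "nat \<Rightarrow> 'k::field mat set \<Rightarrow> ('k mat \<Rightarrow> 'k) set \<Rightarrow> 'k rep \<Rightarrow> 'k rep \<Rightarrow> bool" where
  "extends_structure n G I Q M \<longleftrightarrow> rational_module n G M \<and> deg M = deg Q \<and>
    (\<forall>i<deg Q. \<forall>j<deg Q. (\<lambda>g. act M g $$ (i, j) - act Q g $$ (i, j)) \<in> I)"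

definition unique_G_structure ::
  "nat \<Rightarrow> 'k::field mat set \<Rightarrow> ('k mat \<Rightarrow> 'k) set \<Rightarrow> 'k rep \<Rightarrow> bool" where
  "unique_G_structure n G I Q \<longleftrightarrow>
    (\<exists>M. extends_structure n G I Q M) \<and>
    (\<forall>M M'. extends_structure n G I Q M \<and> extends_structure n G I Q M' \<longrightarrow> rep_iso G M M')"

text \<open>The \<open>G\<^sub>1T\<close>-socle of the \<open>G\<close>-module \<open>M\<close> is simple with restricted highest weight.\<close>

definition simple_G1T_socle_restricted ::
  "nat \<Rightarrow> 'k::field mat set \<Rightarrow> 'k mat set \<Rightarrow> 'k mat set \<Rightarrow> ('k mat \<Rightarrow> 'k mat) \<Rightarrow> 'k rep \<Rightarrow> bool" where
  "simple_G1T_socle_restricted n G B T F M \<longleftrightarrow>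
    (let I = G1T_ideal n G T F; S = scheme_socle I M in
       scheme_simple_submodule I M S \<and>
       (\<exists>\<mu> \<in> restricted_weights n G B T. \<exists>L. is_L n G B T \<mu> L \<and> scheme_submodule_iso I L M S))"

end

theory Submission
  imports Defs "Jordan_Normal_Form.Char_Poly" "HOL-Library.Function_Algebras"
begin

text \<open>
  Write \<open>V = I\<^sub>0\<close>, let \<open>S\<close> be its simple \<open>G\<^sub>1T\<close>-socle, and let \<open>N = I\<^sub>1 \<otimes> I\<^sub>2\<^bsup>[1]\<^esup> \<otimes> \<dots>\<close>, which by induction has
  no idempotent endomorphism except \<open>0\<close> and \<open>1\<close>. Over \<open>G\<^sub>1T\<close> the module \<open>N\<^bsup>[1]\<^esup>\<close> is a sum of
  one-dimensional modules, so Schur's lemma shows that an idempotent \<open>e\<close> of \<open>V \<otimes> N\<^bsup>[1]\<^esup>\<close> acts on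
  \<open>S \<otimes> N\<close> as \<open>1 \<otimes> c\<close>; components of \<open>e\<close> between different \<open>T\<close>-weights of \<open>N\<close> kill \<open>S\<close>, since otherwise
  they would have infinitely many eigenvalues. On \<open>gS \<otimes> N\<close> the action of \<open>e\<close> is \<open>1 \<otimes> (F g) c (F g)\<inverse>\<close>, whose
  entries are eigenvalues of the blocks of \<open>e\<close>; they form a finite set, so they do not depend on
  \<open>g\<close> as \<open>G\<close> is connected, and \<open>c\<close> commutes with \<open>F G\<close>, which is dense in \<open>G\<close>. Hence \<open>c\<close> is \<open>0\<close> or \<open>1\<close>.
  If \<open>c = 0\<close>, a simple \<open>G\<^sub>1T\<close>-submodule of the image of \<open>e\<close> would lie in \<open>S \<otimes> N\<close> and be killed by \<open>e\<close>;
  thus \<open>e = 0\<close>. The case \<open>c = 1\<close> follows by passing to \<open>1 - e\<close>.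
\<close>

section \<open>Linear algebra in function spaces\<close>

text \<open>Modules over G_1T are studied through linear functionals that kill its ideal: applied to
  the entries of a coefficient matrix, a functional gives an operator on K^d, and the subcomodules
  are exactly the subspaces stable under all these operators. Schur's lemma thereby becomes linear
  algebra. The twisted factor splits over G_1T because \<open>f \<circ> F\<close> modulo the ideal
  depends only on \<open>f\<close> restricted to \<open>T\<close>, so only the
  \<open>T\<close>-weights of N remain visible. The obstacle is that Schur's lemma then compares S
  tensored with p-th powers of two different weights. A nonzero map between such twists is excluded
  by finiteness of a spectrum: translation by t in T multiplies an eigenvalue by the p-th power of
  the quotient of the weights at t. The same finiteness, with connectedness of G in place of
  divisibility of T, freezes the conjugates of c. The induction runs on idempotents rather than on
  indecomposability, since c is an idempotent matrix commuting with N, which is exactly what an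
  induction hypothesis of that form accepts.\<close>

definition fscale :: "'k::field \<Rightarrow> ('a \<Rightarrow> 'k) \<Rightarrow> 'a \<Rightarrow> 'k" where
  "fscale c f = (\<lambda>x. c * f x)"

text \<open>One structure for all function types: span, independence and dimension then serve both
  for ideals of functions on matrices and for coordinate spaces.\<close>

interpretation fs: vector_space "fscale :: 'k::field \<Rightarrow> ('a \<Rightarrow> 'k) \<Rightarrow> 'a \<Rightarrow> 'k"
  by unfold_locales (auto simp: fscale_def fun_eq_iff algebra_simps)

lemma subspace_fs_iff:
  "fs.subspace W \<longleftrightarrow> (\<lambda>x. 0) \<in> W \<and> (\<forall>f\<in>W. \<forall>g\<in>W. (\<lambda>x. f x + g x) \<in> W) \<and>
     (\<forall>c. \<forall>f\<in>W. (\<lambda>x. c * f x) \<in> W)"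
  by (simp add: fs.subspace_def fscale_def plus_fun_def zero_fun_def)

lemma subspace_fsD:
  assumes "fs.subspace W"
  shows "(\<lambda>x. 0) \<in> W" "f \<in> W \<Longrightarrow> g \<in> W \<Longrightarrow> (\<lambda>x. f x + g x) \<in> W" "f \<in> W \<Longrightarrow> (\<lambda>x. c * f x) \<in> W"
  using assms by (auto simp: subspace_fs_iff)

lemma sum_fun_apply: "(\<Sum>i\<in>A. f i) x = (\<Sum>i\<in>A. f i x)"
  by (induction A rule: infinite_finite_induct) auto

lemma subspace_fs_sum:
  assumes "fs.subspace W" "\<And>i. i \<in> A \<Longrightarrow> f i \<in> W"
  shows "(\<lambda>x. \<Sum>i\<in>A. f i x) \<in> W"
proof -
  have "(\<lambda>x. \<Sum>i\<in>A. f i x) = (\<Sum>i\<in>A. f i)"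
    by (rule ext) (simp add: sum_fun_apply)
  then show ?thesis using fs.subspace_sum[of W A f] assms by simp
qed

definition functional :: "(('a \<Rightarrow> 'k::field) \<Rightarrow> 'k) \<Rightarrow> bool" where
  "functional \<delta> \<longleftrightarrow> (\<forall>f g. \<delta> (\<lambda>x. f x + g x) = \<delta> f + \<delta> g) \<and> (\<forall>c f. \<delta> (\<lambda>x. c * f x) = c * \<delta> f)"

lemma functional_simps:
  assumes "functional \<delta>"
  shows "\<delta> (\<lambda>x. f x + g x) = \<delta> f + \<delta> g" "\<delta> (\<lambda>x. c * f x) = c * \<delta> f" "\<delta> (\<lambda>x. f x * c) = \<delta> f * c"
    "\<delta> (\<lambda>x. 0) = 0" "\<delta> (\<lambda>x. f x - g x) = \<delta> f - \<delta> g" 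
proof -
  show 1: "\<delta> (\<lambda>x. f x + g x) = \<delta> f + \<delta> g" for f g
    using assms by (simp add: functional_def)
  show 2: "\<delta> (\<lambda>x. c * f x) = c * \<delta> f" for c f
    using assms by (simp add: functional_def)
  show "\<delta> (\<lambda>x. f x * c) = \<delta> f * c"
    using 2[of c f] by (simp add: mult.commute)
  show "\<delta> (\<lambda>x. 0) = 0"
    using 2[of 0 f] by simp
  show "\<delta> (\<lambda>x. f x - g x) = \<delta> f - \<delta> g"
    using 1[of f "\<lambda>x. (-1) * g x"] 2[of "-1" g] by simp
qed

lemma functional_sum:
  assumes "functional \<delta>"
  shows "\<delta> (\<lambda>x. \<Sum>i\<in>A. f i x) = (\<Sum>i\<in>A. \<delta> (f i))"
  by (induction A rule: infinite_finite_induct) (simp_all add: functional_simps[OF assms])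

text \<open>A basis of \<open>W\<close> stays independent when \<open>f\<close> is added, and a
  functional can be prescribed on it. This turns membership in an ideal or a subspace into a test by
  functionals.\<close>

lemma separating_functional:
  fixes W :: "('a \<Rightarrow> 'k::field) set"
  assumes W: "fs.subspace W" and f: "f \<notin> W"
  obtains \<delta> where "functional \<delta>" "\<And>w. w \<in> W \<Longrightarrow> \<delta> w = 0" "\<delta> f \<noteq> 0"
proof -
  interpret fs_scalars: vector_space_pair "fscale :: 'k \<Rightarrow> ('a \<Rightarrow> 'k) \<Rightarrow> 'a \<Rightarrow> 'k" "(*) :: 'k \<Rightarrow> 'k \<Rightarrow> 'k"
    by unfold_locales (simp_all add: distrib_left distrib_right)
  obtain B where B: "B \<subseteq> W" "fs.independent B" "W \<subseteq> fs.span B"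
    using fs.maximal_independent_subset by blast
  have spanB: "fs.span B = W"
    using B W by (meson fs.span_minimal subset_antisym)
  have "fs.independent (insert f B)"
    using B f spanB by (simp add: fs.independent_insert)
  then obtain g where g: "Vector_Spaces.linear fscale (*) g"
      "\<forall>x\<in>insert f B. g x = (if x = f then 1 else 0)"
    using fs_scalars.linear_independent_extend[of "insert f B" "\<lambda>x. if x = f then 1 else 0"] by blast
  have fnB: "f \<notin> B" using B f by auto
  have add: "g (x + y) = g x + g y" and sc: "g (fscale c x) = c * g x" for x y c
    using g(1) by (simp_all add: Vector_Spaces.linear_iff)
  have fg: "functional g"
    using add sc by (simp add: functional_def fscale_def plus_fun_def)
  have "g w = 0" if "w \<in> W" for w
    using that unfolding spanB[symmetric]
  proof (induction rule: fs.span_induct_alt)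
    case base then show ?case using functional_simps(4)[OF fg] by (simp add: zero_fun_def)
  next
    case (step c x y)
    then have "g x = 0" using g(2) fnB by auto
    then show ?case using step unfolding add sc by simp
  qed
  then show ?thesis using that[OF fg] g(2) by auto
qed

text \<open>The coordinate space K^J for an index set of any type, realised as functions extended by
  zero.\<close>

definition supported :: "'a set \<Rightarrow> ('a \<Rightarrow> 'k::zero) set" where
  "supported J = {f. \<forall>i. i \<notin> J \<longrightarrow> f i = 0}"

lemma subspace_supported: "fs.subspace (supported J)"
  by (auto simp: subspace_fs_iff supported_def)

lemma supported_span:
  assumes "finite J"
  shows "supported J \<subseteq> fs.span ((\<lambda>j i. if i = j then 1 else 0 :: 'k::field) ` J)"
proof
  fix f :: "'a \<Rightarrow> 'k" assume f: "f \<in> supported J"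
  have "f = (\<Sum>j\<in>J. fscale (f j) (\<lambda>i. if i = j then 1 else 0))"
  proof
    fix i show "f i = (\<Sum>j\<in>J. fscale (f j) (\<lambda>i. if i = j then 1 else 0)) i"
      using f assms by (auto simp: sum_fun_apply fscale_def supported_def if_distrib cong: if_cong)
  qed
  also have "\<dots> \<in> fs.span ((\<lambda>j i. if i = j then 1 else 0) ` J)"
    by (intro fs.span_sum fs.span_scale fs.span_base) auto
  finally show "f \<in> fs.span ((\<lambda>j i. if i = j then 1 else 0 :: 'k) ` J)" .
qed

text \<open>A basis of \<open>U\<close> extends to one of \<open>V\<close>, and the counts show that
  nothing was added. The finite set \<open>A\<close> makes the larger basis finite, so that counting
  is meaningful.\<close>

lemma subspace_fs_dim_eq:
  fixes U V :: "('a \<Rightarrow> 'k::field) set"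
  assumes U: "fs.subspace U" and UV: "U \<subseteq> V" and A: "finite A" "V \<subseteq> fs.span A"
    and dim: "fs.dim V \<le> fs.dim U"
  shows "U = V"
proof -
  obtain B where B: "B \<subseteq> U" "fs.independent B" "U \<subseteq> fs.span B" "card B = fs.dim U"
    using fs.basis_exists by metis
  obtain C where C: "B \<subseteq> C" "C \<subseteq> V" "fs.independent C" "V \<subseteq> fs.span C"
    using fs.maximal_independent_subset_extend[of B V] B UV by (metis subset_trans)
  have "finite C"
    using fs.independent_span_bound[OF A(1) C(3)] C A by auto
  moreover have "card C = fs.dim V"
    using fs.dim_unique C by metis
  ultimately have "B = C"
    using C(1) B(4) dim by (metis card_seteq)
  then show ?thesis
    using B C U UV by (metis fs.span_minimal subset_antisym subset_trans)
qed

lemma minimal_subspace_exists: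
  fixes \<W> :: "('a \<Rightarrow> 'k::field) set set"
  assumes "finite J" and "W0 \<in> \<W>" and "\<And>W. W \<in> \<W> \<Longrightarrow> fs.subspace W \<and> W \<subseteq> supported J"
  obtains X where "X \<in> \<W>" "\<And>Y. Y \<in> \<W> \<Longrightarrow> Y \<subseteq> X \<Longrightarrow> Y = X"
proof -
  obtain X where X: "X \<in> \<W>" "\<And>Y. Y \<in> \<W> \<Longrightarrow> fs.dim X \<le> fs.dim Y"
    using ex_has_least_nat[of "\<lambda>W. W \<in> \<W>" W0 fs.dim] assms(2) by blast
  have "Y = X" if "Y \<in> \<W>" "Y \<subseteq> X" for Y
    using subspace_fs_dim_eq[of Y X "(\<lambda>j i. if i = j then 1 else 0) ` J"] supported_span[of J]
      X that assms by blast
  then show ?thesis using that X by blast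
qed

lemma span_mult_left:
  fixes C :: "('a \<Rightarrow> 'k::field) set"
  assumes f: "\<And>g. g \<in> C \<Longrightarrow> (\<lambda>x. f x * g x) \<in> fs.span C" and g: "g \<in> fs.span C"
  shows "(\<lambda>x. f x * g x) \<in> fs.span C"
  using g
proof (induction rule: fs.span_induct_alt)
  case base
  then show ?case using subspace_fsD(1)[OF fs.subspace_span, of C] by (simp only: zero_fun_apply mult_zero_right)
next
  case (step c u v)
  have "(\<lambda>x. f x * (fscale c u + v) x) = (\<lambda>x. c * (f x * u x) + f x * v x)"
    by (rule ext) (simp add: fscale_def distrib_left mult.left_commute)
  then show ?case
    using subspace_fsD(2)[OF fs.subspace_span subspace_fsD(3)[OF fs.subspace_span f[OF step(1)], of c] step(2)]
    by presburger
qed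

text \<open>Bilinearity, one factor at a time. It serves the restrictions of characters to a torus
  and the functions compatible with p-th powers.\<close>

lemma span_mult_closed:
  fixes C :: "('a \<Rightarrow> 'k::field) set"
  assumes C: "\<And>f g. f \<in> C \<Longrightarrow> g \<in> C \<Longrightarrow> (\<lambda>x. f x * g x) \<in> C"
    and f: "f \<in> fs.span C" and g: "g \<in> fs.span C"
  shows "(\<lambda>x. f x * g x) \<in> fs.span C"
proof (rule span_mult_left[OF _ g])
  fix h assume h: "h \<in> C"
  have "(\<lambda>x. h x * f x) \<in> fs.span C"
    by (rule span_mult_left[OF _ f]) (rule fs.span_base, rule C[OF h])
  then show "(\<lambda>x. f x * h x) \<in> fs.span C"
    by (simp only: mult.commute)
qed

lemma span_fsE:
  fixes C :: "('a \<Rightarrow> 'k::field) set"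
  assumes "f \<in> fs.span C"
  obtains X a where "finite X" "X \<subseteq> C" "\<And>x. f x = (\<Sum>h\<in>X. a h * h x)"
proof -
  obtain X a where "finite X" "X \<subseteq> C" "f = (\<Sum>h\<in>X. fscale (a h) h)"
    using assms unfolding fs.span_explicit by blast
  then show ?thesis using that[of X a] by (simp add: sum_fun_apply fscale_def)
qed

section \<open>Linear operators, eigenvectors and matrices\<close>

definition linear_op :: "(('a \<Rightarrow> 'k::field) \<Rightarrow> 'b \<Rightarrow> 'k) \<Rightarrow> bool" where
  "linear_op L \<longleftrightarrow> (\<forall>f g. L (\<lambda>x. f x + g x) = (\<lambda>y. L f y + L g y)) \<and>
     (\<forall>c f. L (\<lambda>x. c * f x) = (\<lambda>y. c * L f y))"

lemma linear_op_simps: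
  assumes "linear_op L"
  shows "L (\<lambda>x. f x + g x) = (\<lambda>y. L f y + L g y)" "L (\<lambda>x. c * f x) = (\<lambda>y. c * L f y)"
    "L (\<lambda>x. 0) = (\<lambda>y. 0)" "L (\<lambda>x. f x - g x) = (\<lambda>y. L f y - L g y)"
proof -
  show 1: "L (\<lambda>x. f x + g x) = (\<lambda>y. L f y + L g y)" for f g
    using assms unfolding linear_op_def by blast
  show 2: "L (\<lambda>x. c * f x) = (\<lambda>y. c * L f y)" for f c
    using assms unfolding linear_op_def by blast
  show "L (\<lambda>x. 0) = (\<lambda>y. 0)" using 2[of 0 "\<lambda>x. 0"] by simp
  have "L (\<lambda>x. f x + (-1) * g x) = (\<lambda>y. L f y + (-1) * L g y)"
    by (simp only: 1 2)
  then show "L (\<lambda>x. f x - g x) = (\<lambda>y. L f y - L g y)" by simp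
qed

lemma linear_op_sum:
  assumes "linear_op L"
  shows "L (\<lambda>x. \<Sum>i\<in>A. f i x) = (\<lambda>y. \<Sum>i\<in>A. L (f i) y)"
  by (induction A rule: infinite_finite_induct) (simp_all add: linear_op_simps[OF assms])

lemma subspace_linear_image:
  assumes U: "fs.subspace U" and f: "linear_op f"
  shows "fs.subspace (f ` U)"
  unfolding subspace_fs_iff
proof (intro conjI ballI allI)
  show "(\<lambda>x. 0) \<in> f ` U"
    using imageI[OF subspace_fsD(1)[OF U], of f] unfolding linear_op_simps(3)[OF f] .
  show "(\<lambda>x. y x + z x) \<in> f ` U" if yz: "y \<in> f ` U" "z \<in> f ` U" for y z
  proof -
    obtain a b where ab: "a \<in> U" "b \<in> U" "y = f a" "z = f b" using yz by blast
    show ?thesis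
      using imageI[OF subspace_fsD(2)[OF U ab(1,2)], of f] unfolding linear_op_simps(1)[OF f] ab(3,4) .
  qed
  show "(\<lambda>x. c * y x) \<in> f ` U" if y: "y \<in> f ` U" for y c
  proof -
    obtain a where a: "a \<in> U" "y = f a" using y by blast
    show ?thesis
      using imageI[OF subspace_fsD(3)[OF U a(1), of c], of f] unfolding linear_op_simps(2)[OF f] a(2) .
  qed
qed

text \<open>\<open>S\<close> has no chosen coordinates, so the eigenvector comes from a nonzero
  polynomial \<open>q\<close> of least degree with \<open>q(L) x = 0\<close>: if \<open>c\<close> is
  a root, removing the factor \<open>X - c\<close> leaves \<open>r\<close> with
  \<open>r(L) x\<close> nonzero, and \<open>L - c\<close> kills this vector.\<close>

lemma eigenvector_in_subspace:
  fixes L :: "('a \<Rightarrow> 'k::alg_closed_field) \<Rightarrow> 'a \<Rightarrow> 'k"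
  assumes J: "finite J" and S: "fs.subspace S" "S \<subseteq> supported J" and L: "linear_op L"
    and LS: "\<And>x. x \<in> S \<Longrightarrow> L x \<in> S" and x: "x \<in> S" "x \<noteq> (\<lambda>_. 0)"
  obtains c y where "y \<in> S" "y \<noteq> (\<lambda>_. 0)" "L y = (\<lambda>i. c * y i)"
proof -
  \<comment> \<open>\<open>Q q\<close> is the vector \<open>q(L) x\<close>; \<open>Q_root\<close> is
    the rule for multiplying \<open>q\<close> by \<open>X - c\<close>.\<close>
  define Q where "Q q = (\<lambda>i. \<Sum>k\<le>degree q. coeff q k * ((L ^^ k) x) i)" for q
  have Qn: "Q q = (\<lambda>i. \<Sum>k<n. coeff q k * ((L ^^ k) x) i)" if "degree q < n" for q n
    unfolding Q_def using that
    by (intro ext sum.mono_neutral_left) (auto simp: coeff_eq_0)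
  have LkS: "(L ^^ k) x \<in> S" for k
    by (induction k) (auto intro: LS x)
  have QS: "Q q \<in> S" for q
    unfolding Q_def by (intro subspace_fs_sum S subspace_fsD(3) LkS)
  have Q_root: "Q ([:- c, 1:] * q) = (\<lambda>i. L (Q q) i - c * Q q i)" for c q
  proof
    fix i
    define n where "n = Suc (degree q + degree ([:- c, 1:] * q))"
    have L: "L (Q q) = (\<lambda>i. \<Sum>k<n. coeff q k * ((L ^^ Suc k) x) i)"
      using Qn[of q n] by (simp add: n_def linear_op_sum[OF L] linear_op_simps[OF L])
    have "Q ([:- c, 1:] * q) i = (\<Sum>k<Suc n. coeff ([:- c, 1:] * q) k * ((L ^^ k) x) i)"
      using Qn[of "[:- c, 1:] * q" "Suc n"] by (simp add: n_def)
    also have "\<dots> = (\<Sum>k<Suc n. coeff (pCons 0 q) k * ((L ^^ k) x) i) -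
        c * (\<Sum>k<Suc n. coeff q k * ((L ^^ k) x) i)"
      unfolding sum_distrib_left sum_subtractf[symmetric]
    proof (rule sum.cong[OF refl])
      fix k
      have "coeff ([:- c, 1:] * q) k = coeff (pCons 0 q) k - c * coeff q k" by simp
      then show "coeff ([:- c, 1:] * q) k * ((L ^^ k) x) i =
          coeff (pCons 0 q) k * ((L ^^ k) x) i - c * (coeff q k * ((L ^^ k) x) i)"
        by (simp only: left_diff_distrib mult.assoc)
    qed
    also have "(\<Sum>k<Suc n. coeff q k * ((L ^^ k) x) i) = Q q i"
      using Qn[of q "Suc n"] by (simp add: n_def)
    also have "(\<Sum>k<Suc n. coeff (pCons 0 q) k * ((L ^^ k) x) i) = L (Q q) i"
      unfolding L by (simp only: sum.lessThan_Suc_shift) simp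
    finally show "Q ([:- c, 1:] * q) i = L (Q q) i - c * Q q i" .
  qed
  \<comment> \<open>The iterates of \<open>x\<close> up to exponent \<open>card J\<close> outnumber
    the dimension. As dependence is a property of sets, a repetition among them is treated apart and
    yields \<open>X^i - X^j\<close>.\<close>
  have "\<exists>q. q \<noteq> 0 \<and> Q q = (\<lambda>_. 0)"
  proof (cases "inj_on (\<lambda>k. (L ^^ k) x) {..card J}")
    case False
    then obtain i j where ij: "i \<noteq> j" "(L ^^ i) x = (L ^^ j) x"
      by (auto simp: inj_on_def)
    define q where "q = monom (1::'k) i - monom 1 j"
    have "coeff q i \<noteq> 0" using ij by (simp add: q_def)
    then have "q \<noteq> 0" by auto
    moreover have "Q q = (\<lambda>_. 0)"
    proof -
      have "degree q < Suc (max i j)"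
        unfolding q_def by (meson degree_diff_le degree_monom_le le_imp_less_Suc max.cobounded1 max.cobounded2 order_trans)
      from Qn[OF this] show ?thesis
        by (auto simp: q_def left_diff_distrib sum_subtractf ij(2) if_distrib[of "\<lambda>c. c * _"] sum.delta' cong: if_cong)
    qed
    ultimately show ?thesis by blast
  next
    case True
    let ?B = "(\<lambda>k. (L ^^ k) x) ` {..card J}"
    have "fs.dependent ?B"
    proof (rule ccontr)
      assume "\<not> fs.dependent ?B"
      then have "card ?B \<le> card ((\<lambda>j i. if i = j then 1 else 0 :: 'k) ` J)"
        using fs.independent_span_bound[of "(\<lambda>j i. if i = j then 1 else 0 :: 'k) ` J" ?B]
          supported_span[OF J] LkS S(2) J by blast
      also have "\<dots> \<le> card J" using J by (rule card_image_le)
      finally show False using True by (simp add: card_image)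
    qed
    then obtain t u v where tu: "finite t" "t \<subseteq> ?B" "(\<Sum>v\<in>t. fscale (u v) v) = 0" "v \<in> t" "u v \<noteq> 0"
      unfolding fs.dependent_explicit by blast
    define a where "a k = (if (L ^^ k) x \<in> t then u ((L ^^ k) x) else 0)" for k
    define q where "q = (\<Sum>k\<le>card J. monom (a k) k)"
    have cq: "coeff q k = (if k \<le> card J then a k else 0)" for k
      by (simp add: q_def coeff_sum if_distrib sum.delta cong: if_cong)
    obtain k0 where k0: "k0 \<le> card J" "(L ^^ k0) x = v" using tu by auto
    have "coeff q k0 \<noteq> 0" using k0 tu by (simp add: cq a_def)
    then have "q \<noteq> 0" by auto
    moreover have "Q q = (\<lambda>_. 0)"
    proof
      fix i
      have "degree q < Suc (card J)"
        unfolding less_Suc_eq_le by (rule degree_le) (simp add: cq)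
      from Qn[OF this] have "Q q i = (\<Sum>k\<le>card J. a k * ((L ^^ k) x) i)"
        by (simp add: cq lessThan_Suc_atMost)
      also have "\<dots> = (\<Sum>w\<in>?B. (if w \<in> t then u w else 0) * w i)"
        by (subst sum.reindex[OF True]) (simp add: a_def)
      also have "\<dots> = (\<Sum>w\<in>t. u w * w i)"
        using tu(2) by (intro sum.mono_neutral_cong_right) auto
      also have "\<dots> = (\<Sum>v\<in>t. fscale (u v) v) i" by (simp add: sum_fun_apply fscale_def)
      finally show "Q q i = 0" using tu(3) by simp
    qed
    ultimately show ?thesis by blast
  qed
  then obtain q where q: "q \<noteq> 0" "Q q = (\<lambda>_. 0)"
    and qmin: "\<And>q'. q' \<noteq> 0 \<and> Q q' = (\<lambda>_. 0) \<Longrightarrow> degree q \<le> degree q'"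
    using ex_has_least_nat[of "\<lambda>q. q \<noteq> 0 \<and> Q q = (\<lambda>_. 0)" _ degree] by blast
  have "degree q > 0"
  proof (rule ccontr)
    assume "\<not> degree q > 0"
    then obtain c where c: "q = [:c:]" using degree_eq_zeroE by blast
    then have "c \<noteq> 0" "Q q = (\<lambda>i. c * x i)" using q by (auto simp: Q_def)
    then show False using q(2) x(2) by (auto simp: fun_eq_iff)
  qed
  then obtain c where "poly q c = 0" using alg_closed_imp_poly_has_root by blast
  then obtain r where r: "q = [:- c, 1:] * r" by (auto simp: poly_eq_0_iff_dvd)
  have r0: "r \<noteq> 0" using r q(1) by auto
  have "degree q = Suc (degree r)" unfolding r using r0 by (subst degree_mult_eq) auto
  then have "Q r \<noteq> (\<lambda>_. 0)" using qmin[of r] r0 by auto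
  moreover have "L (Q r) = (\<lambda>i. c * Q r i)"
    using q(2) Q_root[of c r] by (auto simp: r fun_eq_iff)
  ultimately show ?thesis using that QS by blast
qed

text \<open>Matrices are functions of two indices, so \<open>J\<close> may consist of pairs for a
  tensor product. The value \<open>0\<close> outside \<open>J\<close> keeps every product in
  \<open>supported J\<close>.\<close>

definition mv :: "'b set \<Rightarrow> ('b \<Rightarrow> 'b \<Rightarrow> 'k) \<Rightarrow> ('b \<Rightarrow> 'k::field) \<Rightarrow> 'b \<Rightarrow> 'k" where
  "mv J A u = (\<lambda>p. if p \<in> J then \<Sum>q\<in>J. A p q * u q else 0)"

lemma linear_op_mv: "linear_op (mv J A)"
  by (auto simp: linear_op_def mv_def fun_eq_iff distrib_left sum.distrib sum_distrib_left intro!: sum.cong)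

lemma mv_supported: "mv J A u \<in> supported J"
  by (simp add: mv_def supported_def)

lemma mv_mv: "mv J A (mv J B u) = mv J (\<lambda>p s. \<Sum>q\<in>J. A p q * B q s) u"
proof
  fix p
  have "(\<Sum>q\<in>J. A p q * (\<Sum>s\<in>J. B q s * u s)) = (\<Sum>s\<in>J. (\<Sum>q\<in>J. A p q * B q s) * u s)"
    unfolding sum_distrib_left sum_distrib_right mult.assoc by (rule sum.swap)
  then show "mv J A (mv J B u) p = mv J (\<lambda>p s. \<Sum>q\<in>J. A p q * B q s) u p"
    by (simp add: mv_def)
qed

lemma mv_cong:
  "(\<And>p q. p \<in> J \<Longrightarrow> q \<in> J \<Longrightarrow> A p q = B p q) \<Longrightarrow> mv J A u = mv J B u"
  by (auto simp: mv_def fun_eq_iff intro!: sum.cong)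

lemma mv_one:
  assumes "finite J" "u \<in> supported J"
  shows "mv J (\<lambda>p q. if p = q then 1 else 0) u = u"
  using assms by (auto simp: mv_def fun_eq_iff supported_def if_distrib[of "\<lambda>c. c * _"] cong: if_cong)

text \<open>Eigenvalues are roots of the characteristic polynomial. Both rigidity arguments rest on
  this: a character of \<open>T\<close> and a regular function on \<open>G\<close> are constant
  because their values are, up to a fixed factor, eigenvalues of one fixed matrix.\<close>

lemma finite_mv_eigenvalues:
  fixes A :: "nat \<Rightarrow> nat \<Rightarrow> 'k::field"
  shows "finite {c. \<exists>x \<in> supported {..<d}. x \<noteq> (\<lambda>_. 0) \<and> mv {..<d} A x = (\<lambda>i. c * x i)}"
proof -
  define M where "M = mat d d (\<lambda>(i, j). A i j)"
  have M: "M \<in> carrier_mat d d" by (simp add: M_def)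
  have "char_poly M \<noteq> 0" using degree_monic_char_poly[OF M] by auto
  then have "finite {c. poly (char_poly M) c = 0}" by (rule poly_roots_finite)
  moreover have "poly (char_poly M) c = 0"
    if x: "x \<in> supported {..<d}" "x \<noteq> (\<lambda>_. 0)" "mv {..<d} A x = (\<lambda>i. c * x i)" for c x
  proof -
    have "vec d x \<noteq> 0\<^sub>v d"
    proof
      assume "vec d x = 0\<^sub>v d"
      then have "x i = 0" if "i < d" for i using that by (metis index_vec index_zero_vec(1))
      then have "x i = 0" for i using x(1) by (cases "i < d") (auto simp: supported_def)
      then show False using x(2) by auto
    qed
    moreover have "M *\<^sub>v vec d x = c \<cdot>\<^sub>v vec d x"
    proof (rule eq_vecI)
      fix i assume "i < dim_vec (c \<cdot>\<^sub>v vec d x)"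
      then have i: "i < d" by simp
      have "(M *\<^sub>v vec d x) $ i = mv {..<d} A x i"
        using i by (simp add: M_def mv_def scalar_prod_def atLeast0LessThan)
      then show "(M *\<^sub>v vec d x) $ i = (c \<cdot>\<^sub>v vec d x) $ i" using i x(3) by simp
    qed (simp add: M_def)
    ultimately have "eigenvalue M c"
      unfolding eigenvalue_def eigenvector_def using M by (intro exI[of _ "vec d x"]) auto
    then show ?thesis using eigenvalue_root_char_poly[OF M] by blast
  qed
  ultimately show ?thesis by (elim finite_subset[rotated]) blast
qed

section \<open>Regular functions\<close>

lemma carrier_GL: "g \<in> carrier (GL n) \<longleftrightarrow>
    g \<in> carrier_mat n n \<and> (\<exists>h \<in> carrier_mat n n. h * g = 1\<^sub>m n \<and> g * h = 1\<^sub>m n)"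
  by (auto simp: GL_def units_of_def Units_def ring_mat_simps)

lemma mult_GL: "g \<otimes>\<^bsub>GL n\<^esub> h = g * h" and one_GL: "\<one>\<^bsub>GL n\<^esub> = 1\<^sub>m n"
  by (simp_all add: GL_def units_of_def ring_mat_simps)

lemma group_GL: "group (GL n :: 'k::field mat monoid)"
proof -
  interpret ring "ring_mat TYPE('k) n ()" by (rule ring_mat)
  show ?thesis unfolding GL_def by (rule units_group)
qed

lemma det_GL_nonzero: "g \<in> carrier (GL n) \<Longrightarrow> det (g :: 'k::field mat) \<noteq> 0"
  unfolding GL_def units_of_def by (auto dest: unit_imp_det_non_zero)

abbreviation mat_inv :: "nat \<Rightarrow> 'k::field mat \<Rightarrow> 'k mat" where
  "mat_inv n g \<equiv> inv\<^bsub>GL n\<^esub> g"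

lemma mat_inv_simps:
  fixes g :: "'k::field mat"
  assumes "g \<in> carrier (GL n)"
  shows "mat_inv n g \<in> carrier (GL n)" "g * mat_inv n g = 1\<^sub>m n" "mat_inv n g * g = 1\<^sub>m n"
  using group.inv_closed[OF group_GL assms] group.r_inv[OF group_GL assms] group.l_inv[OF group_GL assms]
  by (simp_all add: mult_GL one_GL)

lemma subgroup_GLD:
  fixes G :: "'k::field mat set"
  assumes "subgroup G (GL n)"
  shows "g \<in> G \<Longrightarrow> g \<in> carrier (GL n)" "g \<in> G \<Longrightarrow> g \<in> carrier_mat n n" "1\<^sub>m n \<in> G"
    "g \<in> G \<Longrightarrow> h \<in> G \<Longrightarrow> g * h \<in> G" "g \<in> G \<Longrightarrow> mat_inv n g \<in> G"
  using subgroup.mem_carrier[OF assms] subgroup.one_closed[OF assms] subgroup.m_closed[OF assms]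
    subgroup.m_inv_closed[OF assms]
  by (auto simp: mult_GL one_GL carrier_GL)

lemma det_mat_inv:
  fixes g :: "'k::field mat"
  assumes g: "g \<in> carrier (GL n)"
  shows "det (mat_inv n g) = inverse (det g)"
proof -
  have "det g * det (mat_inv n g) = 1"
    using mat_inv_simps[OF g] g by (metis det_mult det_one carrier_GL)
  then show ?thesis by (metis inverse_unique)
qed

text \<open>Cramer's rule, which makes inversion a regular map.\<close>

lemma mat_inv_entry:
  fixes g :: "'k::field mat"
  assumes g: "g \<in> carrier (GL n)" and ij: "i < n" "j < n"
  shows "mat_inv n g $$ (i, j) = inverse (det g) * cofactor g j i"
proof -
  have gc: "g \<in> carrier_mat n n" and ic: "mat_inv n g \<in> carrier_mat n n"
    using g mat_inv_simps(1)[OF g] by (auto simp: carrier_GL)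
  have "adj_mat g = mat_inv n g * g * adj_mat g"
    using mat_inv_simps(3)[OF g] adj_mat(1)[OF gc] by simp
  also have "\<dots> = mat_inv n g * (g * adj_mat g)"
    using ic gc adj_mat(1)[OF gc] by (rule assoc_mult_mat)
  also have "\<dots> = det g \<cdot>\<^sub>m mat_inv n g"
    using ic unfolding adj_mat(2)[OF gc] by (simp add: mult_smult_distrib[OF ic one_carrier_mat])
  finally have "adj_mat g $$ (i, j) = (det g \<cdot>\<^sub>m mat_inv n g) $$ (i, j)" by simp
  then have "cofactor g j i = det g * mat_inv n g $$ (i, j)"
    using gc ic ij by (simp add: adj_mat_def)
  then show ?thesis using det_GL_nonzero[OF g] by (simp add: field_simps)
qed

lemma regular_GL_function: "r \<in> GL_functions n \<Longrightarrow> regular n G r"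
  by (auto simp: regular_def)

lemma regular_cong: "regular n G f \<Longrightarrow> (\<And>g. g \<in> G \<Longrightarrow> f' g = f g) \<Longrightarrow> regular n G f'"
  by (auto simp: regular_def)

lemma regular_subset: "regular n G f \<Longrightarrow> H \<subseteq> G \<Longrightarrow> regular n H f"
  by (auto simp: regular_def)

lemma regular_const: "regular n G (\<lambda>g. c)"
  by (intro regular_GL_function GL_functions.const)

lemma regular_entry: "i < n \<Longrightarrow> j < n \<Longrightarrow> regular n G (\<lambda>g. g $$ (i, j))"
  by (intro regular_GL_function GL_functions.entry)

lemma regular_add: "regular n G a \<Longrightarrow> regular n G b \<Longrightarrow> regular n G (\<lambda>g. a g + b g)"
proof -
  assume "regular n G a" "regular n G b"
  then obtain r s where "r \<in> GL_functions n" "\<forall>g\<in>G. a g = r g" "s \<in> GL_functions n" "\<forall>g\<in>G. b g = s g"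
    unfolding regular_def by blast
  then show ?thesis
    unfolding regular_def by (intro bexI[OF _ GL_functions.add[of r n s]]) auto
qed

lemma regular_mult: "regular n G a \<Longrightarrow> regular n G b \<Longrightarrow> regular n G (\<lambda>g. a g * b g)"
proof -
  assume "regular n G a" "regular n G b"
  then obtain r s where "r \<in> GL_functions n" "\<forall>g\<in>G. a g = r g" "s \<in> GL_functions n" "\<forall>g\<in>G. b g = s g"
    unfolding regular_def by blast
  then show ?thesis
    unfolding regular_def by (intro bexI[OF _ GL_functions.mult[of r n s]]) auto
qed

lemma regular_uminus: "regular n G a \<Longrightarrow> regular n G (\<lambda>g. - a g)"
  using regular_mult[OF regular_const[of n G "-1"], of a] by simp

lemma regular_diff: "regular n G a \<Longrightarrow> regular n G b \<Longrightarrow> regular n G (\<lambda>g. a g - b g)"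
  using regular_add[OF _ regular_uminus, of n G a b] by simp

lemma regular_sum: "(\<And>i. i \<in> A \<Longrightarrow> regular n G (f i)) \<Longrightarrow> regular n G (\<lambda>g. \<Sum>i\<in>A. f i g)"
  by (induction A rule: infinite_finite_induct) (simp_all add: regular_const regular_add)

lemma regular_prod: "(\<And>i. i \<in> A \<Longrightarrow> regular n G (f i)) \<Longrightarrow> regular n G (\<lambda>g. \<Prod>i\<in>A. f i g)"
  by (induction A rule: infinite_finite_induct) (simp_all add: regular_const regular_mult)

lemma regular_det:
  assumes X: "\<And>g. g \<in> G \<Longrightarrow> X g \<in> carrier_mat k k"
    and reg: "\<And>i j. i < k \<Longrightarrow> j < k \<Longrightarrow> regular n G (\<lambda>g. X g $$ (i, j))"
  shows "regular n G (\<lambda>g. det (X g))"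
proof (rule regular_cong)
  show "regular n G (\<lambda>g. \<Sum>p \<in> {p. p permutes {0..<k}}. signof p * (\<Prod>i = 0..<k. X g $$ (i, p i)))"
    by (intro regular_sum regular_mult regular_const regular_prod reg)
      (auto dest: permutes_in_image)
qed (simp add: det_def'[OF X])

lemma regular_mat_inv_entry:
  fixes G :: "'k::field mat set"
  assumes G: "subgroup G (GL n)" and ij: "i < n" "j < n"
  shows "regular n G (\<lambda>g. mat_inv n g $$ (i, j))"
proof (rule regular_cong)
  have dim: "g \<in> G \<Longrightarrow> g \<in> carrier_mat n n" for g by (rule subgroup_GLD(2)[OF G])
  have "regular n G (\<lambda>g. det (mat_delete g j i))"
  proof (rule regular_det)
    fix a b assume ab: "a < n - 1" "b < n - 1"
    show "regular n G (\<lambda>g. mat_delete g j i $$ (a, b))"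
    proof (rule regular_cong)
      show "regular n G (\<lambda>g. g $$ (if a < j then a else Suc a, if b < i then b else Suc b))"
        using ab by (intro regular_entry) auto
    next
      fix g assume "g \<in> G"
      then have "dim_row g = n" "dim_col g = n" using dim by blast+
      then show "mat_delete g j i $$ (a, b) = g $$ (if a < j then a else Suc a, if b < i then b else Suc b)"
        using ab by (simp add: mat_delete_def)
    qed
  qed (rule mat_delete_carrier[OF dim])
  then show "regular n G (\<lambda>g. inverse (det g) * ((-1) ^ (j + i) * det (mat_delete g j i)))"
    by (intro regular_mult regular_const regular_GL_function[OF GL_functions.inv_det])
next
  fix g assume "g \<in> G"
  then show "mat_inv n g $$ (i, j) = inverse (det g) * ((-1) ^ (j + i) * det (mat_delete g j i))"
    using mat_inv_entry[OF subgroup_GLD(1)[OF G] ij] by (simp add: cofactor_def)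
qed

lemma GL_function_comp_regular:
  assumes r: "r \<in> GL_functions m"
    and entry: "\<And>i j. i < m \<Longrightarrow> j < m \<Longrightarrow> regular n G (\<lambda>g. \<phi> g $$ (i, j))"
    and inv_det: "regular n G (\<lambda>g. inverse (det (\<phi> g)))"
  shows "regular n G (\<lambda>g. r (\<phi> g))"
  using r by induction (auto intro: entry inv_det regular_const regular_add regular_mult)

lemma regular_comp_mat_inv:
  fixes G :: "'k::field mat set"
  assumes G: "subgroup G (GL n)" and f: "regular n G f"
  shows "regular n G (\<lambda>g. f (mat_inv n g))"
proof -
  obtain r where r: "r \<in> GL_functions n" "\<And>g. g \<in> G \<Longrightarrow> f g = r g"
    using f by (auto simp: regular_def)
  have "regular n G (\<lambda>g. r (mat_inv n g))"
  proof (rule GL_function_comp_regular[OF r(1)])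
    show "regular n G (\<lambda>g. inverse (det (mat_inv n g)))"
    proof (rule regular_cong)
      show "regular n G det"
        by (rule regular_det[where k = n]) (use subgroup_GLD(2)[OF G] in \<open>auto intro: regular_entry\<close>)
    qed (simp add: det_mat_inv[OF subgroup_GLD(1)[OF G]])
  qed (rule regular_mat_inv_entry[OF G])
  then show ?thesis
    by (rule regular_cong) (simp add: r(2) subgroup_GLD(5)[OF G])
qed

lemma alg_homD:
  fixes G :: "'k::field mat set"
  assumes "alg_hom n G m H \<phi>"
  shows "g \<in> G \<Longrightarrow> \<phi> g \<in> H" "g \<in> G \<Longrightarrow> h \<in> G \<Longrightarrow> \<phi> (g * h) = \<phi> g * \<phi> h"
    "i < m \<Longrightarrow> j < m \<Longrightarrow> regular n G (\<lambda>g. \<phi> g $$ (i, j))"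
  using assms by (auto simp: alg_hom_def hom_def mult_GL Pi_iff)

lemma alg_hom_one:
  fixes G :: "'k::field mat set"
  assumes G: "subgroup G (GL n)" and H: "subgroup H (GL m)" and \<phi>: "alg_hom n G m H \<phi>"
  shows "\<phi> (1\<^sub>m n) = 1\<^sub>m m"
proof -
  let ?e = "\<phi> (1\<^sub>m n)"
  have e: "?e \<in> carrier (GL m)" using alg_homD(1)[OF \<phi>] subgroup_GLD(3)[OF G] subgroup_GLD(1)[OF H] by blast
  have "?e * ?e = ?e"
    using alg_homD(2)[OF \<phi> subgroup_GLD(3)[OF G] subgroup_GLD(3)[OF G]] by simp
  then have "?e \<otimes>\<^bsub>GL m\<^esub> ?e = ?e" by (simp add: mult_GL)
  then show ?thesis using group.r_cancel_one[OF group_GL e e] by (simp add: one_GL)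
qed

lemma alg_hom_mat_inv:
  fixes G :: "'k::field mat set"
  assumes G: "subgroup G (GL n)" and H: "subgroup H (GL m)" and \<phi>: "alg_hom n G m H \<phi>" and g: "g \<in> G"
  shows "\<phi> (mat_inv n g) = mat_inv m (\<phi> g)"
proof -
  have "\<phi> (mat_inv n g) * \<phi> g = 1\<^sub>m m"
    using alg_homD(2)[OF \<phi> subgroup_GLD(5)[OF G g] g] mat_inv_simps(3)[OF subgroup_GLD(1)[OF G g]]
      alg_hom_one[OF G H \<phi>] by simp
  then show ?thesis
    using group.inv_equality[OF group_GL[of m], of "\<phi> (mat_inv n g)" "\<phi> g"]
      alg_homD(1)[OF \<phi>] subgroup_GLD(1)[OF H] subgroup_GLD(5)[OF G g] g
    by (simp add: mult_GL one_GL)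
qed

lemma regular_comp_alg_hom:
  fixes G :: "'k::field mat set"
  assumes G: "subgroup G (GL n)" and H: "subgroup H (GL m)" and \<phi>: "alg_hom n G m H \<phi>"
    and f: "regular m H f"
  shows "regular n G (\<lambda>g. f (\<phi> g))"
proof -
  obtain r where r: "r \<in> GL_functions m" "\<And>g. g \<in> H \<Longrightarrow> f g = r g"
    using f by (auto simp: regular_def)
  have "regular n G (\<lambda>g. r (\<phi> g))"
  proof (rule GL_function_comp_regular[OF r(1)])
    have "regular n G (\<lambda>g. det (\<phi> g))"
      by (rule regular_det[where k = m]) (use alg_homD[OF \<phi>] subgroup_GLD(2)[OF H] in auto)
    \<comment> \<open>The reciprocal of \<open>det (\<phi> g)\<close> is the determinant of
      \<open>\<phi>\<close> at the inverse of \<open>g\<close>, so regularity of inversion disposes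
      of the denominator.\<close>
    then have "regular n G (\<lambda>g. det (\<phi> (mat_inv n g)))"
      by (rule regular_comp_mat_inv[OF G])
    then show "regular n G (\<lambda>g. inverse (det (\<phi> g)))"
    proof (rule regular_cong)
      fix g assume g: "g \<in> G"
      then show "inverse (det (\<phi> g)) = det (\<phi> (mat_inv n g))"
        using alg_hom_mat_inv[OF G H \<phi> g] det_mat_inv[OF subgroup_GLD(1)[OF H], of "\<phi> g"] alg_homD(1)[OF \<phi> g]
        by simp
    qed
  qed (rule alg_homD(3)[OF \<phi>])
  then show ?thesis
    by (rule regular_cong) (simp add: r(2) alg_homD(1)[OF \<phi>])
qed

lemma alg_hom_comp:
  fixes G :: "'k::field mat set"
  assumes G: "subgroup G (GL n)" and H: "subgroup H (GL m)" 
    and \<phi>: "alg_hom n G m H \<phi>" and \<psi>: "alg_hom m H l K \<psi>"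
  shows "alg_hom n G l K (\<lambda>g. \<psi> (\<phi> g))"
  using alg_homD[OF \<phi>] alg_homD(1,2)[OF \<psi>] regular_comp_alg_hom[OF G H \<phi> alg_homD(3)[OF \<psi>]]
  by (auto simp: alg_hom_def hom_def mult_GL)

lemma zariski_closed_zeros:
  assumes G: "zariski_closed n G" and f: "regular n G f"
  shows "zariski_closed n {g \<in> G. f g = 0}"
proof -
  obtain P where P: "P \<subseteq> GL_functions n" "G = {g \<in> carrier (GL n). \<forall>f\<in>P. f g = 0}"
    using G by (auto simp: zariski_closed_def)
  obtain r where r: "r \<in> GL_functions n" "\<And>g. g \<in> G \<Longrightarrow> f g = r g"
    using f by (auto simp: regular_def)
  have "{g \<in> G. f g = 0} = {g \<in> carrier (GL n). \<forall>f\<in>insert r P. f g = 0}"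
    using P(2) r(2) by auto
  then show ?thesis unfolding zariski_closed_def using P(1) r(1) by (intro exI[of _ "insert r P"]) auto
qed

text \<open>If \<open>f\<close> took two values, the fibre over \<open>f g\<close> and the zeros of
  the product of \<open>f - c\<close> over the remaining values \<open>c\<close> would be disjoint
  nonempty closed sets covering \<open>G\<close>.\<close>

lemma finite_valued_regular_constant:
  assumes G: "zariski_closed n G" "zariski_connected n G" and f: "regular n G f"
    and fin: "finite (f ` G)" and gh: "g \<in> G" "h \<in> G"
  shows "f g = f h"
proof (rule ccontr)
  assume neq: "f g \<noteq> f h"
  let ?A = "{x \<in> G. f x - f g = 0}" and ?B = "{x \<in> G. (\<Prod>c\<in>f ` G - {f g}. f x - c) = 0}"
  have "zariski_closed n ?A" "zariski_closed n ?B"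
    by (intro zariski_closed_zeros G regular_diff regular_prod f regular_const)+
  moreover have "g \<in> ?A" "h \<in> ?B" "?A \<inter> ?B = {}" "?A \<union> ?B = G"
    using gh neq fin by auto
  ultimately show False using G(2) unfolding zariski_connected_def by blast
qed

section \<open>Tori and the density of the Frobenius image\<close>

lemma charactersD:
  assumes "\<chi> \<in> characters n T"
  shows "regular n T \<chi>" "t \<in> T \<Longrightarrow> \<chi> t \<noteq> 0" "s \<in> T \<Longrightarrow> t \<in> T \<Longrightarrow> \<chi> (s * t) = \<chi> s * \<chi> t"
    "t \<notin> T \<Longrightarrow> \<chi> t = 1"
  using assms by (auto simp: characters_def)

lemma characters_extend:
  assumes T: "subgroup T (GL n)" and "regular n T \<kappa>" "\<And>t. t \<in> T \<Longrightarrow> \<kappa> t \<noteq> 0"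
    "\<And>s t. s \<in> T \<Longrightarrow> t \<in> T \<Longrightarrow> \<kappa> (s * t) = \<kappa> s * \<kappa> t"
  shows "(\<lambda>t. if t \<in> T then \<kappa> t else 1) \<in> characters n T"
  using assms subgroup_GLD(4)[OF T] by (auto simp: characters_def intro: regular_cong)

lemma character_one:
  fixes T :: "'k::field mat set"
  assumes T: "subgroup T (GL n)" and \<chi>: "\<chi> \<in> characters n T"
  shows "\<chi> (1\<^sub>m n) = 1"
proof -
  have 1: "1\<^sub>m n \<in> T" by (rule subgroup_GLD(3)[OF T])
  have "\<chi> (1\<^sub>m n * 1\<^sub>m n) = \<chi> (1\<^sub>m n) * \<chi> (1\<^sub>m n)" by (rule charactersD(3)[OF \<chi> 1 1])
  then show ?thesis using charactersD(2)[OF \<chi> 1] by simp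
qed

lemma character_eqI:
  assumes "\<chi> \<in> characters n T" "\<psi> \<in> characters n T" "\<And>t. t \<in> T \<Longrightarrow> \<chi> t = \<psi> t"
  shows "\<chi> = \<psi>"
  using charactersD(4)[OF assms(1)] charactersD(4)[OF assms(2)] assms(3) by (intro ext) metis

lemma character_inverse:
  fixes T :: "'k::field mat set"
  assumes T: "subgroup T (GL n)" and \<chi>: "\<chi> \<in> characters n T"
  shows "regular n T (\<lambda>t. inverse (\<chi> t))"
proof (rule regular_cong)
  show "regular n T (\<lambda>t. \<chi> (mat_inv n t))"
    by (rule regular_comp_mat_inv[OF T charactersD(1)[OF \<chi>]])
next
  fix t assume t: "t \<in> T"
  have "\<chi> t * \<chi> (mat_inv n t) = 1"
    using charactersD(3)[OF \<chi> t subgroup_GLD(5)[OF T t]] mat_inv_simps(2)[OF subgroup_GLD(1)[OF T t]]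
      character_one[OF T \<chi>] by simp
  then show "inverse (\<chi> t) = \<chi> (mat_inv n t)" by (rule inverse_unique)
qed

text \<open>Dedekind's argument: replacing \<open>t\<close> by \<open>s * t\<close> and subtracting
  \<open>\<omega> s\<close> times the relation removes \<open>\<omega>\<close> and multiplies the
  coefficient of \<open>\<psi>\<close> by \<open>\<psi> s - \<omega> s\<close>. A nonzero
  coefficient would force \<open>\<psi> = \<omega>\<close>.\<close>

lemma characters_independent:
  fixes T :: "'k::field mat set"
  assumes T: "subgroup T (GL n)" and "finite X" "X \<subseteq> characters n T"
    and "\<And>t. t \<in> T \<Longrightarrow> (\<Sum>\<chi>\<in>X. a \<chi> * \<chi> t) = 0" and "\<chi> \<in> X"
  shows "a \<chi> = 0"
  using assms(2-)
proof (induction X arbitrary: a \<chi> rule: finite_induct)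
  case empty
  then show ?case by simp
next
  case (insert \<omega> X)
  have X: "X \<subseteq> characters n T" and \<omega>: "\<omega> \<in> characters n T" using insert.prems(1) by auto
  have zero: "a \<omega> * \<omega> t + (\<Sum>\<chi>\<in>X. a \<chi> * \<chi> t) = 0" if "t \<in> T" for t
    using insert.prems(2)[OF that] insert.hyps by simp
  have aX: "a \<psi> = 0" if \<psi>: "\<psi> \<in> X" for \<psi>
  proof (rule ccontr)
    assume a: "a \<psi> \<noteq> 0"
    have "\<psi> s = \<omega> s" if s: "s \<in> T" for s
    proof -
      have "a \<psi> * (\<psi> s - \<omega> s) = 0"
      proof (rule insert.IH[of "\<lambda>\<chi>. a \<chi> * (\<chi> s - \<omega> s)", OF X _ \<psi>])
        fix t assume t: "t \<in> T"
        have "(\<Sum>\<chi>\<in>X. a \<chi> * (\<chi> s - \<omega> s) * \<chi> t) =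
            (\<Sum>\<chi>\<in>X. a \<chi> * \<chi> (s * t)) - \<omega> s * (\<Sum>\<chi>\<in>X. a \<chi> * \<chi> t)"
          unfolding sum_distrib_left sum_subtractf[symmetric]
        proof (rule sum.cong[OF refl])
          fix \<chi> assume "\<chi> \<in> X"
          then have "\<chi> (s * t) = \<chi> s * \<chi> t" using charactersD(3)[OF _ s t] X by blast
          then show "a \<chi> * (\<chi> s - \<omega> s) * \<chi> t = a \<chi> * \<chi> (s * t) - \<omega> s * (a \<chi> * \<chi> t)"
            by (simp add: algebra_simps)
        qed
        also have "\<dots> = - (a \<omega> * \<omega> (s * t)) - \<omega> s * - (a \<omega> * \<omega> t)"
          using zero[OF t] zero[OF subgroup_GLD(4)[OF T s t]] by (simp only: add_eq_0_iff)
        also have "\<dots> = 0"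
          using charactersD(3)[OF \<omega> s t] by simp
        finally show "(\<Sum>\<chi>\<in>X. a \<chi> * (\<chi> s - \<omega> s) * \<chi> t) = 0" .
      qed
      then show ?thesis using a by simp
    qed
    then have "\<psi> = \<omega>" using X \<psi> \<omega> by (intro character_eqI[of \<psi> n T \<omega>]) auto
    then show False using insert.hyps \<psi> by simp
  qed
  have "(\<Sum>\<chi>\<in>X. a \<chi> * \<chi> (1\<^sub>m n)) = 0" using aX by simp
  then have "a \<omega> = 0"
    using zero[OF subgroup_GLD(3)[OF T]] character_one[OF T \<omega>] by simp
  then show ?case using aX insert.prems(3) by auto
qed

lemma alg_closed_root_exists:
  fixes c :: "'k::alg_closed_field"
  assumes "k > 0"
  shows "\<exists>z. z ^ k = c"
proof -
  have "degree (monom 1 k - [:c:]) > 0"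
    using assms by (intro le_degree[of _ k, THEN less_le_trans[OF assms]]) (auto simp: coeff_pCons split: nat.splits)
  then obtain z where "poly (monom 1 k - [:c:]) z = 0" using alg_closed_imp_poly_has_root by blast
  then show ?thesis by (auto simp: poly_monom)
qed

lemma diagonal_GL_entries:
  fixes A B :: "'k::field mat"
  assumes A: "A \<in> {A \<in> carrier (GL r). diagonal_mat A}" and B: "B \<in> {A \<in> carrier (GL r). diagonal_mat A}"
    and i: "i < r"
  shows "(A * B) $$ (i, i) = A $$ (i, i) * B $$ (i, i)" "A $$ (i, i) \<noteq> 0"
proof -
  have *: "(A * C) $$ (i, i) = A $$ (i, i) * C $$ (i, i)" if C: "C \<in> carrier_mat r r" for C
  proof -
    have "(A * C) $$ (i, i) = (\<Sum>k<r. A $$ (i, k) * C $$ (k, i))"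
      using A C i by (auto simp: carrier_GL scalar_prod_def atLeast0LessThan)
    also have "\<dots> = (\<Sum>k\<in>{i}. A $$ (i, k) * C $$ (k, i))"
      using A i by (intro sum.mono_neutral_right) (auto simp: carrier_GL diagonal_mat_def)
    finally show ?thesis by simp
  qed
  show "(A * B) $$ (i, i) = A $$ (i, i) * B $$ (i, i)"
    using B by (intro *) (auto simp: carrier_GL)
  obtain h where "h \<in> carrier_mat r r" "A * h = 1\<^sub>m r" using A by (auto simp: carrier_GL)
  then show "A $$ (i, i) \<noteq> 0" using *[of h] i by auto
qed

context
  fixes T :: "'k::alg_closed_field mat set" and n :: nat
  assumes torus: "torus n T"
begin

lemma torus_subgroup: "subgroup T (GL n)"
  using torus by (simp add: torus_def closed_subgroup_def)

lemma torus_coordinates: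
  obtains r \<phi> \<psi> where "alg_hom n T r {A \<in> carrier (GL r). diagonal_mat A} \<phi>"
    "alg_hom r {A \<in> carrier (GL r). diagonal_mat A} n T \<psi>" "\<And>t. t \<in> T \<Longrightarrow> \<psi> (\<phi> t) = t"
  using torus unfolding torus_def alg_iso_def by blast

text \<open>An isomorphism \<open>\<phi>\<close> onto a diagonal torus expresses the entries of
  \<open>t\<close> through the diagonal entries and the inverse determinant of
  \<open>\<phi> t\<close>, which are characters; off-diagonal entries vanish. Setting functions to
  \<open>0\<close> off \<open>T\<close> makes equality in the span mean equality on
  \<open>T\<close>.\<close>

lemma torus_function_span:
  assumes r: "r \<in> GL_functions n"
  shows "(\<lambda>t. if t \<in> T then r t else 0) \<in>
    fs.span ((\<lambda>\<chi> t. if t \<in> T then \<chi> t else 0) ` characters n T)" (is "?res r \<in> fs.span ?C")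
proof -
  note Tg = torus_subgroup
  have char: "?res \<kappa> \<in> ?C" if "regular n T \<kappa>" "\<And>t. t \<in> T \<Longrightarrow> \<kappa> t \<noteq> 0"
    "\<And>s t. s \<in> T \<Longrightarrow> t \<in> T \<Longrightarrow> \<kappa> (s * t) = \<kappa> s * \<kappa> t" for \<kappa>
    by (rule image_eqI[OF _ characters_extend[OF Tg that]]) auto
  have one: "?res (\<lambda>t. 1) \<in> ?C" by (rule char) (auto intro: regular_const)
  have mult_closed: "(\<lambda>t. f t * g t) \<in> ?C" if f: "f \<in> ?C" and g: "g \<in> ?C" for f g
  proof -
    obtain \<chi> \<psi> where c: "\<chi> \<in> characters n T" "\<psi> \<in> characters n T" "f = ?res \<chi>" "g = ?res \<psi>"
      using f g by blast
    have "?res (\<lambda>t. \<chi> t * \<psi> t) \<in> ?C"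
      by (rule char) (auto intro: regular_mult charactersD(1) c simp: charactersD(2,3)[OF c(1)] charactersD(2,3)[OF c(2)])
    moreover have "(\<lambda>t. f t * g t) = ?res (\<lambda>t. \<chi> t * \<psi> t)" using c(3,4) by auto
    ultimately show ?thesis by simp
  qed
  have const: "?res (\<lambda>t. c) \<in> fs.span ?C" for c
  proof -
    have "?res (\<lambda>t. c) = fscale c (?res (\<lambda>t. 1))" by (auto simp: fscale_def)
    also have "\<dots> \<in> fs.span ?C" by (rule fs.span_scale[OF fs.span_base[OF one]])
    finally show ?thesis .
  qed
  have add: "?res (\<lambda>t. a t + b t) \<in> fs.span ?C" if "?res a \<in> fs.span ?C" "?res b \<in> fs.span ?C" for a b
  proof -
    have "?res (\<lambda>t. a t + b t) = ?res a + ?res b" by auto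
    also have "\<dots> \<in> fs.span ?C" by (rule fs.span_add[OF that])
    finally show ?thesis .
  qed
  have mult: "?res (\<lambda>t. a t * b t) \<in> fs.span ?C" if "?res a \<in> fs.span ?C" "?res b \<in> fs.span ?C" for a b
  proof -
    have "?res (\<lambda>t. a t * b t) = (\<lambda>t. ?res a t * ?res b t)" by auto
    also have "\<dots> \<in> fs.span ?C" by (rule span_mult_closed[OF mult_closed that])
    finally show ?thesis .
  qed
  have inv_det: "?res (\<lambda>t. inverse (det (\<phi> t))) \<in> fs.span ?C"
    if \<phi>: "alg_hom n T m (carrier (GL m)) \<phi>" for \<phi> m
  proof (rule fs.span_base, rule char)
    note GLm = group.subgroup_self[OF group_GL[of m]]
    show "regular n T (\<lambda>t. inverse (det (\<phi> t)))"
      by (rule regular_comp_alg_hom[OF Tg GLm \<phi>]) (intro regular_GL_function GL_functions.inv_det)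
    show "inverse (det (\<phi> t)) \<noteq> 0" if "t \<in> T" for t
      using det_GL_nonzero[OF alg_homD(1)[OF \<phi> that]] by simp
    show "inverse (det (\<phi> (s * t))) = inverse (det (\<phi> s)) * inverse (det (\<phi> t))" if "s \<in> T" "t \<in> T" for s t
      using det_mult alg_homD(1)[OF \<phi>] that
      by (simp add: alg_homD(2)[OF \<phi>] carrier_GL det_mult[of _ m])
  qed
  obtain d \<phi> \<psi> where \<phi>: "alg_hom n T d {A \<in> carrier (GL d). diagonal_mat A} \<phi>"
    and \<psi>: "alg_hom d {A \<in> carrier (GL d). diagonal_mat A} n T \<psi>" and inv: "\<And>t. t \<in> T \<Longrightarrow> \<psi> (\<phi> t) = t"
    using torus_coordinates by blast
  have \<phi>': "alg_hom n T d (carrier (GL d)) \<phi>"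
    using \<phi> by (auto simp: alg_hom_def hom_def)
  have diag: "?res (\<lambda>t. q (\<phi> t)) \<in> fs.span ?C" if "q \<in> GL_functions d" for q
    using that
  proof induction
    case (entry i j)
    show ?case
    proof (cases "i = j")
      case True
      show ?thesis unfolding True[symmetric]
      proof (rule fs.span_base, rule char)
        show "\<phi> (s * t) $$ (i, i) = \<phi> s $$ (i, i) * \<phi> t $$ (i, i)" if "s \<in> T" "t \<in> T" for s t
          using diagonal_GL_entries(1)[OF alg_homD(1)[OF \<phi>] alg_homD(1)[OF \<phi>] entry(1)] that
          by (simp add: alg_homD(2)[OF \<phi>])
        show "\<phi> t $$ (i, i) \<noteq> 0" if "t \<in> T" for t
          using diagonal_GL_entries(2)[OF alg_homD(1)[OF \<phi> that] alg_homD(1)[OF \<phi> that] entry(1)] .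
      qed (rule alg_homD(3)[OF \<phi> entry(1) entry(1)])
    next
      case False
      have "\<phi> t $$ (i, j) = 0" if "t \<in> T" for t
        using alg_homD(1)[OF \<phi> that] entry False by (auto simp: diagonal_mat_def carrier_GL)
      then have "?res (\<lambda>t. \<phi> t $$ (i, j)) = ?res (\<lambda>t. 0)" by auto
      then show ?thesis using const[of 0] by simp
    qed
  qed (auto intro: const inv_det[OF \<phi>'] add mult)
  have id: "alg_hom n T n (carrier (GL n)) (\<lambda>t. t)"
    using subgroup_GLD(1)[OF Tg] by (auto simp: alg_hom_def hom_def mult_GL intro: regular_entry)
  show ?thesis using r
  proof induction
    case (entry i j)
    obtain q where q: "q \<in> GL_functions d" "\<forall>g\<in>{A \<in> carrier (GL d). diagonal_mat A}. \<psi> g $$ (i, j) = q g"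
      using alg_homD(3)[OF \<psi> entry] unfolding regular_def by blast
    have "t $$ (i, j) = q (\<phi> t)" if "t \<in> T" for t
      using q(2) alg_homD(1)[OF \<phi> that] inv[OF that] by metis
    then have "?res (\<lambda>t. t $$ (i, j)) = ?res (\<lambda>t. q (\<phi> t))" by auto
    then show ?case using diag[OF q(1)] by simp
  qed (auto intro: const inv_det[OF id] add mult)
qed

text \<open>The union of the supports of the single expansions, padded with zero coefficients, is
  one set \<open>X\<close> for all entries of a matrix, as a comparison of coefficients
  requires.\<close>

lemma torus_regular_expansion:
  assumes "finite J" and f: "\<And>p. p \<in> J \<Longrightarrow> regular n T (f p)"
  obtains X a where "finite X" "X \<subseteq> characters n T"
    "\<And>p t. p \<in> J \<Longrightarrow> t \<in> T \<Longrightarrow> f p t = (\<Sum>\<chi>\<in>X. a p \<chi> * \<chi> t)"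
proof -
  let ?res = "\<lambda>\<chi> t. if t \<in> T then \<chi> t else (0 :: 'k)"
  define expands where "expands p X a \<longleftrightarrow> finite X \<and> X \<subseteq> characters n T \<and>
    (\<forall>t\<in>T. f p t = (\<Sum>\<chi>\<in>X. a \<chi> * \<chi> t))" for p X a
  have "\<exists>X a. expands p X a" if p: "p \<in> J" for p
  proof -
    obtain r where r: "r \<in> GL_functions n" "\<And>t. t \<in> T \<Longrightarrow> f p t = r t"
      using f[OF p] by (auto simp: regular_def)
    obtain Y b where Y: "finite Y" "Y \<subseteq> ?res ` characters n T" "\<And>t. ?res r t = (\<Sum>h\<in>Y. b h * h t)"
      using span_fsE[OF torus_function_span[OF r(1)]] by blast
    \<comment> \<open>\<open>b\<close> is indexed by truncated functions; a set \<open>X\<close> on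
      which truncation is injective moves the indexing to characters.\<close>
    obtain X where X: "X \<subseteq> characters n T" "inj_on ?res X" "Y = ?res ` X"
      using Y(2) unfolding subset_image_inj by blast
    have "f p t = (\<Sum>\<chi>\<in>X. b (?res \<chi>) * \<chi> t)" if t: "t \<in> T" for t
    proof -
      have "f p t = (\<Sum>\<chi>\<in>X. b (?res \<chi>) * ?res \<chi> t)"
        using Y(3)[of t] t r(2) unfolding X(3) by (simp add: sum.reindex[OF X(2)])
      then show ?thesis using t by simp
    qed
    moreover have "finite X" using Y(1) X(2,3) by (simp add: finite_image_iff)
    ultimately show ?thesis
      unfolding expands_def using X(1) by (intro exI[of _ X] exI[of _ "\<lambda>\<chi>. b (?res \<chi>)"] conjI ballI)
  qed
  then obtain X a where "\<And>p. p \<in> J \<Longrightarrow> expands p (X p) (a p)"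
    by metis
  then have X: "\<And>p. p \<in> J \<Longrightarrow> finite (X p) \<and> X p \<subseteq> characters n T"
    "\<And>p t. p \<in> J \<Longrightarrow> t \<in> T \<Longrightarrow> f p t = (\<Sum>\<chi>\<in>X p. a p \<chi> * \<chi> t)"
    by (simp_all add: expands_def)
  show ?thesis
  proof
    show "finite (\<Union>p\<in>J. X p)" "(\<Union>p\<in>J. X p) \<subseteq> characters n T" using assms(1) X(1) by auto
    show "f p t = (\<Sum>\<chi>\<in>(\<Union>p\<in>J. X p). (if \<chi> \<in> X p then a p \<chi> else 0) * \<chi> t)" if "p \<in> J" "t \<in> T" for p t
      unfolding X(2)[OF that] using that(1) X(1) assms(1)
      by (intro sum.mono_neutral_cong_left) auto
  qed
qed

text \<open>The image is a finite group, so some \<open>K > 0\<close> kills it; over an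
  algebraically closed field every element of a torus is a \<open>K\<close>-th power.\<close>

lemma torus_finite_valued_character:
  assumes mult: "\<And>s t. s \<in> T \<Longrightarrow> t \<in> T \<Longrightarrow> \<kappa> (s * t) = \<kappa> s * (\<kappa> t :: 'k)"
    and nz: "\<And>t. t \<in> T \<Longrightarrow> \<kappa> t \<noteq> 0" and fin: "finite (\<kappa> ` T)" and t: "t \<in> T"
  shows "\<kappa> t = 1"
proof -
  note Tg = torus_subgroup
  have 1: "1\<^sub>m n \<in> T" by (rule subgroup_GLD(3)[OF Tg])
  have \<kappa>1: "\<kappa> (1\<^sub>m n) = 1" using mult[OF 1 1] nz[OF 1] by simp
  have "\<exists>k>0. c ^ k = 1" if c: "c \<in> \<kappa> ` T" for c
  proof -
    have "c ^ k \<in> \<kappa> ` T" for k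
    proof (induction k)
      case 0 then show ?case using \<kappa>1 1 by force
    next
      case (Suc k)
      then obtain s s' where "s \<in> T" "s' \<in> T" "c ^ k = \<kappa> s" "c = \<kappa> s'" using c by auto
      then have "c ^ Suc k = \<kappa> (s' * s)" "s' * s \<in> T" using mult subgroup_GLD(4)[OF Tg] by auto
      then show ?case by blast
    qed
    then have "\<not> inj (\<lambda>k. c ^ k)" using fin by (meson finite_imageD finite_subset image_subsetI infinite_UNIV_nat)
    then obtain i j where ij: "i < j" "c ^ i = c ^ j" by (auto simp: inj_def) (metis nat_neq_iff)
    have "c ^ i * c ^ (j - i) = c ^ i" using ij by (metis power_add le_add_diff_inverse less_imp_le)
    moreover have "c \<noteq> 0" using c nz by auto
    ultimately show ?thesis using ij(1) by (intro exI[of _ "j - i"]) auto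
  qed
  then obtain k where k: "\<And>c. c \<in> \<kappa> ` T \<Longrightarrow> k c > 0 \<and> c ^ k c = 1" by metis
  define K where "K = (\<Prod>c\<in>\<kappa> ` T. k c)"
  have K: "K > 0" using k by (simp add: K_def prod_pos)
  have cK: "c ^ K = 1" if c: "c \<in> \<kappa> ` T" for c
  proof -
    obtain l where "K = k c * l" using dvd_prodI[OF fin c, of k] by (auto simp: K_def dvd_def)
    then show ?thesis using k[OF c] by (simp add: power_mult)
  qed
  obtain r \<phi> \<psi> where \<phi>: "alg_hom n T r {A \<in> carrier (GL r). diagonal_mat A} \<phi>" (is "alg_hom n T r ?D \<phi>")
    and \<psi>: "alg_hom r {A \<in> carrier (GL r). diagonal_mat A} n T \<psi>" and inv: "\<And>t. t \<in> T \<Longrightarrow> \<psi> (\<phi> t) = t"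
    using torus_coordinates by blast
  define D where "D x = mat r r (\<lambda>(i, j). if i = j then x i else (0 :: 'k))" for x
  have D_mult: "D x * D y = D (\<lambda>i. x i * y i)" for x y
    by (rule eq_matI) (auto simp: D_def scalar_prod_def if_distrib[of "\<lambda>c. c * _"] if_distrib[of "\<lambda>c. _ * c"] sum.delta cong: if_cong)
  have D_one: "D (\<lambda>i. 1) = 1\<^sub>m r" by (rule eq_matI) (auto simp: D_def)
  have D_closed: "D x \<in> ?D" if "\<And>i. x i \<noteq> 0" for x
  proof -
    have "D (\<lambda>i. inverse (x i)) * D x = 1\<^sub>m r" "D x * D (\<lambda>i. inverse (x i)) = 1\<^sub>m r"
      unfolding D_mult using that by (simp_all add: D_one)
    moreover have "D y \<in> carrier_mat r r" for y by (simp add: D_def)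
    ultimately have "D x \<in> carrier (GL r)" unfolding carrier_GL by blast
    then show ?thesis by (auto simp: D_def diagonal_mat_def)
  qed
  have pow: "\<kappa> (\<psi> (D (\<lambda>i. x i ^ k))) = \<kappa> (\<psi> (D x)) ^ k" if x: "\<And>i. x i \<noteq> 0" for x k
  proof (induction k)
    case 0
    have "\<psi> (1\<^sub>m r) \<in> T" and "\<psi> (1\<^sub>m r * 1\<^sub>m r) = \<psi> (1\<^sub>m r) * \<psi> (1\<^sub>m r)"
      using alg_homD(1)[OF \<psi> D_closed[of "\<lambda>i. 1"]] alg_homD(2)[OF \<psi> D_closed[of "\<lambda>i. 1"] D_closed[of "\<lambda>i. 1"]]
      unfolding D_one by simp_all
    then have "\<kappa> (\<psi> (1\<^sub>m r)) = \<kappa> (\<psi> (1\<^sub>m r)) * \<kappa> (\<psi> (1\<^sub>m r))" using mult by (metis right_mult_one_mat one_carrier_mat)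
    then show ?case using nz \<open>\<psi> (1\<^sub>m r) \<in> T\<close> by (simp add: D_one)
  next
    case (Suc k)
    have "D (\<lambda>i. x i ^ Suc k) = D x * D (\<lambda>i. x i ^ k)" by (simp add: D_mult)
    then have "\<psi> (D (\<lambda>i. x i ^ Suc k)) = \<psi> (D x) * \<psi> (D (\<lambda>i. x i ^ k))"
      using alg_homD(2)[OF \<psi> D_closed[of x] D_closed[of "\<lambda>i. x i ^ k"]] x by simp
    moreover have "\<psi> (D x) \<in> T" "\<psi> (D (\<lambda>i. x i ^ k)) \<in> T" 
      using alg_homD(1)[OF \<psi>] D_closed x by auto
    ultimately show ?case using mult Suc by simp
  qed
  \<comment> \<open>The diagonal of \<open>\<phi> t\<close>, continued by \<open>1\<close> because
    \<open>D_closed\<close> and \<open>pow\<close> ask for nonzero values at every index.\<close>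
  define x where "x i = (if i < r then \<phi> t $$ (i, i) else 1)" for i
  have \<phi>t: "\<phi> t \<in> ?D" by (rule alg_homD(1)[OF \<phi> t])
  have x: "x i \<noteq> 0" for i
    using diagonal_GL_entries(2)[OF \<phi>t \<phi>t] by (simp add: x_def)
  have "\<phi> t = D x"
    using \<phi>t by (intro eq_matI) (auto simp: D_def x_def carrier_GL diagonal_mat_def)
  have "\<exists>y. \<forall>i. y i ^ K = x i" by (intro choice allI alg_closed_root_exists K)
  then obtain y where y: "\<And>i. y i ^ K = x i" by blast
  have y0: "y i \<noteq> 0" for i using y[of i] x[of i] K by (auto simp: power_0_left)
  have "\<kappa> t = \<kappa> (\<psi> (D (\<lambda>i. y i ^ K)))" using inv[OF t] \<open>\<phi> t = D x\<close> y by simp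
  also have "\<dots> = \<kappa> (\<psi> (D y)) ^ K" by (rule pow[OF y0])
  also have "\<dots> = 1" using alg_homD(1)[OF \<psi> D_closed[of y, OF y0]] by (intro cK) blast
  finally show ?thesis .
qed

end

section \<open>Frobenius on functions and the density of its image\<close>

lemma CHAR_power_inj:
  fixes x y :: "'k::field"
  assumes "CHAR('k) > 0" and "x ^ CHAR('k) = y ^ CHAR('k)"
  shows "x = y"
proof -
  have p: "prime CHAR('k)" by (rule prime_CHAR_semidom[OF assms(1)])
  have "x ^ CHAR('k) = (x - y) ^ CHAR('k) + y ^ CHAR('k)"
    using freshmans_dream[OF p refl, of "x - y" y] by simp
  then show ?thesis using assms by simp
qed

definition frob_mat :: "'k::field mat \<Rightarrow> 'k mat" where
  "frob_mat = map_mat (\<lambda>x. x ^ CHAR('k))"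

lemma det_frob_mat:
  fixes A :: "'k::field mat"
  assumes "CHAR('k) > 0"
  shows "det (frob_mat A) = det A ^ CHAR('k)"
proof -
  have "prime CHAR('k)" by (rule prime_CHAR_semidom[OF assms])
  then interpret comm_ring_hom "\<lambda>x::'k. x ^ CHAR('k)"
    using assms by unfold_locales (auto simp: freshmans_dream power_mult_distrib power_0_left)
  show ?thesis unfolding frob_mat_def by (rule hom_det)
qed

text \<open>Entries and the inverse determinant are compatible with p-th powers, and compatibility
  survives products. Constants can fail it, but they become coefficients.\<close>

lemma GL_functions_frob_span:
  fixes r :: "'k::field mat \<Rightarrow> 'k"
  assumes p: "CHAR('k) > 0" and "r \<in> GL_functions N"
  shows "r \<in> fs.span {m. \<forall>x \<in> carrier (GL N). m (frob_mat x) = m x ^ CHAR('k)}" (is "r \<in> fs.span ?C")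
  using assms(2)
proof induction
  case (const c)
  have "fscale c (\<lambda>g. 1) \<in> fs.span ?C" by (intro fs.span_scale fs.span_base) simp
  moreover have "fscale c (\<lambda>g :: 'k mat. 1) = (\<lambda>g. c)" by (simp add: fscale_def)
  ultimately show ?case by (simp only:)
next
  case (entry i j)
  then show ?case by (intro fs.span_base) (auto simp: frob_mat_def carrier_GL)
next
  case inv_det
  show ?case by (intro fs.span_base) (auto simp: det_frob_mat[OF p] power_inverse)
next
  case (add a b)
  then show ?case using fs.span_add[of a ?C b] by (simp add: plus_fun_def)
next
  case (mult a b)
  then show ?case by (intro span_mult_closed) (auto simp: power_mult_distrib)
qed

text \<open>
  The coefficient vectors \<open>U\<close> of functions vanishing on \<open>G\<close> are contained in those, \<open>U'\<close>, of
  functions vanishing on the Frobenius image, and \<open>U'\<close> is the image of \<open>U\<close> under the semilinear map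
  \<open>c \<mapsto> c\<^sup>p\<close>; so the two have the same dimension.
\<close>

lemma frobenius_image_dense:
  fixes G :: "'k::alg_closed_field mat set"
  assumes p: "CHAR('k) > 0" and G: "subgroup G (GL n)" and frob: "frobenius n G T F"
    and f: "regular n G f" and zero: "\<And>g. g \<in> G \<Longrightarrow> f (F g) = 0" and g: "g \<in> G"
  shows "f g = 0"
proof -
  let ?p = "CHAR('k)"
  have pp: "prime ?p" by (rule prime_CHAR_semidom[OF p])
  have F: "alg_hom n G n G F" using frob by (simp add: frobenius_def)
  obtain N \<iota> where "closed_subgroup N (\<iota> ` G)" and iso: "alg_iso n G N (\<iota> ` G) \<iota>"
    and \<iota>F: "\<And>g. g \<in> G \<Longrightarrow> \<iota> (F g) = frob_mat (\<iota> g)"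
    using frob unfolding frobenius_def frob_mat_def by blast
  then have H: "subgroup (\<iota> ` G) (GL N)" by (simp add: closed_subgroup_def)
  obtain \<psi> where \<psi>: "alg_hom N (\<iota> ` G) n G \<psi>" and \<psi>\<iota>: "\<And>g. g \<in> G \<Longrightarrow> \<psi> (\<iota> g) = g"
    using iso unfolding alg_iso_def by blast
  obtain r where r: "r \<in> GL_functions N" "\<forall>h\<in>\<iota> ` G. f (\<psi> h) = r h"
    using regular_comp_alg_hom[OF H G \<psi> f] unfolding regular_def by blast
  have fr: "f g = r (\<iota> g)" if "g \<in> G" for g
    using bspec[OF r(2) imageI[OF that]] \<psi>\<iota>[OF that] by simp
  obtain X a where X: "finite X" "X \<subseteq> {m. \<forall>x \<in> carrier (GL N). m (frob_mat x) = m x ^ ?p}"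
    "\<And>x. r x = (\<Sum>m\<in>X. a m * m x)"
    using span_fsE[OF GL_functions_frob_span[OF p r(1)]] by blast
  have mF: "m (\<iota> (F g)) = m (\<iota> g) ^ ?p" if "m \<in> X" "g \<in> G" for m g
    using X(2) that subgroup_GLD(1)[OF H] \<iota>F[OF that(2)] by auto
  define U where "U = {c \<in> supported X. \<forall>g\<in>G. (\<Sum>m\<in>X. c m * m (\<iota> g)) = 0}"
  define U' where "U' = {c \<in> supported X. \<forall>g\<in>G. (\<Sum>m\<in>X. c m * m (\<iota> g) ^ ?p) = 0}"
  have sub: "fs.subspace U"
    unfolding U_def subspace_fs_iff
    by (auto simp: supported_def distrib_right sum.distrib mult.assoc simp flip: sum_distrib_left)
  have UU': "U \<subseteq> U'"
  proof
    \<comment> \<open>A relation on \<open>G\<close> holds in particular at \<open>F g\<close>,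
      where each \<open>m\<close> takes the p-th power of its value at \<open>g\<close>.\<close>
    fix c assume c: "c \<in> U"
    have "(\<Sum>m\<in>X. c m * m (\<iota> g) ^ ?p) = 0" if g: "g \<in> G" for g
    proof -
      have "(\<Sum>m\<in>X. c m * m (\<iota> (F g))) = 0" using c alg_homD(1)[OF F g] by (auto simp: U_def)
      then show ?thesis using mF g by simp
    qed
    then show "c \<in> U'" using c by (simp add: U_def U'_def)
  qed
  obtain B where B: "B \<subseteq> U" "fs.independent B" "U \<subseteq> fs.span B" "card B = fs.dim U"
    using fs.basis_exists by metis
  let ?\<phi> = "\<lambda>c :: ('k mat \<Rightarrow> 'k) \<Rightarrow> 'k. (\<lambda>m. c m ^ ?p)"
  have finB: "finite B"
  proof -
    have "B \<subseteq> fs.span ((\<lambda>j i. if i = j then 1 else 0) ` X)"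
      using B(1) supported_span[OF X(1)] by (auto simp: U_def)
    then show ?thesis using fs.independent_span_bound[OF _ B(2)] X(1) by blast
  qed
  have span': "U' \<subseteq> fs.span (?\<phi> ` B)"
  proof
    fix c assume c: "c \<in> U'"
    \<comment> \<open>The semilinear map is onto \<open>U'\<close>: with p-th roots of the
      coefficients, the p-th power of the new relation is the old one, so the new relation holds as
      well.\<close>
    have "\<exists>u. \<forall>m. u m ^ ?p = c m" by (intro choice allI alg_closed_root_exists p)
    then obtain u where u: "\<And>m. u m ^ ?p = c m" by blast
    have "(\<Sum>m\<in>X. u m * m (\<iota> g)) = 0" if g: "g \<in> G" for g
    proof -
      have "(\<Sum>m\<in>X. u m * m (\<iota> g)) ^ ?p = (\<Sum>m\<in>X. c m * m (\<iota> g) ^ ?p)"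
        by (simp add: freshmans_dream_sum[OF pp refl] power_mult_distrib u)
      also have "\<dots> = 0" using c g by (simp add: U'_def)
      finally show ?thesis by (simp only: power_eq_0_iff)
    qed
    moreover have "u \<in> supported X"
      unfolding supported_def
    proof (intro CollectI allI impI)
      fix m assume "m \<notin> X"
      then have "u m ^ ?p = 0" using c u by (simp add: U'_def supported_def)
      then show "u m = 0" by (simp only: power_eq_0_iff)
    qed
    ultimately have "u \<in> fs.span B" using B(3) by (auto simp: U_def)
    then obtain Y b where Y: "finite Y" "Y \<subseteq> B" "\<And>m. u m = (\<Sum>h\<in>Y. b h * h m)"
      using span_fsE by blast
    have "c = (\<Sum>h\<in>Y. fscale (b h ^ ?p) (?\<phi> h))"
    proof
      fix m
      have "c m = (\<Sum>h\<in>Y. b h * h m) ^ ?p" using u[of m] Y(3)[of m] by simp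
      then show "c m = (\<Sum>h\<in>Y. fscale (b h ^ ?p) (?\<phi> h)) m"
        by (simp add: freshmans_dream_sum[OF pp refl] power_mult_distrib sum_fun_apply fscale_def)
    qed
    also have "\<dots> \<in> fs.span (?\<phi> ` B)"
      using Y(2) by (intro fs.span_sum fs.span_scale fs.span_base) auto
    finally show "c \<in> fs.span (?\<phi> ` B)" .
  qed
  have "fs.dim U' \<le> card (?\<phi> ` B)" by (rule fs.dim_le_card[OF span']) (use finB in simp)
  also have "\<dots> \<le> fs.dim U" using card_image_le[OF finB] B(4) by metis
  finally have eq: "U = U'"
    using subspace_fs_dim_eq[OF sub UU' _ span'] finB by blast
  \<comment> \<open>The coefficients of \<open>f\<close>: its vanishing on the image of
    \<open>F\<close> puts them in \<open>U'\<close>, and \<open>U = U'\<close> says that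
    \<open>f\<close> vanishes on \<open>G\<close>.\<close>
  define a' where "a' m = (if m \<in> X then a m else 0)" for m
  have "a' \<in> U'"
  proof -
    have "(\<Sum>m\<in>X. a m * m (\<iota> g) ^ ?p) = 0" if g: "g \<in> G" for g
      using zero[OF g] fr[OF alg_homD(1)[OF F g]] X(3)[of "\<iota> (F g)"] mF g by simp
    then show ?thesis by (simp add: U'_def a'_def supported_def)
  qed
  then have "(\<Sum>m\<in>X. a m * m (\<iota> g)) = 0" using g unfolding eq[symmetric] U_def a'_def by simp
  then show ?thesis using fr[OF g] X(3) by simp
qed

section \<open>Distributions on a closed subgroup scheme\<close>

text \<open>For the ideal of a closed subgroup scheme H these induce the full linear dual of K[H],
  not just functionals of finite order at the identity. They are defined on all functions on
  matrices; \<open>distribution_cong\<close> shows that values off \<open>G\<close> do not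
  matter.\<close>

definition distribution :: "('k::field mat \<Rightarrow> 'k) set \<Rightarrow> (('k mat \<Rightarrow> 'k) \<Rightarrow> 'k) \<Rightarrow> bool" where
  "distribution I \<delta> \<longleftrightarrow> functional \<delta> \<and> (\<forall>f\<in>I. \<delta> f = 0)"

lemma distribution_cong:
  assumes I: "fs.subspace I" "\<And>a b. a \<in> I \<Longrightarrow> (\<And>g. g \<in> G \<Longrightarrow> b g = a g) \<Longrightarrow> b \<in> I"
    and \<delta>: "distribution I \<delta>" and eq: "\<And>g. g \<in> G \<Longrightarrow> f g = f' g"
  shows "\<delta> f = \<delta> f'"
proof -
  have "(\<lambda>g. f g - f' g) \<in> I"
    using I(2)[OF subspace_fsD(1)[OF I(1)], of "\<lambda>g. f g - f' g"] eq by simp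
  then have "\<delta> (\<lambda>g. f g - f' g) = 0" using \<delta> by (simp add: distribution_def)
  then show ?thesis using functional_simps(5)[of \<delta> f f'] \<delta> by (simp add: distribution_def)
qed

text \<open>A comodule for K[H] is a module over the dual algebra: \<open>\<delta>\<close> acts by
  the matrix obtained by applying it to every coefficient \<open>m p q\<close>.\<close>

definition stable_subspace ::
  "('k::field mat \<Rightarrow> 'k) set \<Rightarrow> 'b set \<Rightarrow> ('b \<Rightarrow> 'b \<Rightarrow> 'k mat \<Rightarrow> 'k) \<Rightarrow> ('b \<Rightarrow> 'k) set \<Rightarrow> bool" where
  "stable_subspace I J m U \<longleftrightarrow> fs.subspace U \<and> U \<subseteq> supported J \<and>
     (\<forall>\<delta>. distribution I \<delta> \<longrightarrow> (\<forall>u\<in>U. mv J (\<lambda>p q. \<delta> (m p q)) u \<in> U))"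

definition simple_subspace ::
  "('k::field mat \<Rightarrow> 'k) set \<Rightarrow> 'b set \<Rightarrow> ('b \<Rightarrow> 'b \<Rightarrow> 'k mat \<Rightarrow> 'k) \<Rightarrow> ('b \<Rightarrow> 'k) set \<Rightarrow> bool" where
  "simple_subspace I J m X \<longleftrightarrow> stable_subspace I J m X \<and> X \<noteq> {\<lambda>_. 0} \<and>
     (\<forall>U. stable_subspace I J m U \<and> U \<subseteq> X \<longrightarrow> U = {\<lambda>_. 0} \<or> U = X)"

lemma subspace_fs_zero: "fs.subspace {\<lambda>_. 0}"
  by (simp add: subspace_fs_iff)

lemma simple_subspace_exists:
  assumes "finite J" "stable_subspace I J m U" "U \<noteq> {\<lambda>_. 0}"
  obtains X where "simple_subspace I J m X" "X \<subseteq> U"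
proof -
  define \<W> where "\<W> = {W. stable_subspace I J m W \<and> W \<noteq> {\<lambda>_. 0} \<and> W \<subseteq> U}"
  have W: "U \<in> \<W>" "\<And>W. W \<in> \<W> \<Longrightarrow> fs.subspace W \<and> W \<subseteq> supported J"
    using assms(2,3) by (auto simp: \<W>_def stable_subspace_def)
  obtain X where X: "X \<in> \<W>" "\<And>Y. Y \<in> \<W> \<Longrightarrow> Y \<subseteq> X \<Longrightarrow> Y = X"
    using minimal_subspace_exists[OF assms(1) W] by metis
  have "simple_subspace I J m X"
    unfolding simple_subspace_def
  proof (intro conjI allI impI)
    fix Y assume Y: "stable_subspace I J m Y \<and> Y \<subseteq> X"
    show "Y = {\<lambda>_. 0} \<or> Y = X"
    proof (cases "Y = {\<lambda>_. 0}")
      case False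
      then have "Y \<in> \<W>" using X(1) Y by (auto simp: \<W>_def)
      then show ?thesis using X(2) Y by simp
    qed simp
  qed (use X(1) in \<open>simp_all add: \<W>_def\<close>)
  then show ?thesis using that X(1) by (simp add: \<W>_def)
qed

text \<open>
  The maps \<open>\<tau>\<close> and \<open>\<tau>'\<close> account for a twist by a one-dimensional module, over which \<open>f\<close> need not
  commute with distributions but only intertwine them up to \<open>\<tau>\<close>.
\<close>

lemma simple_subspace_image:
  assumes X: "simple_subspace I J m X" and f: "linear_op f" "\<And>x. x \<in> X \<Longrightarrow> f x \<in> supported J'"
    and \<tau>: "\<And>\<delta>. distribution I \<delta> \<Longrightarrow> distribution I (\<tau> \<delta>)"
      "\<And>\<delta> x. distribution I \<delta> \<Longrightarrow> x \<in> X \<Longrightarrow>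
        f (mv J (\<lambda>p q. \<delta> (m p q)) x) = mv J' (\<lambda>p q. \<tau> \<delta> (m' p q)) (f x)"
    and \<tau>': "\<And>\<delta>. distribution I \<delta> \<Longrightarrow> distribution I (\<tau>' \<delta>)"
      "\<And>\<delta> x. distribution I \<delta> \<Longrightarrow> x \<in> X \<Longrightarrow>
        mv J' (\<lambda>p q. \<delta> (m' p q)) (f x) = f (mv J (\<lambda>p q. \<tau>' \<delta> (m p q)) x)"
  shows "f ` X = {\<lambda>_. 0} \<or> simple_subspace I J' m' (f ` X)"
proof (cases "\<forall>x\<in>X. f x = (\<lambda>_. 0)")
  case True
  have "(\<lambda>_. 0) \<in> X" using X by (simp add: simple_subspace_def stable_subspace_def subspace_fs_iff)
  then have "f ` X = {\<lambda>_. 0}" using True by force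
  then show ?thesis by blast
next
  case False
  have subX: "fs.subspace X" and suppX: "X \<subseteq> supported J" 
    and stabX: "\<And>\<delta> x. distribution I \<delta> \<Longrightarrow> x \<in> X \<Longrightarrow> mv J (\<lambda>p q. \<delta> (m p q)) x \<in> X"
    using X by (auto simp: simple_subspace_def stable_subspace_def)
  note lin = linear_op_simps[OF f(1)]
  \<comment> \<open>The hypotheses on \<open>\<tau>\<close> pull stability back along
    \<open>f\<close>, in particular to the kernel; those on \<open>\<tau>'\<close> push it forward
    to the image.\<close>
  have preimage: "stable_subspace I J m {x \<in> X. f x \<in> Y}"
    if Y: "fs.subspace Y" "\<And>\<delta> y. distribution I \<delta> \<Longrightarrow> y \<in> Y \<Longrightarrow> mv J' (\<lambda>p q. \<delta> (m' p q)) y \<in> Y" for Y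
  proof -
    have "fs.subspace {x \<in> X. f x \<in> Y}"
      unfolding subspace_fs_iff
      using subspace_fsD[OF subX] subspace_fsD[OF Y(1)] by (auto simp: lin)
    moreover have "f (mv J (\<lambda>p q. \<delta> (m p q)) x) \<in> Y" if "distribution I \<delta>" "x \<in> X" "f x \<in> Y" for \<delta> x
      unfolding \<tau>(2)[OF that(1,2)] by (rule Y(2)[OF \<tau>(1)[OF that(1)] that(3)])
    ultimately show ?thesis
      unfolding stable_subspace_def using suppX stabX by auto
  qed
  have "mv J' A (\<lambda>_. 0) = (\<lambda>_. 0)" for A by (rule linear_op_simps(3)[OF linear_op_mv])
  then have "stable_subspace I J m {x \<in> X. f x \<in> {\<lambda>_. 0}}"
    by (intro preimage subspace_fs_zero) simp
  then have ker: "{x \<in> X. f x \<in> {\<lambda>_. 0}} = {\<lambda>_. 0}"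
    using X False unfolding simple_subspace_def by (metis (mono_tags, lifting) mem_Collect_eq singletonD subsetI)
  have sub: "fs.subspace (f ` X)" by (rule subspace_linear_image[OF subX f(1)])
  have "stable_subspace I J' m' (f ` X)"
    unfolding stable_subspace_def using sub f(2) \<tau>'(2) stabX[OF \<tau>'(1)] by auto
  moreover have "f ` X \<noteq> {\<lambda>_. 0}" using False by blast
  moreover have "Y = {\<lambda>_. 0} \<or> Y = f ` X" if Y: "stable_subspace I J' m' Y" "Y \<subseteq> f ` X" for Y
  proof -
    have "stable_subspace I J m {x \<in> X. f x \<in> Y}"
      using Y(1) by (intro preimage) (auto simp: stable_subspace_def)
    then consider "{x \<in> X. f x \<in> Y} = {\<lambda>_. 0}" | "{x \<in> X. f x \<in> Y} = X"
      using X unfolding simple_subspace_def by (metis (mono_tags, lifting) mem_Collect_eq subsetI)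
    then show ?thesis
    proof cases
      case 1
      have "Y \<subseteq> {\<lambda>_. 0}"
      proof
        fix y assume "y \<in> Y"
        then obtain x where "x \<in> X" "y = f x" using Y(2) by blast
        then have "x = (\<lambda>_. 0)" using 1 \<open>y \<in> Y\<close> by blast
        then show "y \<in> {\<lambda>_. 0}" using \<open>y = f x\<close> lin(3) by simp
      qed
      moreover have "(\<lambda>_. 0) \<in> Y" using Y(1) by (simp add: stable_subspace_def subspace_fs_iff)
      ultimately show ?thesis by blast
    next
      case 2
      then show ?thesis using Y(2) by blast
    qed
  qed
  ultimately have "simple_subspace I J' m' (f ` X)" unfolding simple_subspace_def by blast
  then show ?thesis by blast
qed

section \<open>Dictionary between subcomodules and stable subspaces\<close>

definition fun_of_vec :: "nat \<Rightarrow> 'k::field vec \<Rightarrow> nat \<Rightarrow> 'k" where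
  "fun_of_vec d w = (\<lambda>i. if i < d then w $ i else 0)"

lemma fun_of_vec_simps:
  "fun_of_vec d w \<in> supported {..<d}" "w \<in> carrier_vec d \<Longrightarrow> vec d (fun_of_vec d w) = w"
  "u \<in> supported {..<d} \<Longrightarrow> fun_of_vec d (vec d u) = u"
  by (auto simp: fun_of_vec_def supported_def)

lemma vec_fun_of_vec_image:
  assumes "U \<subseteq> carrier_vec d"
  shows "vec d ` fun_of_vec d ` U = U"
proof -
  have "(\<lambda>w. vec d (fun_of_vec d w)) ` U = (\<lambda>w. w) ` U"
    using assms by (intro image_cong refl fun_of_vec_simps(2)) blast
  then show ?thesis by (simp add: image_image)
qed

lemma fun_of_vec_vec_image:
  assumes "U \<subseteq> supported {..<d}"
  shows "fun_of_vec d ` vec d ` U = U"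
proof -
  have "(\<lambda>u. fun_of_vec d (vec d u)) ` U = (\<lambda>u. u) ` U"
    using assms by (intro image_cong refl fun_of_vec_simps(3)) blast
  then show ?thesis by (simp add: image_image)
qed

lemma subspace_vec_iff:
  "VectorSpace.subspace class_ring W (module_vec TYPE('k::field) d) \<longleftrightarrow> W \<subseteq> carrier_vec d \<and> 0\<^sub>v d \<in> W \<and>
     (\<forall>v\<in>W. \<forall>w\<in>W. v + w \<in> W) \<and> (\<forall>c. \<forall>v\<in>W. c \<cdot>\<^sub>v v \<in> W)"
proof -
  interpret vec_space "TYPE('k)" d .
  have "vectorspace class_ring (module_vec TYPE('k) d)" "Module.module class_ring (module_vec TYPE('k) d)"
    by (rule vectorspace_axioms, rule module_axioms)
  then show ?thesis
    unfolding VectorSpace.subspace_def LinearCombinations.submodule_def by (auto simp: module_vec_simps class_ring_simps)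
qed

abbreviation rep_coeff :: "'k rep \<Rightarrow> nat \<Rightarrow> nat \<Rightarrow> 'k mat \<Rightarrow> 'k::field" where
  "rep_coeff M \<equiv> (\<lambda>i j g. act M g $$ (i, j))"

context
  fixes G :: "'k::field mat set" and I :: "('k mat \<Rightarrow> 'k) set" and M :: "'k rep"
  assumes ideal: "fs.subspace I" "\<And>a b. a \<in> I \<Longrightarrow> (\<And>g. g \<in> G \<Longrightarrow> b g = a g) \<Longrightarrow> b \<in> I"
    and act: "\<And>g. g \<in> G \<Longrightarrow> act M g \<in> carrier_mat (deg M) (deg M)"
begin

text \<open>Linearity moves \<open>\<delta>\<close> inside the matrix product. The left side tests
  membership of a function in \<open>I\<close>, the right side tests whether the operator of
  \<open>\<delta>\<close> leaves a subspace; both directions of the dictionary rest on it.\<close>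

lemma distribution_matrix_coeff:
  assumes \<delta>: "distribution I \<delta>" and c: "c \<in> carrier_vec (deg M)" and w: "w \<in> carrier_vec (deg M)"
  shows "\<delta> (\<lambda>g. c \<bullet> (act M g *\<^sub>v w)) =
    c \<bullet> vec (deg M) (mv {..<deg M} (\<lambda>i j. \<delta> (rep_coeff M i j)) (fun_of_vec (deg M) w))"
proof -
  let ?d = "deg M"
  have fl: "functional \<delta>" using \<delta> by (simp add: distribution_def)
  have "\<delta> (\<lambda>g. c \<bullet> (act M g *\<^sub>v w)) = \<delta> (\<lambda>g. \<Sum>i<?d. c $ i * (\<Sum>j<?d. act M g $$ (i, j) * w $ j))"
  proof (rule distribution_cong[OF ideal \<delta>])
    fix g assume "g \<in> G"
    then show "c \<bullet> (act M g *\<^sub>v w) = (\<Sum>i<?d. c $ i * (\<Sum>j<?d. act M g $$ (i, j) * w $ j))"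
      using act[of g] c w by (auto simp: scalar_prod_def atLeast0LessThan intro!: sum.cong)
  qed
  also have "\<dots> = (\<Sum>i<?d. c $ i * (\<Sum>j<?d. \<delta> (rep_coeff M i j) * w $ j))"
    by (simp add: functional_sum[OF fl] functional_simps[OF fl])
  finally show ?thesis
    by (auto simp: scalar_prod_def atLeast0LessThan mv_def fun_of_vec_def intro!: sum.cong)
qed

text \<open>If a coefficient function were outside \<open>I\<close>, a functional killing
  \<open>I\<close> would detect it; but its operator keeps the vector in \<open>U\<close>, where the
  linear form \<open>c\<close> vanishes.\<close>

lemma stable_imp_scheme_submodule:
  assumes U: "stable_subspace I {..<deg M} (rep_coeff M) U"
  shows "scheme_submodule I M (vec (deg M) ` U)"
proof -
  let ?d = "deg M"
  have sub: "fs.subspace U" and supp: "U \<subseteq> supported {..<?d}" using U by (auto simp: stable_subspace_def)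
  have "VectorSpace.subspace class_ring (vec ?d ` U) (module_vec TYPE('k) ?d)"
    unfolding subspace_vec_iff
  proof (intro conjI ballI allI)
    show "0\<^sub>v ?d \<in> vec ?d ` U" by (rule image_eqI[OF _ subspace_fsD(1)[OF sub]]) auto
    show "v + w \<in> vec ?d ` U" if vw: "v \<in> vec ?d ` U" "w \<in> vec ?d ` U" for v w
    proof -
      obtain x y where xy: "x \<in> U" "y \<in> U" "v = vec ?d x" "w = vec ?d y" using vw by blast
      show ?thesis by (rule image_eqI[OF _ subspace_fsD(2)[OF sub xy(1,2)]]) (auto simp: xy(3,4))
    qed
    show "c \<cdot>\<^sub>v v \<in> vec ?d ` U" if v: "v \<in> vec ?d ` U" for c v
    proof -
      obtain x where x: "x \<in> U" "v = vec ?d x" using v by blast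
      show ?thesis by (rule image_eqI[OF _ subspace_fsD(3)[OF sub x(1), of c]]) (auto simp: x(2))
    qed
  qed auto
  moreover have "(\<lambda>g. c \<bullet> (act M g *\<^sub>v vec ?d u)) \<in> I"
    if u: "u \<in> U" and c: "c \<in> carrier_vec ?d" "\<forall>w\<in>vec ?d ` U. c \<bullet> w = 0" for u c
  proof (rule ccontr)
    assume "(\<lambda>g. c \<bullet> (act M g *\<^sub>v vec ?d u)) \<notin> I"
    then obtain \<delta> where \<delta>: "functional \<delta>" "\<And>f. f \<in> I \<Longrightarrow> \<delta> f = 0" "\<delta> (\<lambda>g. c \<bullet> (act M g *\<^sub>v vec ?d u)) \<noteq> 0"
      using separating_functional[OF ideal(1)] by blast
    then have dist: "distribution I \<delta>" by (simp add: distribution_def)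
    have "mv {..<?d} (\<lambda>i j. \<delta> (rep_coeff M i j)) u \<in> U"
      using U dist u by (simp add: stable_subspace_def)
    moreover have "fun_of_vec ?d (vec ?d u) = u" using supp u fun_of_vec_simps(3) by blast
    ultimately show False
      using \<delta>(3) c(2) distribution_matrix_coeff[OF dist c(1) vec_carrier[of ?d u]] by auto
  qed
  ultimately show ?thesis unfolding scheme_submodule_def by blast
qed

lemma scheme_submodule_imp_stable:
  assumes W: "scheme_submodule I M W"
  shows "stable_subspace I {..<deg M} (rep_coeff M) (fun_of_vec (deg M) ` W)"
proof -
  let ?d = "deg M"
  have carr: "W \<subseteq> carrier_vec ?d" and Wsub: "0\<^sub>v ?d \<in> W" "\<And>v w. v \<in> W \<Longrightarrow> w \<in> W \<Longrightarrow> v + w \<in> W"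
    "\<And>c v. v \<in> W \<Longrightarrow> c \<cdot>\<^sub>v v \<in> W"
    using W unfolding scheme_submodule_def subspace_vec_iff by auto
  have sub: "fs.subspace (fun_of_vec ?d ` W)"
    unfolding subspace_fs_iff
  proof (intro conjI ballI allI)
    show "(\<lambda>x. 0) \<in> fun_of_vec ?d ` W" by (rule image_eqI[OF _ Wsub(1)]) (auto simp: fun_of_vec_def)
    show "(\<lambda>x. f x + g x) \<in> fun_of_vec ?d ` W" if fg: "f \<in> fun_of_vec ?d ` W" "g \<in> fun_of_vec ?d ` W" for f g
    proof -
      obtain x y where xy: "x \<in> W" "y \<in> W" "f = fun_of_vec ?d x" "g = fun_of_vec ?d y" using fg by blast
      show ?thesis by (rule image_eqI[OF _ Wsub(2)[OF xy(1,2)]]) (use carr xy in \<open>auto simp: fun_of_vec_def fun_eq_iff\<close>)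
    qed
    show "(\<lambda>x. c * f x) \<in> fun_of_vec ?d ` W" if f: "f \<in> fun_of_vec ?d ` W" for f c
    proof -
      obtain x where x: "x \<in> W" "f = fun_of_vec ?d x" using f by blast
      show ?thesis by (rule image_eqI[OF _ Wsub(3)[OF x(1), of c]]) (use carr x in \<open>auto simp: fun_of_vec_def fun_eq_iff\<close>)
    qed
  qed
  moreover have "fun_of_vec ?d ` W \<subseteq> supported {..<?d}" using fun_of_vec_simps(1) by blast
  moreover have "mv {..<?d} (\<lambda>i j. \<delta> (rep_coeff M i j)) (fun_of_vec ?d w) \<in> fun_of_vec ?d ` W" (is "?x \<in> _")
    if \<delta>: "distribution I \<delta>" and w: "w \<in> W" for \<delta> w
  proof (rule ccontr)
    assume "?x \<notin> fun_of_vec ?d ` W"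
    then obtain \<phi> where \<phi>: "functional \<phi>" "\<And>f. f \<in> fun_of_vec ?d ` W \<Longrightarrow> \<phi> f = 0" "\<phi> ?x \<noteq> 0"
      using separating_functional[OF sub] by blast
    \<comment> \<open>The separating functional in coordinates: it becomes a linear form vanishing
      on \<open>W\<close>, to which the definition of a subcomodule applies.\<close>
    define c where "c = vec ?d (\<lambda>i. \<phi> (\<lambda>j. if j = i then 1 else 0))"
    have c_dot: "c \<bullet> vec ?d u = \<phi> u" if u: "u \<in> supported {..<?d}" for u
    proof -
      have "u = (\<lambda>j. \<Sum>i<?d. u i * (if j = i then 1 else 0))"
        using u by (auto simp: supported_def fun_eq_iff if_distrib[of "\<lambda>c. _ * c"] cong: if_cong)
      then have "\<phi> u = \<phi> (\<lambda>j. \<Sum>i<?d. u i * (if j = i then 1 else 0))" by (rule arg_cong)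
      also have "\<dots> = (\<Sum>i<?d. u i * \<phi> (\<lambda>j. if j = i then 1 else 0))"
        by (simp only: functional_sum[OF \<phi>(1)] functional_simps[OF \<phi>(1)])
      finally show ?thesis by (simp add: c_def scalar_prod_def atLeast0LessThan mult.commute)
    qed
    have "c \<bullet> u = 0" if "u \<in> W" for u
      using c_dot[OF fun_of_vec_simps(1), of u] \<phi>(2) that carr fun_of_vec_simps(2)[of u ?d] by force
    then have "(\<lambda>g. c \<bullet> (act M g *\<^sub>v w)) \<in> I"
      using W w unfolding scheme_submodule_def by (metis c_def vec_carrier)
    then have "\<delta> (\<lambda>g. c \<bullet> (act M g *\<^sub>v w)) = 0" using \<delta> by (simp add: distribution_def)
    moreover have "\<delta> (\<lambda>g. c \<bullet> (act M g *\<^sub>v w)) = c \<bullet> vec ?d ?x"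
      using w carr by (intro distribution_matrix_coeff[OF \<delta>]) (auto simp: c_def)
    ultimately show False using \<phi>(3) c_dot[OF mv_supported] by simp
  qed
  ultimately show ?thesis unfolding stable_subspace_def by blast
qed

lemma simple_imp_scheme_simple:
  assumes X: "simple_subspace I {..<deg M} (rep_coeff M) X"
  shows "scheme_simple_submodule I M (vec (deg M) ` X)"
proof -
  let ?d = "deg M"
  have st: "stable_subspace I {..<?d} (rep_coeff M) X" and supp: "X \<subseteq> supported {..<?d}"
    using X by (auto simp: simple_subspace_def stable_subspace_def)
  have rev_image: "fun_of_vec ?d ` vec ?d ` X = X"
    by (rule fun_of_vec_vec_image[OF supp])
  have zero: "fun_of_vec ?d (0\<^sub>v ?d) = (\<lambda>_. 0)" "vec ?d (\<lambda>_. 0) = 0\<^sub>v ?d" by (auto simp: fun_of_vec_def)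
  have "vec ?d ` X \<noteq> {0\<^sub>v ?d}"
  proof
    assume "vec ?d ` X = {0\<^sub>v ?d}"
    then have "fun_of_vec ?d ` vec ?d ` X = {\<lambda>_. 0}" using zero(1) by simp
    then show False using X unfolding rev_image by (simp add: simple_subspace_def)
  qed
  moreover have "U = {0\<^sub>v ?d} \<or> U = vec ?d ` X" if U: "scheme_submodule I M U" "U \<subseteq> vec ?d ` X" for U
  proof -
    have "U \<subseteq> carrier_vec ?d" using U(2) by auto
    then have U_eq: "U = vec ?d ` fun_of_vec ?d ` U"
      by (rule vec_fun_of_vec_image[symmetric])
    have "fun_of_vec ?d ` U \<subseteq> X" using U(2) rev_image by blast
    then have "fun_of_vec ?d ` U = {\<lambda>_. 0} \<or> fun_of_vec ?d ` U = X"
      using X scheme_submodule_imp_stable[OF U(1)] unfolding simple_subspace_def by blast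
    then show ?thesis
    proof
      assume "fun_of_vec ?d ` U = {\<lambda>_. 0}"
      then have "vec ?d ` fun_of_vec ?d ` U = {0\<^sub>v ?d}" using zero(2) by simp
      then show ?thesis unfolding U_eq[symmetric] by blast
    next
      assume eq: "fun_of_vec ?d ` U = X"
      show ?thesis using U_eq unfolding eq by blast
    qed
  qed
  ultimately show ?thesis
    using stable_imp_scheme_submodule[OF st] unfolding scheme_simple_submodule_def by blast
qed

lemma scheme_simple_imp_simple:
  assumes S: "scheme_simple_submodule I M S"
  shows "simple_subspace I {..<deg M} (rep_coeff M) (fun_of_vec (deg M) ` S)"
proof -
  let ?d = "deg M"
  have sm: "scheme_submodule I M S" using S by (simp add: scheme_simple_submodule_def)
  then have "S \<subseteq> carrier_vec ?d" unfolding scheme_submodule_def subspace_vec_iff by blast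
  then have rev_image: "vec ?d ` fun_of_vec ?d ` S = S"
    by (rule vec_fun_of_vec_image)
  have zero: "fun_of_vec ?d (0\<^sub>v ?d) = (\<lambda>_. 0)" "vec ?d (\<lambda>_. 0) = 0\<^sub>v ?d" by (auto simp: fun_of_vec_def)
  have "fun_of_vec ?d ` S \<noteq> {\<lambda>_. 0}"
  proof
    assume "fun_of_vec ?d ` S = {\<lambda>_. 0}"
    then have "vec ?d ` fun_of_vec ?d ` S = {0\<^sub>v ?d}" using zero(2) by simp
    then show False using S unfolding rev_image by (simp add: scheme_simple_submodule_def)
  qed
  moreover have "U = {\<lambda>_. 0} \<or> U = fun_of_vec ?d ` S"
    if U: "stable_subspace I {..<?d} (rep_coeff M) U" "U \<subseteq> fun_of_vec ?d ` S" for U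
  proof -
    have "U \<subseteq> supported {..<?d}" using U(1) by (simp add: stable_subspace_def)
    then have U_eq: "U = fun_of_vec ?d ` vec ?d ` U"
      by (rule fun_of_vec_vec_image[symmetric])
    have "vec ?d ` U \<subseteq> S" using U(2) rev_image by blast
    then have "vec ?d ` U = {0\<^sub>v ?d} \<or> vec ?d ` U = S"
      using S stable_imp_scheme_submodule[OF U(1)] unfolding scheme_simple_submodule_def by blast
    then show ?thesis
    proof
      assume "vec ?d ` U = {0\<^sub>v ?d}"
      then have "fun_of_vec ?d ` vec ?d ` U = {\<lambda>_. 0}" using zero(1) by simp
      then show ?thesis unfolding U_eq[symmetric] by blast
    next
      assume eq: "vec ?d ` U = S"
      show ?thesis using U_eq unfolding eq by blast
    qed
  qed
  ultimately show ?thesis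
    using scheme_submodule_imp_stable[OF sm] unfolding simple_subspace_def by blast
qed

text \<open>The socle is the intersection of all subspaces containing every simple submodule, so it
  contains them too. In this form the assumption on socles enters the argument.\<close>

lemma simple_scheme_socle:
  assumes "scheme_simple_submodule I M (scheme_socle I M)"
  obtains S where "simple_subspace I {..<deg M} (rep_coeff M) S"
    "\<And>X. simple_subspace I {..<deg M} (rep_coeff M) X \<Longrightarrow> X \<subseteq> S"
proof
  let ?d = "deg M"
  show "simple_subspace I {..<?d} (rep_coeff M) (fun_of_vec ?d ` scheme_socle I M)"
    by (rule scheme_simple_imp_simple[OF assms])
  fix X assume X: "simple_subspace I {..<?d} (rep_coeff M) X"
  then have supp: "X \<subseteq> supported {..<?d}" by (simp add: simple_subspace_def stable_subspace_def)
  have "vec ?d ` X \<subseteq> scheme_socle I M"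
    using simple_imp_scheme_simple[OF X] unfolding scheme_socle_def by blast
  then have "fun_of_vec ?d ` vec ?d ` X \<subseteq> fun_of_vec ?d ` scheme_socle I M" by blast
  then show "X \<subseteq> fun_of_vec ?d ` scheme_socle I M"
    unfolding fun_of_vec_vec_image[OF supp] .
qed

end

section \<open>The Frobenius kernel and twists\<close>

text \<open>A representation as an array of functions: twisting is composition of each entry with
  \<open>F\<close>, and entries can be fed directly to distributions.\<close>

definition matrix_coeffs :: "nat \<Rightarrow> 'k::field mat set \<Rightarrow> nat \<Rightarrow> (nat \<Rightarrow> nat \<Rightarrow> 'k mat \<Rightarrow> 'k) \<Rightarrow> bool" where
  "matrix_coeffs n G d v \<longleftrightarrow> (\<forall>i<d. \<forall>j<d. regular n G (v i j)) \<and>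
     (\<forall>i<d. \<forall>j<d. v i j (1\<^sub>m n) = (if i = j then 1 else 0)) \<and>
     (\<forall>g\<in>G. \<forall>h\<in>G. \<forall>i<d. \<forall>k<d. v i k (g * h) = (\<Sum>j<d. v i j g * v j k h))"

lemma matrix_coeffsD:
  assumes "matrix_coeffs n G d v"
  shows "i < d \<Longrightarrow> j < d \<Longrightarrow> regular n G (v i j)"
    "i < d \<Longrightarrow> j < d \<Longrightarrow> v i j (1\<^sub>m n) = (if i = j then 1 else 0)"
    "g \<in> G \<Longrightarrow> h \<in> G \<Longrightarrow> i < d \<Longrightarrow> k < d \<Longrightarrow> v i k (g * h) = (\<Sum>j<d. v i j g * v j k h)"
  using assms by (auto simp: matrix_coeffs_def)

text \<open>Indecomposability read in the endomorphism ring. Degree \<open>0\<close> is allowed, so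
  nonvanishing of the degree travels separately through the induction.\<close>

definition trivial_idempotents :: "'k::field mat set \<Rightarrow> nat \<Rightarrow> (nat \<Rightarrow> nat \<Rightarrow> 'k mat \<Rightarrow> 'k) \<Rightarrow> bool" where
  "trivial_idempotents G d v \<longleftrightarrow> (\<forall>e. (\<forall>i<d. \<forall>k<d. (\<Sum>j<d. e i j * e j k) = e i k) \<and>
     (\<forall>g\<in>G. \<forall>i<d. \<forall>k<d. (\<Sum>j<d. e i j * v j k g) = (\<Sum>j<d. v i j g * e j k)) \<longrightarrow>
     (\<forall>i<d. \<forall>k<d. e i k = 0) \<or> (\<forall>i<d. \<forall>k<d. e i k = (if i = k then 1 else 0)))"

lemma matrix_coeffs_inverse:
  fixes G :: "'k::field mat set"
  assumes G: "subgroup G (GL n)" and v: "matrix_coeffs n G d v" and g: "g \<in> G" and ij: "i < d" "k < d"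
  shows "(\<Sum>j<d. v i j g * v j k (mat_inv n g)) = (if i = k then 1 else 0)"
    "(\<Sum>j<d. v i j (mat_inv n g) * v j k g) = (if i = k then 1 else 0)"
  using matrix_coeffsD(3)[OF v g subgroup_GLD(5)[OF G g] ij]
    matrix_coeffsD(3)[OF v subgroup_GLD(5)[OF G g] g ij]
    mat_inv_simps(2,3)[OF subgroup_GLD(1)[OF G g]] matrix_coeffsD(2)[OF v ij]
  by simp_all

text \<open>\<open>A \<chi>\<close> is the projection onto the weight space of \<open>\<chi>\<close>.\<close>

lemma torus_weights:
  fixes T :: "'k::alg_closed_field mat set"
  assumes torus: "torus n T" and v: "matrix_coeffs n T r v"
  obtains X A where "finite X" "X \<subseteq> characters n T"
    "\<And>a b. a < r \<Longrightarrow> b < r \<Longrightarrow> (\<Sum>\<chi>\<in>X. A \<chi> a b) = (if a = b then 1 else 0)"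
    "\<And>\<chi> t a c. \<chi> \<in> X \<Longrightarrow> t \<in> T \<Longrightarrow> a < r \<Longrightarrow> c < r \<Longrightarrow> (\<Sum>b<r. v a b t * A \<chi> b c) = \<chi> t * A \<chi> a c"
    "\<And>\<chi> t a c. \<chi> \<in> X \<Longrightarrow> t \<in> T \<Longrightarrow> a < r \<Longrightarrow> c < r \<Longrightarrow> (\<Sum>b<r. A \<chi> a b * v b c t) = \<chi> t * A \<chi> a c"
proof -
  note T = torus_subgroup[OF torus]
  have fin: "finite ({..<r} \<times> {..<r})" by simp
  have reg: "regular n T (case_prod v p)" if "p \<in> {..<r} \<times> {..<r}" for p
    using that matrix_coeffsD(1)[OF v] by (cases p) simp
  show ?thesis
  proof (rule torus_regular_expansion[OF torus fin reg])
    fix X a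
    assume X: "finite X" "X \<subseteq> characters n T"
      and exp: "\<And>p t. p \<in> {..<r} \<times> {..<r} \<Longrightarrow> t \<in> T \<Longrightarrow> case_prod v p t = (\<Sum>\<chi>\<in>X. a p \<chi> * \<chi> t)"
    define A where "A \<chi> i j = a (i, j) \<chi>" for \<chi> i j
    have v_exp: "v i j t = (\<Sum>\<chi>\<in>X. A \<chi> i j * \<chi> t)" if "i < r" "j < r" "t \<in> T" for i j t
      using exp[of "(i, j)" t] that by (simp add: A_def)
    have mult: "\<chi> (s * t) = \<chi> s * \<chi> t" if "\<chi> \<in> X" "s \<in> T" "t \<in> T" for \<chi> s t
      using charactersD(3) X(2) that by blast
    have one: "(\<Sum>\<chi>\<in>X. A \<chi> i j) = (if i = j then 1 else 0)" if "i < r" "j < r" for i j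
    proof -
      have "(\<Sum>\<chi>\<in>X. A \<chi> i j) = (\<Sum>\<chi>\<in>X. A \<chi> i j * \<chi> (1\<^sub>m n))"
        using character_one[OF T] X(2) by (intro sum.cong) auto
      also have "\<dots> = v i j (1\<^sub>m n)" using v_exp[OF that subgroup_GLD(3)[OF T]] by simp
      finally show ?thesis using matrix_coeffsD(2)[OF v that] by simp
    qed
    \<comment> \<open>Both sides are coefficients of \<open>\<chi> t\<close> in
      \<open>v (s * t)\<close>, expanded once as a matrix product and once by multiplicativity of
      characters; independence identifies them.\<close>
    have left: "(\<Sum>b<r. v i b s * A \<chi> b j) = \<chi> s * A \<chi> i j"
      if \<chi>: "\<chi> \<in> X" and s: "s \<in> T" and ij: "i < r" "j < r" for \<chi> s i j
    proof -
      have "(\<Sum>\<omega>\<in>X. ((\<Sum>b<r. v i b s * A \<omega> b j) - \<omega> s * A \<omega> i j) * \<omega> t) = 0" if t: "t \<in> T" for t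
      proof -
        have "(\<Sum>\<omega>\<in>X. (\<Sum>b<r. v i b s * A \<omega> b j) * \<omega> t) = (\<Sum>b<r. v i b s * v b j t)"
          using v_exp[OF _ ij(2) t]
          by (simp add: sum_distrib_left sum_distrib_right mult.assoc sum.swap[of _ X])
        also have "\<dots> = v i j (s * t)" using matrix_coeffsD(3)[OF v s t ij] by simp
        also have "\<dots> = (\<Sum>\<omega>\<in>X. \<omega> s * A \<omega> i j * \<omega> t)"
          unfolding v_exp[OF ij subgroup_GLD(4)[OF T s t]]
          by (intro sum.cong refl) (simp add: mult[OF _ s t] mult_ac)
        finally show ?thesis by (simp add: left_diff_distrib sum_subtractf)
      qed
      then have "(\<Sum>b<r. v i b s * A \<chi> b j) - \<chi> s * A \<chi> i j = 0"
        by (rule characters_independent[OF T X _ \<chi>])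
      then show ?thesis by simp
    qed
    have right: "(\<Sum>b<r. A \<chi> i b * v b j s) = \<chi> s * A \<chi> i j"
      if \<chi>: "\<chi> \<in> X" and s: "s \<in> T" and ij: "i < r" "j < r" for \<chi> s i j
    proof -
      have "(\<Sum>\<omega>\<in>X. ((\<Sum>b<r. A \<omega> i b * v b j s) - \<omega> s * A \<omega> i j) * \<omega> t) = 0" if t: "t \<in> T" for t
      proof -
        have "(\<Sum>\<omega>\<in>X. (\<Sum>b<r. A \<omega> i b * v b j s) * \<omega> t) = (\<Sum>b<r. (\<Sum>\<omega>\<in>X. A \<omega> i b * \<omega> t) * v b j s)"
          unfolding sum_distrib_right by (subst sum.swap) (simp only: mult_ac)
        also have "\<dots> = (\<Sum>b<r. v i b t * v b j s)" using v_exp[OF ij(1) _ t] by simp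
        also have "\<dots> = v i j (t * s)" using matrix_coeffsD(3)[OF v t s ij] by simp
        also have "\<dots> = (\<Sum>\<omega>\<in>X. \<omega> s * A \<omega> i j * \<omega> t)"
          unfolding v_exp[OF ij subgroup_GLD(4)[OF T t s]]
          by (intro sum.cong refl) (simp add: mult[OF _ t s] mult_ac)
        finally show ?thesis by (simp add: left_diff_distrib sum_subtractf)
      qed
      then have "(\<Sum>b<r. A \<chi> i b * v b j s) - \<chi> s * A \<chi> i j = 0"
        by (rule characters_independent[OF T X _ \<chi>])
      then show ?thesis by simp
    qed
    show ?thesis by (rule that[of X A]) (use X one left right in auto)
  qed
qed

locale frobenius_setting =
  fixes n :: nat and G T :: "'k::alg_closed_field mat set" and F :: "'k mat \<Rightarrow> 'k mat"
  assumes char_pos: "CHAR('k) > 0" and G: "subgroup G (GL n)"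
    and closed: "zariski_closed n G" and connected: "zariski_connected n G"
    and torus: "torus n T" and TG: "T \<subseteq> G" and frob: "frobenius n G T F"
begin

abbreviation "ideal \<equiv> G1T_ideal n G T F"

lemma alg_hom_F: "alg_hom n G n G F" using frob by (simp add: frobenius_def)

lemma T: "subgroup T (GL n)" by (rule torus_subgroup[OF torus])

lemma ideal_subspace: "fs.subspace ideal"
  unfolding subspace_fs_iff
proof (intro conjI ballI allI)
  show "(\<lambda>x. 0) \<in> ideal" using G1T_ideal.pullback[of n G "\<lambda>x. 0" T F] by (simp add: regular_const)
  show "(\<lambda>x. c * f x) \<in> ideal" if "f \<in> ideal" for c f
    using G1T_ideal.mult[OF regular_const that, of c] .
qed (rule G1T_ideal.add)

lemma ideal_cong: "a \<in> ideal \<Longrightarrow> (\<And>g. g \<in> G \<Longrightarrow> b g = a g) \<Longrightarrow> b \<in> ideal"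
  by (rule G1T_ideal.cong)

lemma regular_F: "regular n G f \<Longrightarrow> regular n G (\<lambda>g. f (F g))"
  by (rule regular_comp_alg_hom[OF G G alg_hom_F])

lemma F_T:
  assumes t: "t \<in> T"
  shows "F t \<in> T" and "\<chi> \<in> characters n T \<Longrightarrow> \<chi> (F t) = \<chi> t ^ CHAR('k)"
proof -
  have *: "t [^]\<^bsub>GL n\<^esub> k \<in> T \<and> (\<forall>\<chi>\<in>characters n T. \<chi> (t [^]\<^bsub>GL n\<^esub> k) = \<chi> t ^ k)" for k :: nat
  proof (induction k)
    case 0
    then show ?case using subgroup_GLD(3)[OF T] character_one[OF T] by (auto simp: nat_pow_def one_GL)
  next
    case (Suc k)
    have "t [^]\<^bsub>GL n\<^esub> Suc k = t [^]\<^bsub>GL n\<^esub> k * t" by (simp add: nat_pow_def mult_GL)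
    moreover have "\<chi> (t [^]\<^bsub>GL n\<^esub> k * t) = \<chi> t ^ Suc k" if "\<chi> \<in> characters n T" for \<chi>
      using charactersD(3)[OF that _ t] Suc that by (simp add: mult.commute)
    ultimately show ?case using Suc subgroup_GLD(4)[OF T _ t] by auto
  qed
  have Ft: "F t = t [^]\<^bsub>GL n\<^esub> CHAR('k)" using frob t by (simp add: frobenius_def)
  show "F t \<in> T" and "\<chi> \<in> characters n T \<Longrightarrow> \<chi> (F t) = \<chi> t ^ CHAR('k)"
    using * unfolding Ft by auto
qed

text \<open>\<open>T\<close> lies in G_1T: a generator \<open>f \<circ> F\<close> of the ideal
  vanishes at \<open>t\<close> because \<open>F t\<close> is again in \<open>T\<close>.\<close>

lemma evaluation_distribution:
  assumes t: "t \<in> T"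
  shows "distribution ideal (\<lambda>f. f t)"
proof -
  have "f t = 0" if "f \<in> ideal" for f
    using that
  proof induction
    case (pullback f)
    then show ?case using F_T(1)[OF t] by simp
  next
    case (cong a b)
    then show ?case using t TG by auto
  qed simp_all
  then show ?thesis by (simp add: distribution_def functional_def)
qed

text \<open>The function \<open>x \<circ> F\<close> acting on functionals. If \<open>x\<close>
  restricts to a character of \<open>T\<close>, then \<open>x \<circ> F\<close> is the coefficient
  of a one-dimensional G_1T-module, and tensoring with that module replaces the action of
  \<open>\<delta>\<close> by that of \<open>tw \<delta> x\<close>.\<close>

definition tw :: "(('k mat \<Rightarrow> 'k) \<Rightarrow> 'k) \<Rightarrow> ('k mat \<Rightarrow> 'k) \<Rightarrow> ('k mat \<Rightarrow> 'k) \<Rightarrow> 'k" where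
  "tw \<delta> x h = \<delta> (\<lambda>g. h g * x (F g))"

lemma distribution_tw:
  assumes \<delta>: "distribution ideal \<delta>" and x: "regular n G x"
  shows "distribution ideal (tw \<delta> x)"
proof -
  have fl: "functional \<delta>" using \<delta> by (simp add: distribution_def)
  have "functional (tw \<delta> x)"
    unfolding functional_def tw_def by (simp add: distrib_right mult.assoc functional_simps[OF fl])
  moreover have "tw \<delta> x f = 0" if "f \<in> ideal" for f
  proof -
    have "(\<lambda>g. f g * x (F g)) \<in> ideal"
      using G1T_ideal.mult[OF regular_F[OF x] that] by (simp add: mult.commute)
    then show ?thesis using \<delta> by (simp add: distribution_def tw_def)
  qed
  ultimately show ?thesis by (simp add: distribution_def)
qed

text \<open>The difference of \<open>x \<circ> F\<close> and \<open>y \<circ> F\<close> lies in the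
  ideal. This is why G_1T sees a Frobenius twist only through its restriction to
  \<open>T\<close>.\<close>

lemma tw_cong:
  assumes \<delta>: "distribution ideal \<delta>" and h: "regular n G h" and xy: "regular n G x" "regular n G y"
    and eq: "\<And>t. t \<in> T \<Longrightarrow> x t = y t"
  shows "tw \<delta> x h = tw \<delta> y h"
proof -
  have fl: "functional \<delta>" using \<delta> by (simp add: distribution_def)
  have "(\<lambda>g. x (F g) - y (F g)) \<in> ideal"
    using G1T_ideal.pullback[of n G "\<lambda>g. x g - y g" T F] regular_diff[OF xy] eq by simp
  from G1T_ideal.mult[OF h this] have "\<delta> (\<lambda>g. h g * x (F g) - h g * y (F g)) = 0"
    using \<delta> by (simp add: distribution_def right_diff_distrib)
  then show ?thesis by (simp add: tw_def functional_simps[OF fl])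
qed

lemma tw_tw: "tw (tw \<delta> x) y = tw \<delta> (\<lambda>g. x g * y g)"
  by (simp add: tw_def fun_eq_iff mult_ac)

lemma tw_inverse:
  assumes \<delta>: "distribution ideal \<delta>" and h: "regular n G h" and xy: "regular n G x" "regular n G y"
    and eq: "\<And>t. t \<in> T \<Longrightarrow> x t * y t = 1"
  shows "tw (tw \<delta> x) y h = \<delta> h"
proof -
  have "tw (tw \<delta> x) y h = tw \<delta> (\<lambda>g. 1) h"
    unfolding tw_tw by (rule tw_cong[OF \<delta> h regular_mult[OF xy] regular_const eq])
  then show ?thesis by (simp add: tw_def)
qed

text \<open>Characters are regular on \<open>T\<close>, while \<open>tw\<close> needs functions on
  \<open>G\<close>. The two representatives are inverse to each other on \<open>T\<close>, and
  \<open>tw\<close> sees only values there.\<close>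

lemma character_extension:
  assumes "\<chi> \<in> characters n T"
  obtains x y where "regular n G x" "regular n G y" "\<And>t. t \<in> T \<Longrightarrow> x t = \<chi> t" "\<And>t. t \<in> T \<Longrightarrow> y t = inverse (\<chi> t)"
proof -
  obtain x where "x \<in> GL_functions n" "\<And>t. t \<in> T \<Longrightarrow> \<chi> t = x t"
    using charactersD(1)[OF assms] by (auto simp: regular_def)
  moreover obtain y where "y \<in> GL_functions n" "\<And>t. t \<in> T \<Longrightarrow> inverse (\<chi> t) = y t"
    using character_inverse[OF T assms] by (auto simp: regular_def)
  ultimately show ?thesis using that[of x y] regular_GL_function by metis
qed

end

section \<open>Idempotents of a twisted tensor product\<close>

locale twisted_tensor = frobenius_setting +
  fixes d r :: nat and v \<nu> :: "nat \<Rightarrow> nat \<Rightarrow> 'a mat \<Rightarrow> 'a" and S :: "(nat \<Rightarrow> 'a) set"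
    and e :: "nat \<times> nat \<Rightarrow> nat \<times> nat \<Rightarrow> 'a"
  assumes v: "matrix_coeffs n G d v" and \<nu>: "matrix_coeffs n G r \<nu>"
    and S: "simple_subspace ideal {..<d} v S"
    and socle: "\<And>X. simple_subspace ideal {..<d} v X \<Longrightarrow> X \<subseteq> S"
    and idem: "\<And>p s. p \<in> {..<d} \<times> {..<r} \<Longrightarrow> s \<in> {..<d} \<times> {..<r} \<Longrightarrow>
      (\<Sum>q\<in>{..<d} \<times> {..<r}. e p q * e q s) = e p s"
    and comm: "\<And>g p s. g \<in> G \<Longrightarrow> p \<in> {..<d} \<times> {..<r} \<Longrightarrow> s \<in> {..<d} \<times> {..<r} \<Longrightarrow>
      (\<Sum>q\<in>{..<d} \<times> {..<r}. e p q * (v (fst q) (fst s) g * \<nu> (snd q) (snd s) (F g))) =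
      (\<Sum>q\<in>{..<d} \<times> {..<r}. v (fst p) (fst q) g * \<nu> (snd p) (snd q) (F g) * e q s)"
begin

abbreviation "D \<equiv> {..<d}"
abbreviation "J \<equiv> {..<d} \<times> {..<r}"

text \<open>Coefficients of \<open>V \<otimes> N^[1]\<close> in the basis indexed by pairs, which
  postpones the arithmetic of Kronecker indices.\<close>

definition m :: "nat \<times> nat \<Rightarrow> nat \<times> nat \<Rightarrow> 'a mat \<Rightarrow> 'a" where
  "m p q g = v (fst p) (fst q) g * \<nu> (snd p) (snd q) (F g)"

abbreviation "opV \<delta> \<equiv> mv D (\<lambda>i j. \<delta> (v i j))"
abbreviation "opR \<delta> \<equiv> mv J (\<lambda>p q. \<delta> (m p q))"
abbreviation "E \<equiv> mv J e"

text \<open>The map \<open>id \<otimes> \<alpha>\<close> from \<open>V \<otimes> N\<close> to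
  \<open>V\<close>. Its counterpart \<open>incl \<beta>\<close> sends \<open>x\<close> to
  \<open>x \<otimes> \<beta>\<close>; the first index is left unbounded, as \<open>E\<close> reads
  only entries in \<open>J\<close>.\<close>

definition proj :: "(nat \<Rightarrow> 'a) \<Rightarrow> (nat \<times> nat \<Rightarrow> 'a) \<Rightarrow> nat \<Rightarrow> 'a" where
  "proj \<alpha> u = (\<lambda>i. \<Sum>b<r. \<alpha> b * u (i, b))"

definition incl :: "(nat \<Rightarrow> 'a) \<Rightarrow> (nat \<Rightarrow> 'a) \<Rightarrow> nat \<times> nat \<Rightarrow> 'a" where
  "incl \<beta> x = (\<lambda>p. if snd p < r then x (fst p) * \<beta> (snd p) else 0)"

lemma linear_proj: "linear_op (proj \<alpha>)"
  by (simp add: linear_op_def proj_def distrib_left sum.distrib sum_distrib_left mult.left_commute)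

lemma proj_supported: "u \<in> supported J \<Longrightarrow> proj \<alpha> u \<in> supported D"
  by (auto simp: proj_def supported_def)

lemma sum_J: "(\<Sum>q\<in>J. f q) = (\<Sum>j<d. \<Sum>b<r. f (j, b))"
  by (simp add: sum.cartesian_product)

lemma dist_functional: "distribution ideal \<delta> \<Longrightarrow> functional \<delta>"
  by (simp add: distribution_def)

text \<open>Commuting with every \<open>g\<close> is an identity of functions on \<open>G\<close>,
  to which a distribution can be applied entry by entry.\<close>

lemma E_opR:
  assumes \<delta>: "distribution ideal \<delta>"
  shows "E (opR \<delta> u) = opR \<delta> (E u)"
  unfolding mv_mv
proof (rule mv_cong)
  note fl = dist_functional[OF \<delta>]
  fix p s assume ps: "p \<in> J" "s \<in> J"
  have "(\<Sum>q\<in>J. e p q * \<delta> (m q s)) = \<delta> (\<lambda>g. \<Sum>q\<in>J. e p q * m q s g)"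
    by (simp only: functional_sum[OF fl] functional_simps(2)[OF fl])
  also have "\<dots> = \<delta> (\<lambda>g. \<Sum>q\<in>J. m p q g * e q s)"
  proof (rule distribution_cong[OF ideal_subspace ideal_cong \<delta>])
    fix g assume "g \<in> G"
    from comm[OF this ps] show "(\<Sum>q\<in>J. e p q * m q s g) = (\<Sum>q\<in>J. m p q g * e q s)"
      by (simp add: m_def)
  qed
  also have "\<dots> = (\<Sum>q\<in>J. \<delta> (m p q) * e q s)"
    by (simp only: functional_sum[OF fl] functional_simps(3)[OF fl])
  finally show "(\<Sum>q\<in>J. e p q * \<delta> (m q s)) = (\<Sum>q\<in>J. \<delta> (m p q) * e q s)" .
qed

text \<open>A row of weight \<open>\<chi>\<close>, that is, a \<open>T\<close>-eigenvector in the
  dual of N; \<open>wvector\<close> is the version for columns.\<close>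

definition covector :: "('a mat \<Rightarrow> 'a) \<Rightarrow> (nat \<Rightarrow> 'a) \<Rightarrow> bool" where
  "covector \<chi> \<alpha> \<longleftrightarrow> (\<forall>t\<in>T. \<forall>c<r. (\<Sum>b<r. \<alpha> b * \<nu> b c t) = \<chi> t * \<alpha> c)"

definition wvector :: "('a mat \<Rightarrow> 'a) \<Rightarrow> (nat \<Rightarrow> 'a) \<Rightarrow> bool" where
  "wvector \<chi> \<beta> \<longleftrightarrow> (\<forall>t\<in>T. \<forall>c<r. (\<Sum>b<r. \<nu> c b t * \<beta> b) = \<chi> t * \<beta> c)"

text \<open>By \<open>tw_cong\<close>, the row \<open>\<alpha>\<close> times
  \<open>\<nu> (F g)\<close> may be replaced by \<open>x (F g)\<close> times
  \<open>\<alpha>\<close>. So \<open>id \<otimes> \<alpha>\<close> is equivariant over G_1T up to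
  the twist by \<open>\<chi>\<close>.\<close>

lemma proj_opR:
  assumes \<delta>: "distribution ideal \<delta>" and \<alpha>: "covector \<chi> \<alpha>"
    and x: "regular n G x" "\<And>t. t \<in> T \<Longrightarrow> x t = \<chi> t"
  shows "proj \<alpha> (opR \<delta> u) = opV (tw \<delta> x) (proj \<alpha> u)"
proof
  fix i
  note fl = dist_functional[OF \<delta>]
  have key: "(\<Sum>b<r. \<alpha> b * \<delta> (m (i, b) (j, c))) = tw \<delta> x (v i j) * \<alpha> c" if "i < d" "j < d" "c < r" for j c
  proof -
    have "(\<Sum>b<r. \<alpha> b * \<delta> (m (i, b) (j, c))) = \<delta> (\<lambda>g. \<Sum>b<r. \<alpha> b * m (i, b) (j, c) g)"
      by (simp only: functional_sum[OF fl] functional_simps(2)[OF fl])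
    also have "\<dots> = tw \<delta> (\<lambda>y. \<Sum>b<r. \<alpha> b * \<nu> b c y) (v i j)"
      by (simp add: tw_def m_def sum_distrib_left mult_ac)
    also have "\<dots> = tw \<delta> (\<lambda>y. x y * \<alpha> c) (v i j)"
      using that \<alpha> x(2)
      by (intro tw_cong[OF \<delta>] regular_sum regular_mult regular_const x(1) matrix_coeffsD(1)[OF v] matrix_coeffsD(1)[OF \<nu>])
        (auto simp: covector_def)
    also have "\<dots> = tw \<delta> x (v i j) * \<alpha> c"
      by (simp add: tw_def functional_simps(3)[OF fl] flip: mult.assoc)
    finally show ?thesis .
  qed
  show "proj \<alpha> (opR \<delta> u) i = opV (tw \<delta> x) (proj \<alpha> u) i"
  proof (cases "i < d")
    case True
    have "proj \<alpha> (opR \<delta> u) i = (\<Sum>b<r. \<alpha> b * (\<Sum>j<d. \<Sum>c<r. \<delta> (m (i, b) (j, c)) * u (j, c)))"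
      using True by (simp add: proj_def mv_def sum_J)
    also have "\<dots> = (\<Sum>j<d. \<Sum>c<r. (\<Sum>b<r. \<alpha> b * \<delta> (m (i, b) (j, c))) * u (j, c))"
      unfolding sum_distrib_left sum_distrib_right mult.assoc
      by (subst sum.swap, rule sum.cong[OF refl], rule sum.swap)
    also have "\<dots> = (\<Sum>j<d. \<Sum>c<r. tw \<delta> x (v i j) * \<alpha> c * u (j, c))"
      using True by (intro sum.cong refl) (simp add: key)
    also have "\<dots> = opV (tw \<delta> x) (proj \<alpha> u) i"
      using True by (simp add: mv_def proj_def sum_distrib_left mult.assoc)
    finally show ?thesis .
  qed (simp add: proj_def mv_def)
qed

lemma opR_incl:
  assumes \<delta>: "distribution ideal \<delta>" and \<beta>: "wvector \<chi> \<beta>"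
    and y: "regular n G y" "\<And>t. t \<in> T \<Longrightarrow> y t = \<chi> t"
  shows "opR \<delta> (incl \<beta> x) = incl \<beta> (opV (tw \<delta> y) x)"
proof
  fix p :: "nat \<times> nat"
  obtain i a where p: "p = (i, a)" by (cases p)
  note fl = dist_functional[OF \<delta>]
  have key: "(\<Sum>b<r. \<delta> (m (i, a) (j, b)) * \<beta> b) = tw \<delta> y (v i j) * \<beta> a" if "i < d" "j < d" "a < r" for j
  proof -
    have "(\<Sum>b<r. \<delta> (m (i, a) (j, b)) * \<beta> b) = \<delta> (\<lambda>g. \<Sum>b<r. m (i, a) (j, b) g * \<beta> b)"
      by (simp only: functional_sum[OF fl] functional_simps(3)[OF fl])
    also have "\<dots> = tw \<delta> (\<lambda>y. \<Sum>b<r. \<nu> a b y * \<beta> b) (v i j)"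
      by (simp add: tw_def m_def sum_distrib_left mult.assoc)
    also have "\<dots> = tw \<delta> (\<lambda>z. y z * \<beta> a) (v i j)"
      using that \<beta> y(2)
      by (intro tw_cong[OF \<delta>] regular_sum regular_mult regular_const y(1) matrix_coeffsD(1)[OF v] matrix_coeffsD(1)[OF \<nu>])
        (auto simp: wvector_def)
    also have "\<dots> = tw \<delta> y (v i j) * \<beta> a"
      by (simp add: tw_def functional_simps(3)[OF fl] flip: mult.assoc)
    finally show ?thesis .
  qed
  show "opR \<delta> (incl \<beta> x) p = incl \<beta> (opV (tw \<delta> y) x) p"
  proof (cases "i < d \<and> a < r")
    case True
    have "opR \<delta> (incl \<beta> x) p = (\<Sum>j<d. \<Sum>b<r. \<delta> (m (i, a) (j, b)) * (x j * \<beta> b))"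
      using True by (simp add: p mv_def incl_def sum_J)
    also have "\<dots> = (\<Sum>j<d. (\<Sum>b<r. \<delta> (m (i, a) (j, b)) * \<beta> b) * x j)"
      unfolding sum_distrib_right by (simp only: mult_ac)
    also have "\<dots> = (\<Sum>j<d. tw \<delta> y (v i j) * \<beta> a * x j)"
      using True by (intro sum.cong refl) (simp add: key)
    also have "\<dots> = (\<Sum>j<d. tw \<delta> y (v i j) * x j) * \<beta> a"
      unfolding sum_distrib_right by (simp only: mult_ac)
    also have "\<dots> = incl \<beta> (opV (tw \<delta> y) x) p"
      using True by (simp add: p mv_def incl_def)
    finally show ?thesis .
  qed (auto simp: p mv_def incl_def)
qed

lemma opV_tw_inverse:
  assumes "distribution ideal \<delta>" "regular n G x" "regular n G y" "\<And>t. t \<in> T \<Longrightarrow> x t * y t = 1"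
  shows "opV (tw (tw \<delta> x) y) w = opV \<delta> w"
  by (rule mv_cong) (use tw_inverse[OF assms(1) _ assms(2-4)] matrix_coeffsD(1)[OF v] in auto)

lemma S_facts:
  shows "fs.subspace S" "S \<subseteq> supported D" "\<And>\<delta> x. distribution ideal \<delta> \<Longrightarrow> x \<in> S \<Longrightarrow> opV \<delta> x \<in> S"
    "\<And>U. stable_subspace ideal D v U \<Longrightarrow> U \<subseteq> S \<Longrightarrow> U = {\<lambda>_. 0} \<or> U = S" "S \<noteq> {\<lambda>_. 0}"
  using S by (auto simp: simple_subspace_def stable_subspace_def)

lemma image_in_socle:
  assumes "f ` X = {\<lambda>_. 0} \<or> simple_subspace ideal D v (f ` X)" and "x \<in> X"
  shows "f x \<in> S"
  using assms(1)
proof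
  assume "f ` X = {\<lambda>_. 0}"
  then have "f x = (\<lambda>_. 0)" using assms(2) by blast
  then show ?thesis using subspace_fsD(1)[OF S_facts(1)] by simp
next
  assume "simple_subspace ideal D v (f ` X)"
  from socle[OF this] show ?thesis using assms(2) by blast
qed

text \<open>The image under a map equivariant up to a twist is zero or simple, and \<open>S\<close>
  contains every simple subspace. The twist is undone by \<open>y\<close>, which extends the inverse
  of \<open>\<chi>\<close>.\<close>

lemma proj_simple:
  assumes X: "simple_subspace ideal J m X" and \<chi>: "\<chi> \<in> characters n T" and \<alpha>: "covector \<chi> \<alpha>" and u: "u \<in> X"
  shows "proj \<alpha> u \<in> S"
proof -
  obtain x y where xy: "regular n G x" "regular n G y" "\<And>t. t \<in> T \<Longrightarrow> x t = \<chi> t" "\<And>t. t \<in> T \<Longrightarrow> y t = inverse (\<chi> t)"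
    using character_extension[OF \<chi>] by blast
  have inv: "y t * x t = 1" if "t \<in> T" for t
    using xy(3,4)[OF that] charactersD(2)[OF \<chi> that] by simp
  have "proj \<alpha> ` X = {\<lambda>_. 0} \<or> simple_subspace ideal D v (proj \<alpha> ` X)"
  proof (rule simple_subspace_image[OF X linear_proj, where \<tau> = "\<lambda>\<delta>. tw \<delta> x" and \<tau>' = "\<lambda>\<delta>. tw \<delta> y"])
    show "proj \<alpha> u \<in> supported D" if "u \<in> X" for u
      using that X by (intro proj_supported) (auto simp: simple_subspace_def stable_subspace_def)
    show "proj \<alpha> (opR \<delta> u) = opV (tw \<delta> x) (proj \<alpha> u)" if "distribution ideal \<delta>" for \<delta> u
      by (rule proj_opR[OF that \<alpha> xy(1,3)])
    show "opV \<delta> (proj \<alpha> u) = proj \<alpha> (opR (tw \<delta> y) u)" if \<delta>: "distribution ideal \<delta>" for \<delta> u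
      using proj_opR[OF distribution_tw[OF \<delta> xy(2)] \<alpha> xy(1,3)] opV_tw_inverse[OF \<delta> xy(2,1) inv]
      by simp
  qed (auto intro: distribution_tw xy)
  then show ?thesis using u by (rule image_in_socle)
qed

text \<open>The block \<open>(id \<otimes> \<alpha>) E (_ \<otimes> \<beta>)\<close> of
  \<open>E\<close>, written as one matrix on \<open>V\<close> so that its eigenvalues are finite in
  number.\<close>

definition eps :: "(nat \<Rightarrow> 'a) \<Rightarrow> (nat \<Rightarrow> 'a) \<Rightarrow> (nat \<Rightarrow> 'a) \<Rightarrow> nat \<Rightarrow> 'a" where
  "eps \<alpha> \<beta> = mv D (\<lambda>i j. \<Sum>a<r. \<Sum>b<r. \<alpha> a * e (i, a) (j, b) * \<beta> b)"

lemma proj_E_incl: "proj \<alpha> (E (incl \<beta> x)) = eps \<alpha> \<beta> x"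
proof
  fix i
  have "(\<Sum>a<r. \<alpha> a * (\<Sum>j<d. \<Sum>b<r. e (i, a) (j, b) * (x j * \<beta> b))) =
      (\<Sum>j<d. (\<Sum>a<r. \<Sum>b<r. \<alpha> a * e (i, a) (j, b) * \<beta> b) * x j)"
    unfolding sum_distrib_left sum_distrib_right
    by (subst sum.swap) (simp only: mult_ac)
  then show "proj \<alpha> (E (incl \<beta> x)) i = eps \<alpha> \<beta> x i"
    by (simp add: proj_def mv_def incl_def eps_def sum_J)
qed

lemma eps_supported: "eps \<alpha> \<beta> x \<in> supported D"
  unfolding eps_def by (rule mv_supported)

lemma eps_opV:
  assumes \<delta>: "distribution ideal \<delta>" and \<alpha>: "covector \<chi> \<alpha>" and \<beta>: "wvector \<psi> \<beta>"
    and x: "regular n G x" "\<And>t. t \<in> T \<Longrightarrow> x t = \<chi> t" and y: "regular n G y" "\<And>t. t \<in> T \<Longrightarrow> y t = \<psi> t"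
  shows "eps \<alpha> \<beta> (opV (tw \<delta> y) w) = opV (tw \<delta> x) (eps \<alpha> \<beta> w)"
proof -
  have "eps \<alpha> \<beta> (opV (tw \<delta> y) w) = proj \<alpha> (E (opR \<delta> (incl \<beta> w)))"
    using opR_incl[OF \<delta> \<beta> y, of w] proj_E_incl by simp
  also have "\<dots> = opV (tw \<delta> x) (proj \<alpha> (E (incl \<beta> w)))"
    using E_opR[OF \<delta>] proj_opR[OF \<delta> \<alpha> x] by simp
  finally show ?thesis by (simp only: proj_E_incl)
qed

lemma G_act_nonzero:
  assumes g: "g \<in> G" and x: "x \<in> supported D" "x \<noteq> (\<lambda>_. 0)"
  shows "mv D (\<lambda>i j. v i j g) x \<noteq> (\<lambda>_. 0)"
proof
  assume "mv D (\<lambda>i j. v i j g) x = (\<lambda>_. 0)"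
  then have "mv D (\<lambda>i j. v i j (mat_inv n g)) (mv D (\<lambda>i j. v i j g) x) = (\<lambda>_. 0)"
    using linear_op_simps(3)[OF linear_op_mv] by simp
  moreover have "mv D (\<lambda>i j. v i j (mat_inv n g)) (mv D (\<lambda>i j. v i j g) x) = mv D (\<lambda>p q. if p = q then 1 else 0) x"
    unfolding mv_mv by (rule mv_cong) (use matrix_coeffs_inverse(2)[OF G v g] in auto)
  ultimately show False using mv_one[OF _ x(1)] x(2) by simp
qed

text \<open>For equal weights the twists cancel and an eigenspace fills \<open>S\<close>. For
  distinct weights the scalar is \<open>0\<close>: otherwise the block is injective on
  \<open>S\<close>, and the translates of an eigenvector under \<open>T\<close> have too many
  eigenvalues.\<close>

lemma eps_scalar:
  assumes \<chi>: "\<chi> \<in> characters n T" "covector \<chi> \<alpha>" and \<psi>: "\<psi> \<in> characters n T" "wvector \<psi> \<beta>"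
  shows "\<exists>c. \<forall>s\<in>S. eps \<alpha> \<beta> s = (\<lambda>i. c * s i)"
proof -
  let ?\<epsilon> = "eps \<alpha> \<beta>"
  obtain x x' where x: "regular n G x" "regular n G x'" "\<And>t. t \<in> T \<Longrightarrow> x t = \<chi> t" "\<And>t. t \<in> T \<Longrightarrow> x' t = inverse (\<chi> t)"
    using character_extension[OF \<chi>(1)] by blast
  obtain y y' where y: "regular n G y" "regular n G y'" "\<And>t. t \<in> T \<Longrightarrow> y t = \<psi> t" "\<And>t. t \<in> T \<Longrightarrow> y' t = inverse (\<psi> t)"
    using character_extension[OF \<psi>(1)] by blast
  have xx': "x' t * x t = 1" and yy': "y' t * y t = 1" if "t \<in> T" for t
    using x(3,4)[OF that] y(3,4)[OF that] charactersD(2)[OF \<chi>(1) that] charactersD(2)[OF \<psi>(1) that] by simp_all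
  have lin: "linear_op ?\<epsilon>" unfolding eps_def by (rule linear_op_mv)
  note comm = eps_opV[OF _ \<chi>(2) \<psi>(2) x(1,3) y(1,3)]
  have left: "?\<epsilon> (opV \<delta> w) = opV (tw (tw \<delta> y') x) (?\<epsilon> w)" if \<delta>: "distribution ideal \<delta>" for \<delta> w
    using comm[OF distribution_tw[OF \<delta> y(2)]] opV_tw_inverse[OF \<delta> y(2,1) yy'] by simp
  have right: "opV \<delta> (?\<epsilon> w) = ?\<epsilon> (opV (tw (tw \<delta> x') y) w)" if \<delta>: "distribution ideal \<delta>" for \<delta> w
    using comm[OF distribution_tw[OF \<delta> x(2)]] opV_tw_inverse[OF \<delta> x(2,1) xx'] by simp
  have "?\<epsilon> ` S = {\<lambda>_. 0} \<or> simple_subspace ideal D v (?\<epsilon> ` S)"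
    by (rule simple_subspace_image[OF S lin, where \<tau> = "\<lambda>\<delta>. tw (tw \<delta> y') x" and \<tau>' = "\<lambda>\<delta>. tw (tw \<delta> x') y"])
      (auto intro: distribution_tw x(1,2) y(1,2) left right simp: eps_supported)
  then have \<epsilon>S: "?\<epsilon> s \<in> S" if "s \<in> S" for s
    using that by (rule image_in_socle)
  have zero_in: "(\<lambda>_. 0) \<in> S" by (rule subspace_fsD(1)[OF S_facts(1)])
  obtain s0 where s0: "s0 \<in> S" "s0 \<noteq> (\<lambda>_. 0)" using S_facts(5) zero_in by blast
  obtain c w where w: "w \<in> S" "w \<noteq> (\<lambda>_. 0)" "?\<epsilon> w = (\<lambda>i. c * w i)"
    using eigenvector_in_subspace[OF finite_lessThan S_facts(1,2) lin \<epsilon>S s0] by blast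
  have eigenspace: "fs.subspace {s \<in> S. ?\<epsilon> s = (\<lambda>i. c * s i)}" for c
    unfolding subspace_fs_iff
    using subspace_fsD[OF S_facts(1)] by (auto simp: linear_op_simps[OF lin] distrib_left mult.left_commute)
  show ?thesis
  proof (cases "\<chi> = \<psi>")
    case True
    have "?\<epsilon> (opV \<delta> s) = opV \<delta> (?\<epsilon> s)" if \<delta>: "distribution ideal \<delta>" for \<delta> s
    proof -
      have "y' t * x t = 1" if "t \<in> T" for t using yy'[OF that] x(3)[OF that] y(3)[OF that] True by simp
      then show ?thesis unfolding left[OF \<delta>] by (rule opV_tw_inverse[OF \<delta> y(2) x(1)])
    qed
    then have "stable_subspace ideal D v {s \<in> S. ?\<epsilon> s = (\<lambda>i. c * s i)}"
      unfolding stable_subspace_def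
      using eigenspace S_facts(2,3) linear_op_simps(2)[OF linear_op_mv[of D]] by auto
    then have "{s \<in> S. ?\<epsilon> s = (\<lambda>i. c * s i)} = S"
      using S_facts(4)[of "{s \<in> S. ?\<epsilon> s = (\<lambda>i. c * s i)}"] w by blast
    then show ?thesis by blast
  next
    case False
    \<comment> \<open>With distinct weights \<open>left\<close> changes the functional, so a general
      eigenspace need not be stable; the kernel is insensitive to that change.\<close>
    have "stable_subspace ideal D v {s \<in> S. ?\<epsilon> s = (\<lambda>i. 0 * s i)}"
      unfolding stable_subspace_def
      using eigenspace[of 0] S_facts(2,3) left linear_op_simps(3)[OF linear_op_mv[of D]] by auto
    then consider "{s \<in> S. ?\<epsilon> s = (\<lambda>i. 0 * s i)} = {\<lambda>_. 0}" | "{s \<in> S. ?\<epsilon> s = (\<lambda>i. 0 * s i)} = S"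
      using S_facts(4)[of "{s \<in> S. ?\<epsilon> s = (\<lambda>i. 0 * s i)}"] by blast
    then show ?thesis
    proof cases
      case 2
      then show ?thesis by blast
    next
      case 1
      have c: "c \<noteq> 0"
      proof
        assume "c = 0"
        then have "w \<in> {s \<in> S. ?\<epsilon> s = (\<lambda>i. 0 * s i)}" using w by simp
        then show False using w(2) unfolding 1 by blast
      qed
      \<comment> \<open>The factor by which translation with \<open>t\<close> changes the eigenvalue
        of \<open>w\<close>, namely the quotient of \<open>\<chi>\<close> and \<open>\<psi>\<close>
        at \<open>F t\<close>; the exponent comes from \<open>F t = t^p\<close>.\<close>
      define \<kappa> where "\<kappa> t = (\<chi> t / \<psi> t) ^ CHAR('a)" for t
      let ?ev = "{c. \<exists>x \<in> supported D. x \<noteq> (\<lambda>_. 0) \<and> ?\<epsilon> x = (\<lambda>i. c * x i)}"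
      have "\<kappa> t * c \<in> ?ev" if t: "t \<in> T" for t
      proof -
        let ?x = "mv D (\<lambda>i j. v i j t) w"
        have tw_eval: "opV (tw (\<lambda>f. f t) z) u = (\<lambda>i. z (F t) * mv D (\<lambda>i j. v i j t) u i)" for z u
          by (auto simp: tw_def mv_def sum_distrib_left mult_ac)
        have "(\<lambda>i. \<psi> (F t) * ?\<epsilon> ?x i) = ?\<epsilon> (opV (tw (\<lambda>f. f t) y) w)"
          unfolding tw_eval linear_op_simps(2)[OF lin] y(3)[OF F_T(1)[OF t]] ..
        also have "\<dots> = opV (tw (\<lambda>f. f t) x) (?\<epsilon> w)"
          by (rule comm[OF evaluation_distribution[OF t]])
        also have "\<dots> = (\<lambda>i. \<chi> (F t) * (c * ?x i))"
          unfolding tw_eval w(3) linear_op_simps(2)[OF linear_op_mv] x(3)[OF F_T(1)[OF t]]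
          by (simp only: mult.left_commute)
        finally have "\<psi> (F t) * ?\<epsilon> ?x i = \<chi> (F t) * (c * ?x i)" for i by (rule fun_cong)
        moreover have "\<psi> (F t) \<noteq> 0" by (rule charactersD(2)[OF \<psi>(1) F_T(1)[OF t]])
        ultimately have "?\<epsilon> ?x = (\<lambda>i. \<kappa> t * c * ?x i)"
          unfolding \<kappa>_def power_divide F_T(2)[OF t \<chi>(1), symmetric] F_T(2)[OF t \<psi>(1), symmetric]
          by (simp add: fun_eq_iff field_simps)
        moreover have "?x \<noteq> (\<lambda>_. 0)"
          using t TG w S_facts(2) by (intro G_act_nonzero) auto
        ultimately show ?thesis using mv_supported by blast
      qed
      then have "(\<lambda>k. k * c) ` \<kappa> ` T \<subseteq> ?ev" by blast
      moreover have "finite ?ev" unfolding eps_def by (rule finite_mv_eigenvalues)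
      ultimately have "finite ((\<lambda>k. k * c) ` \<kappa> ` T)" by (rule finite_subset)
      then have "finite (\<kappa> ` T)" by (rule finite_imageD) (use c in \<open>auto simp: inj_on_def\<close>)
      have "\<kappa> t = 1" if t: "t \<in> T" for t
      proof (rule torus_finite_valued_character[OF torus _ _ \<open>finite (\<kappa> ` T)\<close> t])
        show "\<kappa> (s * t) = \<kappa> s * \<kappa> t" if "s \<in> T" "t \<in> T" for s t
          by (simp add: \<kappa>_def charactersD(3)[OF \<chi>(1) that] charactersD(3)[OF \<psi>(1) that] flip: power_mult_distrib)
        show "\<kappa> t \<noteq> 0" if "t \<in> T" for t
          using charactersD(2)[OF \<chi>(1) that] charactersD(2)[OF \<psi>(1) that] by (simp add: \<kappa>_def)
      qed
      \<comment> \<open>In characteristic p the only p-th root of \<open>1\<close> is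
        \<open>1\<close>.\<close>
      then have "\<chi> t / \<psi> t = 1" if "t \<in> T" for t
        using CHAR_power_inj[OF char_pos, of "\<chi> t / \<psi> t" 1] that by (simp add: \<kappa>_def)
      then have "\<chi> = \<psi>" using charactersD(2)[OF \<psi>(1)]
        by (intro character_eqI[OF \<chi>(1) \<psi>(1)]) (metis eq_divide_eq_1 divide_eq_1_iff)
      then show ?thesis using False by simp
    qed
  qed
qed

section \<open>From weight vectors to the coordinate basis of N\<close>

abbreviation unit :: "nat \<Rightarrow> nat \<Rightarrow> 'a" where
  "unit a \<equiv> (\<lambda>b. if b = a then 1 else 0)"

lemma E_cong: "(\<And>q. q \<in> J \<Longrightarrow> u q = w q) \<Longrightarrow> E u = E w"
  by (auto simp: mv_def fun_eq_iff intro!: sum.cong)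

lemma incl_cong: "(\<And>a. a < r \<Longrightarrow> \<beta> a = \<gamma> a) \<Longrightarrow> incl \<beta> x = incl \<gamma> x"
  by (auto simp: incl_def fun_eq_iff)

lemma proj_unit: "a < r \<Longrightarrow> proj (unit a) u = (\<lambda>i. u (i, a))"
  by (simp add: proj_def if_distrib[of "\<lambda>c. c * _"] cong: if_cong)

lemma proj_sum: "proj (\<lambda>b. \<Sum>i\<in>A. \<alpha> i b) u = (\<lambda>j. \<Sum>i\<in>A. proj (\<alpha> i) u j)"
  unfolding proj_def sum_distrib_right by (rule ext, rule sum.swap)

lemma incl_sum: "incl (\<lambda>b. \<Sum>i\<in>A. \<beta> i b) x = (\<lambda>p. \<Sum>i\<in>A. incl (\<beta> i) x p)"
  by (simp add: incl_def fun_eq_iff sum_distrib_left)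

lemma incl_scale: "incl (\<lambda>b. c * \<beta> b) x = (\<lambda>p. c * incl \<beta> x p)"
  by (simp add: incl_def fun_eq_iff mult.left_commute)

lemma incl_unit_expansion: "incl \<beta> x = (\<lambda>p. \<Sum>b<r. \<beta> b * incl (unit b) x p)"
proof -
  have "incl \<beta> x = incl (\<lambda>c. \<Sum>b<r. \<beta> b * unit b c) x"
    by (rule incl_cong) (simp add: if_distrib[of "\<lambda>c. _ * c"] cong: if_cong)
  then show ?thesis by (simp only: incl_sum incl_scale)
qed

lemma incl_eqD:
  assumes "incl \<beta> x = incl \<gamma> x" "x \<noteq> (\<lambda>_. 0)" "a < r"
  shows "\<beta> a = \<gamma> a"
proof -
  obtain i where "x i \<noteq> 0" using assms(2) by auto
  then show ?thesis using fun_cong[OF assms(1), of "(i, a)"] assms(3) by (simp add: incl_def)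
qed

text \<open>The identity of N as a sum of weight projections. Having both weight columns and weight
  rows, they expand unit vectors and unit covectors alike.\<close>

definition weight_decomposition ::
  "('a mat \<Rightarrow> 'a) set \<Rightarrow> (('a mat \<Rightarrow> 'a) \<Rightarrow> nat \<Rightarrow> nat \<Rightarrow> 'a) \<Rightarrow> bool" where
  "weight_decomposition X A \<longleftrightarrow> X \<subseteq> characters n T \<and>
     (\<forall>a<r. \<forall>b<r. (\<Sum>\<chi>\<in>X. A \<chi> a b) = (if a = b then 1 else 0)) \<and>
     (\<forall>\<chi>\<in>X. \<forall>a<r. wvector \<chi> (\<lambda>c. A \<chi> c a) \<and> covector \<chi> (A \<chi> a))"

lemma weight_decomposition_exists: "\<exists>X A. weight_decomposition X A"
proof -
  have \<nu>T: "matrix_coeffs n T r \<nu>"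
    using \<nu> TG regular_subset[OF _ TG] unfolding matrix_coeffs_def by blast
  show ?thesis
  proof (rule torus_weights[OF torus \<nu>T])
    fix X A
    assume "X \<subseteq> characters n T"
      and "\<And>a b. a < r \<Longrightarrow> b < r \<Longrightarrow> (\<Sum>\<chi>\<in>X. A \<chi> a b) = (if a = b then 1 else 0)"
      and "\<And>\<chi> t a c. \<chi> \<in> X \<Longrightarrow> t \<in> T \<Longrightarrow> a < r \<Longrightarrow> c < r \<Longrightarrow> (\<Sum>b<r. \<nu> a b t * A \<chi> b c) = \<chi> t * A \<chi> a c"
      and "\<And>\<chi> t a c. \<chi> \<in> X \<Longrightarrow> t \<in> T \<Longrightarrow> a < r \<Longrightarrow> c < r \<Longrightarrow> (\<Sum>b<r. A \<chi> a b * \<nu> b c t) = \<chi> t * A \<chi> a c"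
    then have "weight_decomposition X A"
      unfolding weight_decomposition_def covector_def wvector_def by blast
    then show ?thesis by blast
  qed
qed

lemma weight_decompositionD:
  assumes "weight_decomposition X A"
  shows "X \<subseteq> characters n T" "a < r \<Longrightarrow> b < r \<Longrightarrow> (\<Sum>\<chi>\<in>X. A \<chi> a b) = (if a = b then 1 else 0)"
    "\<chi> \<in> X \<Longrightarrow> a < r \<Longrightarrow> wvector \<chi> (\<lambda>c. A \<chi> c a)" "\<chi> \<in> X \<Longrightarrow> a < r \<Longrightarrow> covector \<chi> (A \<chi> a)"
  using assms unfolding weight_decomposition_def by blast+

text \<open>The coordinate form \<open>unit a\<close> is a sum of weight covectors, each sending the
  simple subspace into \<open>S\<close>. Hence every simple subspace lies in
  \<open>S \<otimes> N\<close>.\<close>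

lemma simple_column_in_socle:
  assumes X: "simple_subspace ideal J m X" "u \<in> X" and a: "a < r"
  shows "(\<lambda>i. u (i, a)) \<in> S"
proof -
  obtain Y A where YA: "weight_decomposition Y A" using weight_decomposition_exists by blast
  note Y = weight_decompositionD(1)[OF YA] and one = weight_decompositionD(2)[OF YA]
    and cov = weight_decompositionD(4)[OF YA]
  have "(\<lambda>i. u (i, a)) = proj (\<lambda>b. \<Sum>\<chi>\<in>Y. A \<chi> a b) u"
    unfolding proj_unit[OF a, symmetric] using one[OF a] by (auto simp: proj_def intro!: sum.cong)
  also have "\<dots> \<in> S"
    unfolding proj_sum using Y cov[OF _ a]
    by (intro subspace_fs_sum[OF S_facts(1)] proj_simple[OF X(1) _ _ X(2)]) auto
  finally show ?thesis .
qed

text \<open>Expanding \<open>unit a\<close> into weight rows and \<open>unit b\<close> into weight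
  columns gives a sum of blocks covered by \<open>eps_scalar\<close>, and scalars add.\<close>

lemma eps_unit_scalar:
  assumes ab: "a < r" "b < r"
  shows "\<exists>c. \<forall>s\<in>S. eps (unit a) (unit b) s = (\<lambda>i. c * s i)"
proof -
  obtain X A where XA: "weight_decomposition X A" using weight_decomposition_exists by blast
  note X = weight_decompositionD(1)[OF XA] and one = weight_decompositionD(2)[OF XA]
    and wvec = weight_decompositionD(3)[OF XA] and cov = weight_decompositionD(4)[OF XA]
  have "\<exists>c. \<forall>s\<in>S. eps (A \<chi> a) (\<lambda>c. A \<psi> c b) s = (\<lambda>i. c * s i)" if "\<chi> \<in> X" "\<psi> \<in> X" for \<chi> \<psi>
    using X that ab by (intro eps_scalar[of \<chi> _ \<psi>] cov wvec) auto
  then obtain c where c: "\<And>\<chi> \<psi> s. \<chi> \<in> X \<Longrightarrow> \<psi> \<in> X \<Longrightarrow> s \<in> S \<Longrightarrow> eps (A \<chi> a) (\<lambda>c. A \<psi> c b) s = (\<lambda>i. c \<chi> \<psi> * s i)"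
    by metis
  have "eps (unit a) (unit b) s = (\<lambda>i. (\<Sum>\<psi>\<in>X. \<Sum>\<chi>\<in>X. c \<chi> \<psi>) * s i)" if s: "s \<in> S" for s
  proof -
    have "incl (unit b) s = incl (\<lambda>c. \<Sum>\<psi>\<in>X. A \<psi> c b) s"
      by (rule incl_cong) (simp add: one ab)
    then have 1: "E (incl (unit b) s) = (\<lambda>p. \<Sum>\<psi>\<in>X. E (incl (\<lambda>c. A \<psi> c b) s) p)"
      by (simp only: incl_sum linear_op_sum[OF linear_op_mv])
    have 2: "proj (unit a) u = proj (\<lambda>c. \<Sum>\<chi>\<in>X. A \<chi> a c) u" for u
      using one[OF ab(1)] by (auto simp: proj_def intro!: sum.cong)
    have "eps (unit a) (unit b) s = (\<lambda>i. \<Sum>\<psi>\<in>X. \<Sum>\<chi>\<in>X. eps (A \<chi> a) (\<lambda>c. A \<psi> c b) s i)"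
      unfolding proj_E_incl[symmetric] 1 linear_op_sum[OF linear_proj] 2 proj_sum ..
    also have "\<dots> = (\<lambda>i. \<Sum>\<psi>\<in>X. \<Sum>\<chi>\<in>X. c \<chi> \<psi> * s i)"
      by (intro ext sum.cong refl) (simp add: c[OF _ _ s])
    finally show ?thesis by (simp add: sum_distrib_right)
  qed
  then show ?thesis by blast
qed

text \<open>The blocks are the components of \<open>E\<close> on \<open>x \<otimes> N\<close>.
  Stating this for a single vector makes it apply to \<open>s\<close> in \<open>S\<close> and to its
  translates under \<open>G\<close> alike.\<close>

lemma E_incl_of_eps:
  assumes x: "x \<in> supported D"
    and C: "\<And>a b. a < r \<Longrightarrow> b < r \<Longrightarrow> eps (unit a) (unit b) x = (\<lambda>i. C a b * x i)"
  shows "E (incl \<beta> x) = incl (\<lambda>a. \<Sum>b<r. C a b * \<beta> b) x"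
proof
  fix p :: "nat \<times> nat"
  obtain i a where p: "p = (i, a)" by (cases p)
  have "E (incl \<beta> x) p = (\<Sum>b<r. \<beta> b * E (incl (unit b) x) p)"
    by (subst incl_unit_expansion) (simp only: linear_op_sum[OF linear_op_mv] linear_op_simps(2)[OF linear_op_mv])
  also have "\<dots> = incl (\<lambda>a. \<Sum>b<r. C a b * \<beta> b) x p"
  proof (cases "i < d \<and> a < r")
    case True
    have "E (incl (unit b) x) p = C a b * x i" if "b < r" for b
      using fun_cong[OF proj_E_incl[of "unit a" "unit b" x], of i] True
      unfolding C[OF conjunct2[OF True] that] by (simp add: proj_unit p)
    then have "(\<Sum>b<r. \<beta> b * E (incl (unit b) x) p) = (\<Sum>b<r. x i * (C a b * \<beta> b))"
      by (intro sum.cong refl) simp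
    then show ?thesis using True by (simp add: p incl_def sum_distrib_left)
  next
    case False
    then have "incl (\<lambda>a. \<Sum>b<r. C a b * \<beta> b) x p = 0" using x by (auto simp: p incl_def supported_def)
    moreover have "E u p = 0" for u using False by (auto simp: p mv_def)
    ultimately show ?thesis by simp
  qed
  finally show "E (incl \<beta> x) p = incl (\<lambda>a. \<Sum>b<r. C a b * \<beta> b) x p" .
qed

abbreviation "actV g \<equiv> mv D (\<lambda>i j. v i j g)"
abbreviation "actR g \<equiv> mv J (\<lambda>p q. m p q g)"

lemma E_actR: "g \<in> G \<Longrightarrow> E (actR g u) = actR g (E u)"
  unfolding mv_mv by (rule mv_cong) (use comm in \<open>auto simp: m_def\<close>)

lemma actR_incl: "actR g (incl \<beta> x) = incl (\<lambda>a. \<Sum>b<r. \<nu> a b (F g) * \<beta> b) (actV g x)"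
proof
  fix p :: "nat \<times> nat"
  obtain i a where p: "p = (i, a)" by (cases p)
  have "(\<Sum>j<d. \<Sum>b<r. v i j g * \<nu> a b (F g) * (x j * \<beta> b)) =
      (\<Sum>j<d. v i j g * x j) * (\<Sum>b<r. \<nu> a b (F g) * \<beta> b)"
    unfolding sum_product by (simp only: mult_ac)
  then show "actR g (incl \<beta> x) p = incl (\<lambda>a. \<Sum>b<r. \<nu> a b (F g) * \<beta> b) (actV g x) p"
    by (auto simp: p mv_def incl_def m_def sum_J)
qed

lemma socle_scalars:
  obtains C where "\<And>s \<beta>. s \<in> S \<Longrightarrow> E (incl \<beta> s) = incl (\<lambda>a. \<Sum>b<r. C a b * \<beta> b) s"
    "\<And>a c. a < r \<Longrightarrow> c < r \<Longrightarrow> (\<Sum>b<r. C a b * C b c) = C a c"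
    "\<And>g a b. g \<in> G \<Longrightarrow> a < r \<Longrightarrow> b < r \<Longrightarrow> (\<Sum>c<r. C a c * \<nu> c b g) = (\<Sum>c<r. \<nu> a c g * C c b)"
proof -
  obtain C where C: "\<And>a b s. a < r \<Longrightarrow> b < r \<Longrightarrow> s \<in> S \<Longrightarrow> eps (unit a) (unit b) s = (\<lambda>i. C a b * s i)"
    using eps_unit_scalar by metis
  have ES: "E (incl \<beta> s) = incl (\<lambda>a. \<Sum>b<r. C a b * \<beta> b) s" if "s \<in> S" for s \<beta>
    by (rule E_incl_of_eps) (use C that S_facts(2) in auto)
  \<comment> \<open>One nonzero vector suffices: by \<open>incl_eqD\<close> a column of a matrix on
    N can be read off after tensoring with \<open>s\<close>.\<close>
  obtain s where s: "s \<in> S" "s \<noteq> (\<lambda>_. 0)" using S_facts(5) subspace_fsD(1)[OF S_facts(1)] by blast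
  have sD: "s \<in> supported D" using s(1) S_facts(2) by blast
  have unit_sum: "(\<Sum>b<r. f b * unit c b) = f c" if "c < r" for f c
    using that by (simp add: if_distrib[of "\<lambda>c. _ * c"] cong: if_cong)
  have idemC: "(\<Sum>b<r. C a b * C b c) = C a c" if ac: "a < r" "c < r" for a c
  proof -
    have 1: "E (incl (unit c) s) = incl (\<lambda>a. C a c) s"
      unfolding ES[OF s(1)] using unit_sum[OF ac(2)] by simp
    have "E (E (incl (unit c) s)) = E (incl (unit c) s)"
      unfolding mv_mv by (rule mv_cong) (rule idem)
    then have "incl (\<lambda>a. \<Sum>b<r. C a b * C b c) s = incl (\<lambda>a. C a c) s"
      unfolding 1 ES[OF s(1)] .
    from incl_eqD[OF this s(2) ac(1)] show ?thesis .
  qed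
  have F: "F g \<in> G" if "g \<in> G" for g using alg_homD(1)[OF alg_hom_F that] .
  have inv_G: "mat_inv n g \<in> G" if "g \<in> G" for g by (rule subgroup_GLD(5)[OF G that])
  have conj_const: "(\<Sum>c<r. \<nu> a c (F g) * (\<Sum>c'<r. C c c' * \<nu> c' b (F (mat_inv n g)))) = C a b"
    and eps_orbit: "eps (unit a) (unit b) (actV g s) = (\<lambda>i. C a b * actV g s i)"
    if ab: "a < r" "b < r" and g: "g \<in> G" for a b g
  proof -
    \<comment> \<open>The entry at \<open>(a, b)\<close> of \<open>C\<close> conjugated by
      \<open>\<nu> (F g)\<close>: a regular function of \<open>g\<close> whose values will be
      eigenvalues of one block of \<open>E\<close>.\<close>
    define K where "K g = (\<Sum>c<r. \<nu> a c (F g) * (\<Sum>c'<r. C c c' * \<nu> c' b (F (mat_inv n g))))" for g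
    have regK: "regular n G K"
      unfolding K_def using ab
      by (intro regular_sum regular_mult regular_const regular_F regular_comp_mat_inv[OF G, of "\<lambda>g. \<nu> _ b (F g)"]
          matrix_coeffsD(1)[OF \<nu>]) auto
    have eigen: "eps (unit a) (unit b) (actV g s) = (\<lambda>i. K g * actV g s i)" if g: "g \<in> G" for g
    proof -
      let ?\<beta> = "\<lambda>c. \<nu> c b (F (mat_inv n g))"
      have "(\<Sum>c<r. \<nu> a' c (F g) * ?\<beta> c) = unit b a'" if "a' < r" for a'
        using matrix_coeffs_inverse(1)[OF G \<nu> F[OF g] that ab(2)] alg_hom_mat_inv[OF G G alg_hom_F g] by simp
      \<comment> \<open>A unit vector tensored with the translate of \<open>s\<close> is pulled back
        by \<open>g\<close> to a vector of \<open>s \<otimes> N\<close>, where \<open>E\<close> is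
        known.\<close>
      then have "incl (unit b) (actV g s) = actR g (incl ?\<beta> s)"
        unfolding actR_incl by (intro incl_cong) simp
      then have "E (incl (unit b) (actV g s)) = actR g (E (incl ?\<beta> s))"
        using E_actR[OF g] by simp
      also have "\<dots> = incl (\<lambda>a. \<Sum>c<r. \<nu> a c (F g) * (\<Sum>c'<r. C c c' * ?\<beta> c')) (actV g s)"
        unfolding ES[OF s(1)] actR_incl ..
      finally show ?thesis
        unfolding proj_E_incl[symmetric] proj_unit[OF ab(1)] K_def using ab(1) by (simp add: incl_def mult.commute)
    qed
    let ?ev = "{c. \<exists>x \<in> supported D. x \<noteq> (\<lambda>_. 0) \<and> eps (unit a) (unit b) x = (\<lambda>i. c * x i)}"
    have "K ` G \<subseteq> ?ev"
    proof (rule image_subsetI)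
      fix g assume g: "g \<in> G"
      show "K g \<in> ?ev"
        using eigen[OF g] G_act_nonzero[OF g sD s(2)] mv_supported[of D "\<lambda>i j. v i j g" s] by blast
    qed
    moreover have "finite ?ev" unfolding eps_def by (rule finite_mv_eigenvalues)
    ultimately have "finite (K ` G)" by (rule finite_subset)
    then have "K g = K (1\<^sub>m n)" using closed connected regK g subgroup_GLD(3)[OF G]
      by (intro finite_valued_regular_constant[of n G]) auto
    also have "K (1\<^sub>m n) = C a b"
    proof -
      have "actV (1\<^sub>m n) s = mv D (\<lambda>p q. if p = q then 1 else 0) s"
        by (rule mv_cong) (use matrix_coeffsD(2)[OF v] in auto)
      then have "actV (1\<^sub>m n) s = s" using mv_one[OF _ sD] by simp
      then have "(\<lambda>i. C a b * s i) = (\<lambda>i. K (1\<^sub>m n) * s i)"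
        using eigen[OF subgroup_GLD(3)[OF G]] C[OF ab s(1)] by simp
      moreover obtain i where "s i \<noteq> 0" using s(2) by auto
      ultimately show ?thesis by (auto dest: fun_cong[of _ _ i])
    qed
    finally have Kg: "K g = C a b" .
    then show "(\<Sum>c<r. \<nu> a c (F g) * (\<Sum>c'<r. C c c' * \<nu> c' b (F (mat_inv n g)))) = C a b"
      by (simp add: K_def)
    show "eps (unit a) (unit b) (actV g s) = (\<lambda>i. C a b * actV g s i)"
      using eigen[OF g] Kg by simp
  qed
  have comm_F: "(\<Sum>c<r. C a c * \<nu> c b (F g)) = (\<Sum>c<r. \<nu> a c (F g) * C c b)"
    if g: "g \<in> G" and ab: "a < r" "b < r" for g a b
  proof -
    \<comment> \<open>\<open>E\<close> on the \<open>g\<close>-translate of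
      \<open>s \<otimes> unit b\<close>, computed in two ways: by its scalars on the translate of
      \<open>s\<close>, which are still \<open>C\<close>, and by commuting with
      \<open>g\<close>.\<close>
    have "incl (\<lambda>a. \<Sum>c<r. C a c * \<nu> c b (F g)) (actV g s) = E (incl (\<lambda>c. \<nu> c b (F g)) (actV g s))"
      by (rule E_incl_of_eps[symmetric]) (use eps_orbit[OF _ _ g] mv_supported in auto)
    also have "\<dots> = E (actR g (incl (unit b) s))"
      unfolding actR_incl using unit_sum[OF ab(2)] by simp
    also have "\<dots> = actR g (incl (\<lambda>a. C a b) s)"
      unfolding E_actR[OF g] ES[OF s(1)] using unit_sum[OF ab(2)] by simp
    also have "\<dots> = incl (\<lambda>a. \<Sum>c<r. \<nu> a c (F g) * C c b) (actV g s)"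
      by (rule actR_incl)
    finally have eq: "incl (\<lambda>a. \<Sum>c<r. C a c * \<nu> c b (F g)) (actV g s) =
        incl (\<lambda>a. \<Sum>c<r. \<nu> a c (F g) * C c b) (actV g s)" .
    show ?thesis by (rule incl_eqD[OF eq G_act_nonzero[OF g sD s(2)] ab(1)])
  qed
  have comm_G: "(\<Sum>c<r. C a c * \<nu> c b g) = (\<Sum>c<r. \<nu> a c g * C c b)"
    if g: "g \<in> G" and ab: "a < r" "b < r" for g a b
  proof -
    \<comment> \<open>A regular function vanishing on the image of \<open>F\<close>. Density removes
      the twist, so that \<open>C\<close> commutes with the untwisted coefficients
      \<open>\<nu>\<close>.\<close>
    let ?f = "\<lambda>g. (\<Sum>c<r. C a c * \<nu> c b g) - (\<Sum>c<r. \<nu> a c g * C c b)"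
    have "?f g = 0"
    proof (rule frobenius_image_dense[OF char_pos G frob _ _ g])
      show "regular n G ?f"
        using ab by (intro regular_diff regular_sum regular_mult regular_const matrix_coeffsD(1)[OF \<nu>]) auto
      show "?f (F g) = 0" if "g \<in> G" for g using comm_F[OF that ab] by simp
    qed
    then show ?thesis by simp
  qed
  show ?thesis by (rule that[of C]) (use ES idemC comm_G in auto)
qed

lemma E_zero:
  assumes zero: "\<And>s \<beta>. s \<in> S \<Longrightarrow> E (incl \<beta> s) = (\<lambda>_. 0)" and pq: "p \<in> J" "q \<in> J"
  shows "e p q = 0"
proof -
  let ?U = "E ` supported J"
  have U: "fs.subspace ?U" by (rule subspace_linear_image[OF subspace_supported linear_op_mv])
  have "stable_subspace ideal J m ?U"
    unfolding stable_subspace_def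
  proof (intro conjI allI impI ballI U)
    show "?U \<subseteq> supported J" using mv_supported by blast
    fix \<delta> u assume \<delta>: "distribution ideal \<delta>" and u: "u \<in> ?U"
    then obtain w where "u = E w" by blast
    then have "opR \<delta> u = E (opR \<delta> w)" using E_opR[OF \<delta>] by simp
    then show "opR \<delta> u \<in> ?U" using mv_supported[of J "\<lambda>p q. \<delta> (m p q)" w] by blast
  qed
  have "?U = {\<lambda>_. 0}"
  proof (rule ccontr)
    assume "?U \<noteq> {\<lambda>_. 0}"
    then obtain X where X: "simple_subspace ideal J m X" "X \<subseteq> ?U"
      using simple_subspace_exists[OF _ \<open>stable_subspace ideal J m ?U\<close>] by (metis finite_SigmaI finite_lessThan)
    have "u = (\<lambda>_. 0)" if u: "u \<in> X" for u
    proof -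
      obtain w where w: "u = E w" using X(2) u by blast
      have "E (E w) = E w" unfolding mv_mv by (rule mv_cong) (rule idem)
      then have Eu: "E u = u" by (simp add: w)
      have col: "(\<lambda>i. u (i, a)) \<in> S" if a: "a < r" for a
        using simple_column_in_socle[OF X(1) u a] .
      \<comment> \<open>\<open>u\<close> is the sum of its columns tensored with unit vectors, and
        \<open>zero\<close> applies to each summand.\<close>
      have "u q = (\<Sum>a<r. incl (unit a) (\<lambda>i. u (i, a)) q)" if "q \<in> J" for q
        using that by (auto simp: incl_def if_distrib[of "\<lambda>c. _ * c"] cong: if_cong)
      then have "E u = E (\<lambda>q. \<Sum>a<r. incl (unit a) (\<lambda>i. u (i, a)) q)"
        by (rule E_cong)
      also have "\<dots> = (\<lambda>_. 0)"
        unfolding linear_op_sum[OF linear_op_mv] using zero[OF col] by simp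
      finally show ?thesis using Eu by simp
    qed
    moreover have "(\<lambda>_. 0) \<in> X" using X(1) by (simp add: simple_subspace_def stable_subspace_def subspace_fs_iff)
    ultimately have "X = {\<lambda>_. 0}" by blast
    then show False using X(1) by (simp add: simple_subspace_def)
  qed
  moreover have "(\<lambda>s. if s = q then 1 else 0) \<in> supported J" using pq(2) by (auto simp: supported_def)
  ultimately have "E (\<lambda>s. if s = q then 1 else 0) = (\<lambda>_. 0)" by blast
  from fun_cong[OF this, of p] show ?thesis
    using pq by (simp add: mv_def if_distrib[of "\<lambda>c. _ * c"] cong: if_cong)
qed

end

section \<open>Indecomposability\<close>

lemma sum_pair_index:
  fixes f :: "nat \<Rightarrow> 'a::comm_monoid_add"
  shows "(\<Sum>k<d * r. f k) = (\<Sum>q\<in>{..<d} \<times> {..<r}. f (fst q * r + snd q))"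
proof (cases "r = 0")
  case False
  have "fst q * r + snd q < d * r" if "q \<in> {..<d} \<times> {..<r}" for q
  proof -
    have "Suc (fst q) * r \<le> d * r" using that by (intro mult_le_mono1) auto
    then show ?thesis using that by auto
  qed
  then show ?thesis
    using False
    by (intro sum.reindex_bij_witness[of _ "\<lambda>q. fst q * r + snd q" "\<lambda>k. (k div r, k mod r)"])
      (auto simp: less_mult_imp_div_less)
qed simp

lemma pair_index_less: "i < d \<Longrightarrow> a < r \<Longrightarrow> i * r + a < d * (r::nat)"
proof -
  assume "i < d" "a < r"
  then have "i * r + a < Suc i * r" "Suc i * r \<le> d * r" by (simp, intro mult_le_mono1) simp
  then show ?thesis by simp
qed

lemma trivial_idempotents_cong:
  assumes "\<And>i j g. i < d \<Longrightarrow> j < d \<Longrightarrow> g \<in> G \<Longrightarrow> v i j g = w i j g" and "trivial_idempotents G d v"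
  shows "trivial_idempotents G d w"
  unfolding trivial_idempotents_def
proof (intro allI impI, elim conjE)
  fix e
  assume idem: "\<forall>i<d. \<forall>k<d. (\<Sum>j<d. e i j * e j k) = e i k"
    and "\<forall>g\<in>G. \<forall>i<d. \<forall>k<d. (\<Sum>j<d. e i j * w j k g) = (\<Sum>j<d. w i j g * e j k)"
  then have "\<forall>g\<in>G. \<forall>i<d. \<forall>k<d. (\<Sum>j<d. e i j * v j k g) = (\<Sum>j<d. v i j g * e j k)"
    using assms(1) by simp
  with idem show "(\<forall>i<d. \<forall>k<d. e i k = 0) \<or> (\<forall>i<d. \<forall>k<d. e i k = (if i = k then 1 else 0))"
    using assms(2) unfolding trivial_idempotents_def by blast
qed

lemma matrix_coeffs_cong:
  assumes G: "subgroup G (GL n)" and "\<And>i j g. i < d \<Longrightarrow> j < d \<Longrightarrow> g \<in> G \<Longrightarrow> w i j g = v i j g"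
    and v: "matrix_coeffs n G d v"
  shows "matrix_coeffs n G d w"
  unfolding matrix_coeffs_def
proof (intro conjI allI impI ballI)
  fix i k assume ik: "i < d" "k < d"
  show "regular n G (w i k)"
    by (rule regular_cong[OF matrix_coeffsD(1)[OF v ik]]) (rule assms(2)[OF ik])
  show "w i k (1\<^sub>m n) = (if i = k then 1 else 0)"
    using matrix_coeffsD(2)[OF v ik] assms(2)[OF ik subgroup_GLD(3)[OF G]] by simp
  show "w i k (g * h) = (\<Sum>j<d. w i j g * w j k h)" if "g \<in> G" "h \<in> G" for g h
    using matrix_coeffsD(3)[OF v that ik] assms(2) ik that subgroup_GLD(4)[OF G that] by simp
qed

abbreviation tensor_coeffs ::
  "nat \<Rightarrow> (nat \<Rightarrow> nat \<Rightarrow> 'k mat \<Rightarrow> 'k) \<Rightarrow> (nat \<Rightarrow> nat \<Rightarrow> 'k mat \<Rightarrow> 'k) \<Rightarrow> nat \<Rightarrow> nat \<Rightarrow> 'k mat \<Rightarrow> 'k::field"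
  where "tensor_coeffs r v w \<equiv> (\<lambda>i k g. v (i div r) (k div r) g * w (i mod r) (k mod r) g)"

lemma matrix_coeffs_tensor:
  assumes v: "matrix_coeffs n G d v" and w: "matrix_coeffs n G r w"
  shows "matrix_coeffs n G (d * r) (tensor_coeffs r v w)"
  unfolding matrix_coeffs_def
proof (intro conjI allI impI ballI)
  fix i k assume ik: "i < d * r" "k < d * r"
  then have r: "r > 0" by (cases r) auto
  have *: "i div r < d" "k div r < d" "i mod r < r" "k mod r < r"
    using ik r by (auto simp: less_mult_imp_div_less)
  show "regular n G (\<lambda>g. v (i div r) (k div r) g * w (i mod r) (k mod r) g)"
    by (intro regular_mult matrix_coeffsD(1)[OF v] matrix_coeffsD(1)[OF w] *)
  have "i = k \<longleftrightarrow> i div r = k div r \<and> i mod r = k mod r" by (metis div_mult_mod_eq)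
  then show "v (i div r) (k div r) (1\<^sub>m n) * w (i mod r) (k mod r) (1\<^sub>m n) = (if i = k then 1 else 0)"
    using matrix_coeffsD(2)[OF v *(1,2)] matrix_coeffsD(2)[OF w *(3,4)] by simp
  fix g h assume gh: "g \<in> G" "h \<in> G"
  show "v (i div r) (k div r) (g * h) * w (i mod r) (k mod r) (g * h) =
      (\<Sum>j<d * r. v (i div r) (j div r) g * w (i mod r) (j mod r) g * (v (j div r) (k div r) h * w (j mod r) (k mod r) h))"
    unfolding sum_pair_index matrix_coeffsD(3)[OF v gh *(1,2)] matrix_coeffsD(3)[OF w gh *(3,4)] sum_product sum.cartesian_product
    by (intro sum.cong refl) (auto simp: mult_ac)
qed

text \<open>Kronecker indices are translated into pairs. The locale is entered with \<open>e\<close>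
  to obtain \<open>C\<close>, and once more with \<open>1 - e\<close> when \<open>C\<close> is the
  identity, because \<open>E_zero\<close> concludes only that an idempotent vanishes.\<close>

lemma (in frobenius_setting) trivial_idempotents_tensor:
  assumes v: "matrix_coeffs n G d v" and \<nu>: "matrix_coeffs n G r \<nu>"
    and S: "simple_subspace ideal {..<d} v S" and socle: "\<And>X. simple_subspace ideal {..<d} v X \<Longrightarrow> X \<subseteq> S"
    and triv: "trivial_idempotents G r \<nu>"
  shows "trivial_idempotents G (d * r) (tensor_coeffs r v (\<lambda>a b g. \<nu> a b (F g)))"
  unfolding trivial_idempotents_def
proof (intro allI impI, elim conjE)
  fix e0 :: "nat \<Rightarrow> nat \<Rightarrow> 'k"
  let ?J = "{..<d} \<times> {..<r}"
  let ?ix = "\<lambda>q. fst q * r + snd q"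
  assume idem: "\<forall>i<d * r. \<forall>k<d * r. (\<Sum>j<d * r. e0 i j * e0 j k) = e0 i k"
    and comm: "\<forall>g\<in>G. \<forall>i<d * r. \<forall>k<d * r.
      (\<Sum>j<d * r. e0 i j * (v (j div r) (k div r) g * \<nu> (j mod r) (k mod r) (F g))) =
      (\<Sum>j<d * r. v (i div r) (j div r) g * \<nu> (i mod r) (j mod r) (F g) * e0 j k)"
  define e where "e p q = e0 (?ix p) (?ix q)" for p q
  have ix: "?ix q < d * r" "?ix q div r = fst q" "?ix q mod r = snd q" if "q \<in> ?J" for q
    using that pair_index_less[of "fst q" d "snd q" r] by auto
  have idem': "(\<Sum>q\<in>?J. e p q * e q s) = e p s" if "p \<in> ?J" "s \<in> ?J" for p s
    using idem ix(1)[OF that(1)] ix(1)[OF that(2)] unfolding e_def sum_pair_index by blast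
  have comm': "(\<Sum>q\<in>?J. e p q * (v (fst q) (fst s) g * \<nu> (snd q) (snd s) (F g))) =
      (\<Sum>q\<in>?J. v (fst p) (fst q) g * \<nu> (snd p) (snd q) (F g) * e q s)"
    if "g \<in> G" "p \<in> ?J" "s \<in> ?J" for g p s
  proof -
    have "(\<Sum>j<d * r. e0 (?ix p) j * (v (j div r) (?ix s div r) g * \<nu> (j mod r) (?ix s mod r) (F g))) =
        (\<Sum>j<d * r. v (?ix p div r) (j div r) g * \<nu> (?ix p mod r) (j mod r) (F g) * e0 j (?ix s))"
      using comm that(1) ix(1)[OF that(2)] ix(1)[OF that(3)] by blast
    then have "(\<Sum>q\<in>?J. e0 (?ix p) (?ix q) * (v (?ix q div r) (fst s) g * \<nu> (?ix q mod r) (snd s) (F g))) =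
        (\<Sum>q\<in>?J. v (fst p) (?ix q div r) g * \<nu> (snd p) (?ix q mod r) (F g) * e0 (?ix q) (?ix s))"
      unfolding sum_pair_index ix(2,3)[OF that(2)] ix(2,3)[OF that(3)] .
    moreover have "(\<Sum>q\<in>?J. e p q * (v (fst q) (fst s) g * \<nu> (snd q) (snd s) (F g))) =
        (\<Sum>q\<in>?J. e0 (?ix p) (?ix q) * (v (?ix q div r) (fst s) g * \<nu> (?ix q mod r) (snd s) (F g)))"
      by (intro sum.cong refl) (simp only: ix(2,3) e_def)
    moreover have "(\<Sum>q\<in>?J. v (fst p) (fst q) g * \<nu> (snd p) (snd q) (F g) * e q s) =
        (\<Sum>q\<in>?J. v (fst p) (?ix q div r) g * \<nu> (snd p) (?ix q mod r) (F g) * e0 (?ix q) (?ix s))"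
      by (intro sum.cong refl) (simp only: ix(2,3) e_def)
    ultimately show ?thesis by (simp only:)
  qed
  interpret A: twisted_tensor n G T F d r v \<nu> S e
    by unfold_locales (rule v, rule \<nu>, rule S, erule socle, erule (1) idem', erule (2) comm')
  have e0_e: "e0 i k = e (i div r, i mod r) (k div r, k mod r)" for i k
    by (simp add: e_def)
  have pair: "(i div r, i mod r) \<in> ?J" if "i < d * r" for i
  proof -
    have "r > 0" using that by (cases r) auto
    then show ?thesis using that by (auto simp: less_mult_imp_div_less)
  qed
  show "(\<forall>i<d * r. \<forall>k<d * r. e0 i k = 0) \<or> (\<forall>i<d * r. \<forall>k<d * r. e0 i k = (if i = k then 1 else 0))"
  proof (rule A.socle_scalars)
    fix C
    assume ES: "\<And>s \<beta>. s \<in> S \<Longrightarrow> A.E (A.incl \<beta> s) = A.incl (\<lambda>a. \<Sum>b<r. C a b * \<beta> b) s"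
      and "\<And>a c. a < r \<Longrightarrow> c < r \<Longrightarrow> (\<Sum>b<r. C a b * C b c) = C a c"
      and "\<And>g a b. g \<in> G \<Longrightarrow> a < r \<Longrightarrow> b < r \<Longrightarrow> (\<Sum>c<r. C a c * \<nu> c b g) = (\<Sum>c<r. \<nu> a c g * C c b)"
    then have "(\<forall>i<r. \<forall>k<r. C i k = 0) \<or> (\<forall>i<r. \<forall>k<r. C i k = (if i = k then 1 else 0))"
      using triv unfolding trivial_idempotents_def by blast
    then show ?thesis
    proof
      assume C: "\<forall>i<r. \<forall>k<r. C i k = 0"
      have "A.E (A.incl \<beta> s) = (\<lambda>_. 0)" if "s \<in> S" for s \<beta>
      proof -
        have "A.E (A.incl \<beta> s) = A.incl (\<lambda>a. 0) s"
          unfolding ES[OF that] using C by (intro A.incl_cong) simp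
        also have "\<dots> = (\<lambda>_. 0)" by (simp add: A.incl_def fun_eq_iff)
        finally show ?thesis .
      qed
      then have "e0 i k = 0" if "i < d * r" "k < d * r" for i k
        unfolding e0_e using A.E_zero pair[OF that(1)] pair[OF that(2)] by blast
      then show ?thesis by blast
    next
      assume C: "\<forall>i<r. \<forall>k<r. C i k = (if i = k then 1 else 0)"
      have "A.incl (\<lambda>a. \<Sum>b<r. C a b * \<beta> b) s = A.incl \<beta> s" for \<beta> s
        using C by (intro A.incl_cong) (simp add: if_distrib[of "\<lambda>c. c * _"] cong: if_cong)
      then have ES': "A.E (A.incl \<beta> s) = A.incl \<beta> s" if "s \<in> S" for s \<beta>
        using ES[OF that] by simp
      define e' where "e' p q = (if p = q then 1 else 0) - e p q" for p q
      have delta: "(\<Sum>q\<in>?J. (if p = q then 1 else 0) * f q) = f p"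
        "(\<Sum>q\<in>?J. f q * (if q = p then 1 else 0)) = f p" if p: "p \<in> ?J" for f :: "nat \<times> nat \<Rightarrow> 'k" and p
      proof -
        have "(\<Sum>q\<in>?J. (if p = q then 1 else 0) * f q) = (\<Sum>q\<in>?J. if p = q then f q else 0)"
          "(\<Sum>q\<in>?J. f q * (if q = p then 1 else 0)) = (\<Sum>q\<in>?J. if p = q then f q else 0)"
          by (intro sum.cong refl; auto)+
        moreover have "(\<Sum>q\<in>?J. if p = q then f q else 0) = f p"
          using p by (subst sum.delta') auto
        ultimately show "(\<Sum>q\<in>?J. (if p = q then 1 else 0) * f q) = f p"
          "(\<Sum>q\<in>?J. f q * (if q = p then 1 else 0)) = f p"
          by simp_all
      qed
      have idem'': "(\<Sum>q\<in>?J. e' p q * e' q s) = e' p s" if "p \<in> ?J" "s \<in> ?J" for p s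
        unfolding e'_def left_diff_distrib right_diff_distrib sum_subtractf
        by (simp add: delta that idem' del: mem_Sigma_iff)
      have comm'': "(\<Sum>q\<in>?J. e' p q * (v (fst q) (fst s) g * \<nu> (snd q) (snd s) (F g))) =
          (\<Sum>q\<in>?J. v (fst p) (fst q) g * \<nu> (snd p) (snd q) (F g) * e' q s)"
        if "g \<in> G" "p \<in> ?J" "s \<in> ?J" for g p s
        unfolding e'_def left_diff_distrib right_diff_distrib sum_subtractf
        using delta(1)[OF that(2), of "\<lambda>q. v (fst q) (fst s) g * \<nu> (snd q) (snd s) (F g)"]
          delta(2)[OF that(3), of "\<lambda>q. v (fst p) (fst q) g * \<nu> (snd p) (snd q) (F g)"] comm'[OF that]
        by simp
      interpret B: twisted_tensor n G T F d r v \<nu> S e'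
        by unfold_locales (rule v, rule \<nu>, rule S, erule socle, erule (1) idem'', erule (2) comm'')
      have "B.E (B.incl \<beta> s) = (\<lambda>_. 0)" if s: "s \<in> S" for s \<beta>
      proof
        fix p
        show "B.E (B.incl \<beta> s) p = 0"
        proof (cases "p \<in> ?J")
          case True
          then have "B.E (B.incl \<beta> s) p = A.incl \<beta> s p - A.E (A.incl \<beta> s) p"
            using delta(1)[OF True, of "A.incl \<beta> s"]
            by (simp add: mv_def e'_def left_diff_distrib sum_subtractf A.incl_def B.incl_def del: mem_Sigma_iff)
          then show ?thesis using ES'[OF s] by simp
        qed (simp add: mv_def del: mem_Sigma_iff)
      qed
      then have "e' (i div r, i mod r) (k div r, k mod r) = 0" if "i < d * r" "k < d * r" for i k
        using B.E_zero pair[OF that(1)] pair[OF that(2)] by blast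
      moreover have "(i div r, i mod r) = (k div r, k mod r) \<longleftrightarrow> i = k" for i k
        by (metis div_mult_mod_eq prod.inject)
      ultimately have "e0 i k = (if i = k then 1 else 0)" if "i < d * r" "k < d * r" for i k
        unfolding e0_e using that by (simp add: e'_def)
      then show ?thesis by blast
    qed
  qed
qed

section \<open>Back to rational modules and the product over the sequence\<close>

lemma rational_module_iff:
  fixes G :: "'k::field mat set"
  assumes G: "subgroup G (GL n)"
  shows "rational_module n G M \<longleftrightarrow>
    (\<forall>g\<in>G. act M g \<in> carrier_mat (deg M) (deg M)) \<and> matrix_coeffs n G (deg M) (rep_coeff M)"
proof
  let ?d = "deg M"
  assume "rational_module n G M"
  then have hom: "alg_hom n G ?d (carrier (GL ?d)) (act M)" by (simp add: rational_module_def)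
  note GLd = group.subgroup_self[OF group_GL[of ?d]]
  have carr: "act M g \<in> carrier_mat ?d ?d" if "g \<in> G" for g
    using alg_homD(1)[OF hom that] by (simp add: carrier_GL)
  moreover have "matrix_coeffs n G ?d (rep_coeff M)"
    unfolding matrix_coeffs_def
  proof (intro conjI allI impI ballI)
    fix i k assume ik: "i < ?d" "k < ?d"
    show "regular n G (rep_coeff M i k)" by (rule alg_homD(3)[OF hom ik])
    show "act M (1\<^sub>m n) $$ (i, k) = (if i = k then 1 else 0)"
      unfolding alg_hom_one[OF G GLd hom] using ik by simp
    show "act M (g * h) $$ (i, k) = (\<Sum>j<?d. act M g $$ (i, j) * act M h $$ (j, k))" if "g \<in> G" "h \<in> G" for g h
      unfolding alg_homD(2)[OF hom that] using ik carr[OF that(1)] carr[OF that(2)]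
      by (auto simp: scalar_prod_def atLeast0LessThan)
  qed
  ultimately show "(\<forall>g\<in>G. act M g \<in> carrier_mat ?d ?d) \<and> matrix_coeffs n G ?d (rep_coeff M)" by blast
next
  let ?d = "deg M"
  assume *: "(\<forall>g\<in>G. act M g \<in> carrier_mat ?d ?d) \<and> matrix_coeffs n G ?d (rep_coeff M)"
  then have carr: "\<And>g. g \<in> G \<Longrightarrow> act M g \<in> carrier_mat ?d ?d" and v: "matrix_coeffs n G ?d (rep_coeff M)" by auto
  have mult: "act M (g * h) = act M g * act M h" if "g \<in> G" "h \<in> G" for g h
    using carr[OF that(1)] carr[OF that(2)] carr[OF subgroup_GLD(4)[OF G that]] matrix_coeffsD(3)[OF v that]
    by (intro eq_matI) (auto simp: scalar_prod_def atLeast0LessThan)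
  have one: "act M (1\<^sub>m n) = 1\<^sub>m ?d"
    using carr[OF subgroup_GLD(3)[OF G]] matrix_coeffsD(2)[OF v] by (intro eq_matI) auto
  \<comment> \<open>Invertibility is automatic: the inverse matrix is the action of the inverse of
    \<open>g\<close>.\<close>
  have "act M g \<in> carrier (GL ?d)" if g: "g \<in> G" for g
    unfolding carrier_GL
    using carr[OF g] carr[OF subgroup_GLD(5)[OF G g]] mat_inv_simps(2,3)[OF subgroup_GLD(1)[OF G g]]
      mult[OF g subgroup_GLD(5)[OF G g]] mult[OF subgroup_GLD(5)[OF G g] g] one
    by (intro conjI bexI[of _ "act M (mat_inv n g)"]) simp_all
  then show "rational_module n G M"
    unfolding rational_module_def alg_hom_def using mult matrix_coeffsD(1)[OF v] by (auto simp: hom_def mult_GL)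
qed

text \<open>A decomposition yields the projection \<open>E\<close> onto the first summand, whose
  conjugate \<open>X\<close> is an idempotent commuting with \<open>M\<close>. If \<open>X\<close>
  is \<open>0\<close> or \<open>1\<close>, so is \<open>E\<close>, and the first or the second block
  is empty.\<close>

lemma indecomposable_if_trivial_idempotents:
  fixes G :: "'k::field mat set"
  assumes G: "subgroup G (GL n)" and M: "rational_module n G M" "deg M \<noteq> 0"
    and triv: "trivial_idempotents G (deg M) (rep_coeff M)"
  shows "indecomposable n G M"
  unfolding indecomposable_def
proof (intro conjI M allI impI, elim conjE)
  fix M1 M2
  assume M1: "rational_module n G M1" and M2: "rational_module n G M2" and iso: "rep_iso G M (rep_sum M1 M2)"
  let ?d = "deg M" and ?d1 = "deg M1" and ?d2 = "deg M2"
  have d: "?d = ?d1 + ?d2" using iso by (simp add: rep_iso_def rep_sum_def)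
  obtain P where P: "P \<in> carrier (GL ?d)" "\<And>g. g \<in> G \<Longrightarrow> P * act M g = act (rep_sum M1 M2) g * P"
    using iso by (auto simp: rep_iso_def)
  define Q where "Q = mat_inv ?d P"
  have Pc: "P \<in> carrier_mat ?d ?d" and Qc: "Q \<in> carrier_mat ?d ?d"
    using P(1) mat_inv_simps(1)[OF P(1)] by (auto simp: carrier_GL Q_def)
  have PQ: "P * Q = 1\<^sub>m ?d" "Q * P = 1\<^sub>m ?d"
    using mat_inv_simps(2,3)[OF P(1)] by (auto simp: Q_def)
  define E where "E = four_block_mat (1\<^sub>m ?d1) (0\<^sub>m ?d1 ?d2) (0\<^sub>m ?d2 ?d1) (0\<^sub>m ?d2 ?d2 :: 'k mat)"
  have Ec: "E \<in> carrier_mat ?d ?d" by (simp add: E_def d)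
  have EE: "E * E = E"
    unfolding E_def by (subst mult_four_block_mat[where ?nr1.0 = ?d1 and ?n1.0 = ?d1 and ?n2.0 = ?d2 and ?nr2.0 = ?d2 and ?nc1.0 = ?d1 and ?nc2.0 = ?d2]) auto
  define R where "R g = act (rep_sum M1 M2) g" for g
  have act1: "act M1 g \<in> carrier_mat ?d1 ?d1" and act2: "act M2 g \<in> carrier_mat ?d2 ?d2"
    and actM: "act M g \<in> carrier_mat ?d ?d" if "g \<in> G" for g
    using M1 M2 M(1) that by (auto simp: rational_module_iff[OF G])
  have Rc: "R g \<in> carrier_mat ?d ?d" and ER: "E * R g = R g * E" if g: "g \<in> G" for g
  proof -
    show "R g \<in> carrier_mat ?d ?d" using act1[OF g] act2[OF g] by (simp add: R_def rep_sum_def d)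
    show "E * R g = R g * E"
      unfolding R_def rep_sum_def E_def rep.sel using act1[OF g] act2[OF g]
      by (subst (1 2) mult_four_block_mat[where ?nr1.0 = ?d1 and ?n1.0 = ?d1 and ?n2.0 = ?d2 and ?nr2.0 = ?d2 and ?nc1.0 = ?d1 and ?nc2.0 = ?d2]) auto
  qed
  have QR: "Q * R g = act M g * Q" if g: "g \<in> G" for g
  proof -
    have "Q * R g = Q * R g * (P * Q)" using Qc Rc[OF g] PQ(1) by simp
    also have "\<dots> = Q * (R g * P) * Q" using Qc Rc[OF g] Pc by (simp add: assoc_mult_mat[of _ ?d ?d _ ?d _ ?d])
    also have "\<dots> = Q * (P * act M g) * Q" using P(2)[OF g] by (simp add: R_def)
    also have "\<dots> = (Q * P) * act M g * Q" using Qc Pc actM[OF g] by (simp add: assoc_mult_mat[of _ ?d ?d _ ?d _ ?d])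
    finally show ?thesis using PQ(2) actM[OF g] by simp
  qed
  define X where "X = Q * E * P"
  have Xc: "X \<in> carrier_mat ?d ?d" using Qc Ec Pc by (simp add: X_def)
  note assoc = assoc_mult_mat[of _ ?d ?d _ ?d _ ?d]
  have XX: "X * X = X"
  proof -
    have "X * X = Q * E * (P * Q) * E * P" using Qc Ec Pc by (simp add: X_def assoc)
    also have "\<dots> = Q * (E * E) * P" using Qc Ec Pc by (simp add: PQ assoc)
    finally show ?thesis by (simp add: EE X_def)
  qed
  have X_comm: "X * act M g = act M g * X" if g: "g \<in> G" for g
  proof -
    have "X * act M g = Q * E * (P * act M g)" using Qc Ec Pc actM[OF g] by (simp add: X_def assoc)
    also have "\<dots> = Q * (E * R g) * P" unfolding P(2)[OF g] using Qc Ec Pc Rc[OF g] by (simp add: R_def assoc)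
    also have "\<dots> = (Q * R g) * E * P" unfolding ER[OF g] using Qc Ec Pc Rc[OF g] by (simp add: assoc)
    also have "\<dots> = act M g * X" unfolding QR[OF g] using Qc Ec Pc actM[OF g] by (simp add: X_def assoc)
    finally show ?thesis .
  qed
  have entry: "(A * B) $$ (i, k) = (\<Sum>j<?d. A $$ (i, j) * B $$ (j, k))"
    if "A \<in> carrier_mat ?d ?d" "B \<in> carrier_mat ?d ?d" "i < ?d" "k < ?d" for A B :: "'k mat" and i k
    using that by (auto simp: scalar_prod_def atLeast0LessThan)
  have "(\<forall>i<?d. \<forall>k<?d. (\<Sum>j<?d. X $$ (i, j) * X $$ (j, k)) = X $$ (i, k)) \<and>
    (\<forall>g\<in>G. \<forall>i<?d. \<forall>k<?d. (\<Sum>j<?d. X $$ (i, j) * act M g $$ (j, k)) = (\<Sum>j<?d. act M g $$ (i, j) * X $$ (j, k)))"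
  proof (intro conjI ballI allI impI)
    fix i k assume ik: "i < ?d" "k < ?d"
    show "(\<Sum>j<?d. X $$ (i, j) * X $$ (j, k)) = X $$ (i, k)"
      unfolding entry[OF Xc Xc ik, symmetric] XX ..
    show "(\<Sum>j<?d. X $$ (i, j) * act M g $$ (j, k)) = (\<Sum>j<?d. act M g $$ (i, j) * X $$ (j, k))" if g: "g \<in> G" for g
      unfolding entry[OF Xc actM[OF g] ik, symmetric] entry[OF actM[OF g] Xc ik, symmetric] X_comm[OF g] ..
  qed
  from mp[OF spec[OF triv[unfolded trivial_idempotents_def], of "\<lambda>i j. X $$ (i, j)"] this]
  consider "\<forall>i<?d. \<forall>k<?d. X $$ (i, k) = 0" | "\<forall>i<?d. \<forall>k<?d. X $$ (i, k) = (if i = k then 1 else 0)"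
    by blast
  then have "X = 0\<^sub>m ?d ?d \<or> X = 1\<^sub>m ?d"
  proof cases
    case 1
    then have "X = 0\<^sub>m ?d ?d" using Xc by (intro eq_matI) auto
    then show ?thesis by blast
  next
    case 2
    then have "X = 1\<^sub>m ?d" using Xc by (intro eq_matI) auto
    then show ?thesis by blast
  qed
  moreover have E_X: "E = P * X * Q"
  proof -
    have "P * X * Q = (P * Q) * E * (P * Q)" using Qc Ec Pc by (simp add: X_def assoc)
    then show ?thesis using Ec by (simp add: PQ)
  qed
  ultimately consider "E = 0\<^sub>m ?d ?d" | "E = 1\<^sub>m ?d"
    using Pc Qc PQ by fastforce
  then show "?d1 = 0 \<or> ?d2 = 0"
  proof cases
    case 1
    have "?d1 = 0"
    proof (rule ccontr)
      assume "?d1 \<noteq> 0"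
      then have "E $$ (0, 0) = 1" by (simp add: E_def)
      then show False using 1 M(2) by simp
    qed
    then show ?thesis by blast
  next
    case 2
    have "?d2 = 0"
    proof (rule ccontr)
      assume "?d2 \<noteq> 0"
      then have "E $$ (?d1, ?d1) = 0" "?d1 < ?d" by (simp_all add: E_def d)
      then show False using 2 by simp
    qed
    then show ?thesis by blast
  qed
qed

lemma rational_module_twist:
  fixes G :: "'k::field mat set"
  assumes G: "subgroup G (GL n)" and F: "alg_hom n G n G F" and M: "rational_module n G M"
  shows "rational_module n G (twist F (Suc 0) M)"
  using alg_hom_comp[OF G G F, of "deg M" "carrier (GL (deg M))" "act M"] M
  by (simp add: rational_module_def twist_def)

lemma rational_module_tensor:
  fixes G :: "'k::field mat set"
  assumes G: "subgroup G (GL n)" and M: "rational_module n G M" and N: "rational_module n G N"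
  shows "rational_module n G (rep_tensor M N)"
  using M N matrix_coeffs_tensor[of n G "deg M" "rep_coeff M" "deg N" "rep_coeff N"]
  unfolding rational_module_iff[OF G]
  by (auto simp: rep_tensor_def intro: matrix_coeffs_cong[OF G])

lemma rational_module_trivial:
  fixes G :: "'k::field mat set"
  assumes G: "subgroup G (GL n)"
  shows "rational_module n G rep_trivial"
  unfolding rational_module_iff[OF G] by (auto simp: rep_trivial_def matrix_coeffs_def intro: regular_const)

lemma trivial_idempotents_rep_trivial:
  "trivial_idempotents G (deg rep_trivial) (rep_coeff rep_trivial)"
  by (auto simp: trivial_idempotents_def rep_trivial_def)

lemma twist_zero: "twist F 0 M = M"
  by (cases M) (simp add: twist_def)

text \<open>Twisting commutes with tensor products and raises each exponent by one, so the tail of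
  the product is a single twist of a product of the same shape.\<close>

lemma twist_tensor_list:
  "twist F (Suc 0) (rep_tensor_list (map (\<lambda>j. twist F j (M j)) js)) =
   rep_tensor_list (map (\<lambda>j. twist F (Suc j) (M j)) js)"
proof (induction js)
  case Nil
  then show ?case by (simp add: rep_tensor_list_def twist_def rep_trivial_def)
next
  case (Cons j js)
  have "twist F (Suc 0) (rep_tensor A B) = rep_tensor (twist F (Suc 0) A) (twist F (Suc 0) B)" for A B
    by (simp add: twist_def rep_tensor_def)
  moreover have "twist F (Suc 0) (twist F j A) = twist F (Suc j) A" for A
    by (simp add: twist_def funpow_swap1)
  ultimately show ?case using Cons by (simp add: rep_tensor_list_def)
qed

context frobenius_setting
begin

lemma trivial_idempotents_rep_tensor_twist:
  assumes M: "rational_module n G M" and N: "rational_module n G N"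
    and socle: "scheme_simple_submodule ideal M (scheme_socle ideal M)"
    and triv: "trivial_idempotents G (deg N) (rep_coeff N)"
  shows "trivial_idempotents G (deg (rep_tensor M (twist F (Suc 0) N))) (rep_coeff (rep_tensor M (twist F (Suc 0) N)))"
proof -
  have v: "matrix_coeffs n G (deg M) (rep_coeff M)" and \<nu>: "matrix_coeffs n G (deg N) (rep_coeff N)"
    and act: "\<And>g. g \<in> G \<Longrightarrow> act M g \<in> carrier_mat (deg M) (deg M)"
    using M N by (auto simp: rational_module_iff[OF G])
  have "trivial_idempotents G (deg M * deg N) (tensor_coeffs (deg N) (rep_coeff M) (\<lambda>a b g. rep_coeff N a b (F g)))"
  proof (rule simple_scheme_socle[OF ideal_subspace ideal_cong act socle])
    fix S assume "simple_subspace ideal {..<deg M} (rep_coeff M) S"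
      "\<And>X. simple_subspace ideal {..<deg M} (rep_coeff M) X \<Longrightarrow> X \<subseteq> S"
    then show ?thesis by (rule trivial_idempotents_tensor[OF v \<nu> _ _ triv])
  qed
  then have "trivial_idempotents G (deg M * deg N) (rep_coeff (rep_tensor M (twist F (Suc 0) N)))"
    by (rule trivial_idempotents_cong[rotated]) (simp add: rep_tensor_def twist_def)
  moreover have "deg (rep_tensor M (twist F (Suc 0) N)) = deg M * deg N"
    by (simp add: rep_tensor_def twist_def)
  ultimately show ?thesis by (simp only:)
qed

text \<open>Induction on the length with the first factor split off; the sequence \<open>M\<close>
  is generalized because the tail belongs to the shifted sequence \<open>M (Suc j)\<close>.\<close>

lemma twisted_tensor_list:
  assumes "\<And>j. j < l \<Longrightarrow> rational_module n G (M j) \<and> deg (M j) \<noteq> 0 \<and>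
    scheme_simple_submodule ideal (M j) (scheme_socle ideal (M j))"
  defines "N \<equiv> rep_tensor_list (map (\<lambda>j. twist F j (M j)) [0..<l])"
  shows "rational_module n G N \<and> deg N \<noteq> 0 \<and> trivial_idempotents G (deg N) (rep_coeff N)"
  using assms(1) unfolding N_def
proof (induction l arbitrary: M)
  case 0
  have "rep_tensor_list (map (\<lambda>j. twist F j (M j)) [0..<0]) = rep_trivial" by (simp add: rep_tensor_list_def)
  then show ?case
    using rational_module_trivial[OF G] trivial_idempotents_rep_trivial[of G] by (simp add: rep_trivial_def)
next
  case (Suc l)
  let ?N = "rep_tensor_list (map (\<lambda>j. twist F j (M (Suc j))) [0..<l])"
  \<comment> \<open>The interval is opened at its front, whereas the default rule would append the
    last index.\<close>
  have "[0..<Suc l] = 0 # map Suc [0..<l]" by (simp add: upt_conv_Cons map_Suc_upt del: upt_Suc)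
  then have eq: "rep_tensor_list (map (\<lambda>j. twist F j (M j)) [0..<Suc l]) = rep_tensor (M 0) (twist F (Suc 0) ?N)"
    unfolding twist_tensor_list[of F "\<lambda>j. M (Suc j)"] by (simp add: rep_tensor_list_def twist_zero comp_def)
  have N: "rational_module n G ?N \<and> deg ?N \<noteq> 0 \<and> trivial_idempotents G (deg ?N) (rep_coeff ?N)"
    by (rule Suc.IH) (use Suc.prems in simp)
  have "deg (rep_tensor (M 0) (twist F (Suc 0) ?N)) \<noteq> 0"
    using N Suc.prems[of 0] by (simp add: rep_tensor_def twist_def)
  then show ?case
    unfolding eq
    using N Suc.prems[of 0] rational_module_tensor[OF G _ rational_module_twist[OF G alg_hom_F]]
      trivial_idempotents_rep_tensor_twist by blast
qed

end

theorem lemma1p1: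
  fixes n :: nat
    and G B T :: "'k::alg_closed_field mat set"
    and F :: "'k mat \<Rightarrow> 'k mat"
    and m :: nat
    and I :: "nat \<Rightarrow> 'k rep"
  assumes char_pos: "CHAR('k) > 0"
    and ss: "semisimple n G"
    and borel: "borel_subgroup n G B"
    and max_torus: "maximal_torus n G T" "T \<subseteq> B"
    and sc: "simply_connected n G B T"
    and frob: "frobenius n G T F"
    and p_large_or_unique:
      "int CHAR('k) \<ge> 2 * coxeter_number n G B T - 2 \<or>
       (int CHAR('k) < 2 * coxeter_number n G B T - 2 \<longrightarrow>
        (\<forall>\<mu> \<in> restricted_weights n G B T. \<forall>L Q.
           is_L n G B T \<mu> L \<and> scheme_injective_hull n G (G1T_ideal n G T F) L Q \<longrightarrow>
           unique_G_structure n G (G1T_ideal n G T F) Q))"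
    and members: "\<And>j. j \<le> m \<Longrightarrow> in_F n G B T (I j)"
    and socles: "\<And>j. j \<le> m \<Longrightarrow> simple_G1T_socle_restricted n G B T F (I j)"
  shows "indecomposable n G (rep_tensor_list (map (\<lambda>j. twist F j (I j)) [0..<Suc m]))"
proof -
  interpret frobenius_setting n G T F
    by (rule frobenius_setting.intro) (use char_pos ss max_torus frob in
        \<open>simp_all add: semisimple_def closed_subgroup_def maximal_torus_def\<close>)
  have "rational_module n G (I j) \<and> deg (I j) \<noteq> 0 \<and>
      scheme_simple_submodule ideal (I j) (scheme_socle ideal (I j))" if "j < Suc m" for j
    using members[of j] socles[of j] that
    by (simp add: in_F_def indecomposable_def simple_G1T_socle_restricted_def Let_def)
  from twisted_tensor_list[of "Suc m" I, OF this] show ?thesis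
    using indecomposable_if_trivial_idempotents[OF G] by blast
qed

end
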